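(* Let $\mathbf{D}$ be a compact connected subset of $\mathbb{R}^d$, let $\mathbf{X}$ be an open connected subset of $\mathbb{R}^d$ containing $\mathbf{D}$, and let $H=L^2(\mathbf{D},\mathbb{H})$. Let $E(\boldsymbol{\omega},\mathbf{x})$ be an $\mathbb{H}$-valued continuous function defined on $\mathbf{X}^2\subset\mathbb{R}^{2d}$ satisfying the following conditions: (i) $E(\boldsymbol{\omega},\mathbf{x})=E(\mathbf{x},\boldsymbol{\omega})$ for every $(\boldsymbol{\omega},\mathbf{x})\in\mathbf{X}^2$; (ii) $A=\{E(\cdot,\mathbf{x})\}_{\mathbf{x}\in\mathbf{X}}\subset H$ and $A^\perp=\{0\}$ in $H$; (iii) $S(\mathbf{x},\mathbf{y}):=\int_{\mathbf{D}}E(\boldsymbol{\omega},\mathbf{y})\overline{E(\boldsymbol{\omega},\mathbf{x})}\,d\boldsymbol{\omega}\in\mathbb{R}$ for every $(\mathbf{x},\mathbf{y})\in\mathbf{X}^2$; (iv) $\int_{\mathbf{D}}E(\boldsymbol{\omega},\mathbf{y})\overline{E(\boldsymbol{\omega},\mathbf{x})}\,d\boldsymbol{\omega}=\int_{\mathbf{D}}\overline{E(\boldsymbol{\omega},\mathbf{x})}E(\boldsymbol{\omega},\mathbf{y})\,d\boldsymbol{\omega}$ for every $(\mathbf{x},\mathbf{y})\in\mathbf{X}^2$. Let $\mathcal{T}$ be the integral transform $(\mathcal{T}F)(\mathbf{x})=\int_{\mathbf{D}}F(\boldsymbol{\omega})\overline{E(\boldsymbol{\omega},\mathbf{x})}\,d\boldsymbol{\omega}$,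 $F\in H$, $\mathbf{x}\in\mathbf{X}$, and let $\mathcal{H}$ be its range, with the inner product $(\cdot,\cdot)_{\mathcal{H}}$ described in the context. Then there are a countably infinite set of $\mathbb{H}$-valued functions $\{\phi_n(\mathbf{x})\}_{n=1}^\infty$ on $\mathbf{X}$ (called quaternionic prolate spheroidal wave functions) and quaternions $\lambda_1,\lambda_2,\dots$ with $|\lambda_1|\geq|\lambda_2|\geq\cdots$ having the following properties: 1. The $\phi_n$ ($n=1,2,\dots$) are $\mathbf{D}$-bandlimited in the sense of the transformation $\mathcal{T}$, and are orthonormal and complete in $\mathcal{H}$: $(\phi_m,\phi_n)_{\mathcal{H}}=\delta_{mn}$. 2. The $\phi_n$ ($n=1,2,\dots$) are orthogonal and complete in $L^2(\mathbf{D},\mathbb{H})$: $\int_{\mathbf{D}}\phi_m(\boldsymbol{\omega})\overline{\phi_n(\boldsymbol{\omega})}\,d\boldsymbol{\omega}=\mu_n\delta_{mn}$, with $\mu_n=|\lambda_n|^2$. 3. For every $\mathbf{x}\in\mathbf{X}$ and every $n$, $$\int_{\mathbf{D}}\phi_n(\boldsymbol{\omega})\overline{E(\boldsymbol{\omega},\mathbf{x})}\,d\boldsymbol{\omega}=\lambda_n\phi_n(\mathbf{x}),\qquad \int_{\mathbf{D}}\phi_n(\mathbf{y})S(\mathbf{x},\mathbf{y})\,d\mathbf{y}=\mu_n\phi_n(\mathbf{x}).$$ 4. The $\phi_n$ are uniformly continuous on every compact subset $\mathbf{X}_1$ of $\mathbf{X}$; hence each $\phi_n$ is continuous on $\mathbf{X}$.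 5. $E$ and $S$ can be expanded as $$E(\boldsymbol{\omega},\mathbf{x})=\sum_{n=1}^\infty\overline{\phi_n(\mathbf{x})}\lambda_n^{-1}\phi_n(\boldsymbol{\omega}),\quad(\boldsymbol{\omega},\mathbf{x})\in\mathbf{D}\times\mathbf{X};\qquad S(\mathbf{x},\mathbf{y})=\sum_{n=1}^\infty\overline{\phi_n(\mathbf{y})}\phi_n(\mathbf{x}),\quad(\mathbf{x},\mathbf{y})\in\mathbf{X}^2.$$ For any fixed $\mathbf{x}\in\mathbf{X}$ the first series converges in the norm (of $L^2(\mathbf{D},\mathbb{H})$ in the variable $\boldsymbol{\omega}$). The second series converges absolutely on $\mathbf{X}\times\mathbf{X}$. Furthermore, if $E(\boldsymbol{\omega},\mathbf{x})$ is bounded on $\mathbf{D}\times\mathbf{X}$, then the second series converges uniformly on $\mathbf{X}_1\times\mathbf{X}_2$ for any compact subsets $\mathbf{X}_1,\mathbf{X}_2$ of $\mathbf{X}$. 6. If there exists a sequence of points $\{\mathbf{x}_n\}_{n=1}^\infty\subset\mathbf{X}$ such that $\{E(\cdot,\mathbf{x}_n)\}$ is an orthonormal basis of $L^2(\mathbf{D},\mathbb{H})$, then for any $f\in\mathcal{H}$ and $\mathbf{x}\in\mathbf{X}$, $$f(\mathbf{x})=\sum_{n=1}^\infty f(\mathbf{x}_n)S(\mathbf{x},\mathbf{x}_n),\qquad f(\mathbf{x})=\sum_{n=1}^\infty\left(\sum_{m=1}^\infty f(\mathbf{x}_m)\overline{\phi_n(\mathbf{x}_m)}\right)\phi_n(\mathbf{x}).$$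 7. With $\{\mathbf{x}_n\}$ a sequence as in item 6 (when one exists), the functions $\phi_n$ satisfy the discrete orthogonality relation $\sum_{n=1}^\infty\overline{\phi_n(\mathbf{x}_l)}\phi_n(\mathbf{x}_m)=\delta_{ml}$; moreover $\int_{\mathbf{D}}S(\mathbf{x},\mathbf{x})\,d\mathbf{x}=\sum_{n=1}^\infty\mu_n$. 8. For $f\in\mathcal{H}$ with $\|f\|_{\mathcal{H}}\neq 0$ put $\beta_f=\|f\|_H^2/\|f\|_{\mathcal{H}}^2$, where $\|f\|_H^2=\int_{\mathbf{D}}|f(\mathbf{x})|^2\,d\mathbf{x}$. If $\widetilde{\beta}=\sup\{\beta_f: f\in\mathcal{H},\ \|f\|_{\mathcal{H}}\neq 0\}$, then $\widetilde{\beta}=\mu_1$.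
   Context: $\mathbb{H}$ denotes the skew field of (Hamilton) quaternions, with conjugation $q\mapsto\overline{q}$ and norm $|q|$, $|q|^2=q\overline{q}$. A left quaternionic Hilbert space is a left $\mathbb{H}$-module with an $\mathbb{H}$-valued inner product satisfying $(u,v)=\overline{(v,u)}$, $(pu+qv,w)=p(u,w)+q(v,w)$, $(u,u)\ge 0$ real and zero only for $u=0$, complete for the norm $\|u\|=(u,u)^{1/2}$. $L^2(\mathbf{D},\mathbb{H})$ is the left quaternionic Hilbert space of $\mathbb{H}$-valued functions on $\mathbf{D}$ with $\int_{\mathbf{D}}|f|^2<\infty$ (Lebesgue measure, modulo a.e. equality), with inner product $(f,g)_H=\int_{\mathbf{D}}f(\boldsymbol{\omega})\overline{g(\boldsymbol{\omega})}\,d\boldsymbol{\omega}$ and norm $\|f\|_H$ given by $\|f\|_H^2=(f,f)_H$. For $A\subset H$, $A^\perp=\{u\in H:(u,v)_H=0\ \forall v\in A\}$. An orthonormal basis is an orthonormal set whose left $\mathbb{H}$-linear span is dense; "complete" for an orthogonal system means that its left $\mathbb{H}$-linear span is dense. The space $\mathcal{H}=\{\mathcal{T}F:F\in H\}$ consists of $\mathbb{H}$-valued functions on $\mathbf{X}$; its inner product is $(\mathcal{T}F,\mathcal{T}G)_{\mathcal{H}}=(P_MF,P_MG)_H$, where $M=N^\perp$, $N$ is the null space of $\mathcal{T}:H\to\{\text{functions on }\mathbf{X}\}$, and $P_M$ is the orthogonal projection of $H$ onto $M$; with it $\mathcal{H}$ is a left quaternionic Hilbert space, and $\|f\|_{\mathcal{H}}^2=(f,f)_{\mathcal{H}}$.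 A function on $\mathbf{X}$ is "$\mathbf{D}$-bandlimited in the sense of the transformation $\mathcal{T}$" if it is of the form $\mathcal{T}F$ for some $F\in L^2(\mathbf{D},\mathbb{H})$, i.e. belongs to $\mathcal{H}$. When functions on $\mathbf{X}$ are considered as elements of $L^2(\mathbf{D},\mathbb{H})$, they are restricted to $\mathbf{D}$.
   Formalization: Two hypotheses are added, without which the claim fails: D has positive Lebesgue measure, and T followed by restriction to D is injective on L^2(D,H), i.e. TF=0 a.e. on D implies F=0 a.e. on D. *)

theory Defs
  imports "HOL-Analysis.Analysis"
begin

section \<open>The skew field of quaternions\<close>

datatype quat = Quat (q0: real) (q1: real) (q2: real) (q3: real)

lemma quat_eq_iff: "x = y \<longleftrightarrow> q0 x = q0 y \<and> q1 x = q1 y \<and> q2 x = q2 y \<and> q3 x = q3 y"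
  by (cases x; cases y) simp

instantiation quat :: ab_group_add
begin

definition zero_quat :: quat where "0 = Quat 0 0 0 0"
definition plus_quat :: "quat \<Rightarrow> quat \<Rightarrow> quat"
  where "x + y = Quat (q0 x + q0 y) (q1 x + q1 y) (q2 x + q2 y) (q3 x + q3 y)"
definition uminus_quat :: "quat \<Rightarrow> quat"
  where "- x = Quat (- q0 x) (- q1 x) (- q2 x) (- q3 x)"
definition minus_quat :: "quat \<Rightarrow> quat \<Rightarrow> quat"
  where "x - y = Quat (q0 x - q0 y) (q1 x - q1 y) (q2 x - q2 y) (q3 x - q3 y)"

instance
  by standard (simp_all add: quat_eq_iff zero_quat_def plus_quat_def uminus_quat_def minus_quat_def)

end

lemma quat_zero_sel [simp]: "q0 0 = 0" "q1 0 = 0" "q2 0 = 0" "q3 0 = 0"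
  by (simp_all add: zero_quat_def)

lemma quat_plus_sel [simp]:
  "q0 (x + y) = q0 x + q0 y" "q1 (x + y) = q1 x + q1 y"
  "q2 (x + y) = q2 x + q2 y" "q3 (x + y) = q3 x + q3 y"
  by (simp_all add: plus_quat_def)

lemma quat_uminus_sel [simp]:
  "q0 (- x) = - q0 x" "q1 (- x) = - q1 x" "q2 (- x) = - q2 x" "q3 (- x) = - q3 x"
  by (simp_all add: uminus_quat_def)

lemma quat_minus_sel [simp]:
  "q0 (x - y) = q0 x - q0 y" "q1 (x - y) = q1 x - q1 y"
  "q2 (x - y) = q2 x - q2 y" "q3 (x - y) = q3 x - q3 y"
  by (simp_all add: minus_quat_def)

instantiation quat :: ring_1
begin

definition one_quat :: quat where "1 = Quat 1 0 0 0"
definition times_quat :: "quat \<Rightarrow> quat \<Rightarrow> quat"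
  where "x * y = Quat
    (q0 x * q0 y - q1 x * q1 y - q2 x * q2 y - q3 x * q3 y)
    (q0 x * q1 y + q1 x * q0 y + q2 x * q3 y - q3 x * q2 y)
    (q0 x * q2 y - q1 x * q3 y + q2 x * q0 y + q3 x * q1 y)
    (q0 x * q3 y + q1 x * q2 y - q2 x * q1 y + q3 x * q0 y)"

instance
  by standard (simp_all add: quat_eq_iff one_quat_def times_quat_def algebra_simps)

end

lemma quat_one_sel [simp]: "q0 1 = 1" "q1 1 = 0" "q2 1 = 0" "q3 1 = 0"
  by (simp_all add: one_quat_def)

lemma quat_times_sel [simp]:
  "q0 (x * y) = q0 x * q0 y - q1 x * q1 y - q2 x * q2 y - q3 x * q3 y"
  "q1 (x * y) = q0 x * q1 y + q1 x * q0 y + q2 x * q3 y - q3 x * q2 y"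
  "q2 (x * y) = q0 x * q2 y - q1 x * q3 y + q2 x * q0 y + q3 x * q1 y"
  "q3 (x * y) = q0 x * q3 y + q1 x * q2 y - q2 x * q1 y + q3 x * q0 y"
  by (simp_all add: times_quat_def)

instantiation quat :: real_algebra_1
begin

definition scaleR_quat :: "real \<Rightarrow> quat \<Rightarrow> quat"
  where "scaleR r x = Quat (r * q0 x) (r * q1 x) (r * q2 x) (r * q3 x)"

instance
  by standard (simp_all add: quat_eq_iff scaleR_quat_def algebra_simps)

end

lemma quat_scaleR_sel [simp]:
  "q0 (scaleR r x) = r * q0 x" "q1 (scaleR r x) = r * q1 x"
  "q2 (scaleR r x) = r * q2 x" "q3 (scaleR r x) = r * q3 x"
  by (simp_all add: scaleR_quat_def)

definition qcnj :: "quat \<Rightarrow> quat"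
  where "qcnj x = Quat (q0 x) (- q1 x) (- q2 x) (- q3 x)"

lemma qcnj_sel [simp]:
  "q0 (qcnj x) = q0 x" "q1 (qcnj x) = - q1 x" "q2 (qcnj x) = - q2 x" "q3 (qcnj x) = - q3 x"
  by (simp_all add: qcnj_def)

instantiation quat :: real_inner
begin

definition inner_quat :: "quat \<Rightarrow> quat \<Rightarrow> real"
  where "inner x y = q0 x * q0 y + q1 x * q1 y + q2 x * q2 y + q3 x * q3 y"
definition norm_quat :: "quat \<Rightarrow> real"
  where "norm x = sqrt ((q0 x)\<^sup>2 + (q1 x)\<^sup>2 + (q2 x)\<^sup>2 + (q3 x)\<^sup>2)"
definition quat_sgn_def: "sgn x = x /\<^sub>R norm (x :: quat)"
definition quat_dist_def: "dist x y = norm (x - y :: quat)"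
definition quat_uniformity_def [code del]:
  "(uniformity :: (quat \<times> quat) filter) = (INF e\<in>{0 <..}. principal {(x, y). dist x y < e})"
definition quat_open_def [code del]:
  "open (U :: quat set) \<longleftrightarrow> (\<forall>x\<in>U. eventually (\<lambda>(x', y). x' = x \<longrightarrow> y \<in> U) uniformity)"

instance
proof
  fix x y z :: quat and r :: real and U :: "quat set"
  show "sgn x = x /\<^sub>R norm x" by (rule quat_sgn_def)
  show "dist x y = norm (x - y)" by (rule quat_dist_def)
  show "(uniformity :: (quat \<times> quat) filter) = (INF e\<in>{0 <..}. principal {(x, y). dist x y < e})"
    by (rule quat_uniformity_def)
  show "open U \<longleftrightarrow> (\<forall>x\<in>U. eventually (\<lambda>(x', y). x' = x \<longrightarrow> y \<in> U) uniformity)"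
    by (rule quat_open_def)
  show "inner x y = inner y x" "inner (x + y) z = inner x z + inner y z"
    "inner (scaleR r x) y = r * inner x y"
    by (simp_all add: inner_quat_def algebra_simps)
  show "0 \<le> inner x x" by (simp add: inner_quat_def)
  show "inner x x = 0 \<longleftrightarrow> x = 0"
    by (auto simp: inner_quat_def quat_eq_iff add_nonneg_eq_0_iff)
  show "norm x = sqrt (inner x x)"
    by (simp add: inner_quat_def norm_quat_def power2_eq_square)
qed

end

instantiation quat :: real_normed_div_algebra
begin

definition inverse_quat :: "quat \<Rightarrow> quat"
  where "inverse x = qcnj x /\<^sub>R (norm x)\<^sup>2"
definition divide_quat :: "quat \<Rightarrow> quat \<Rightarrow> quat"
  where "x div y = x * inverse (y :: quat)"

instance
proof
  fix x y :: quat
  have n2: "(norm z)\<^sup>2 = (q0 z)\<^sup>2 + (q1 z)\<^sup>2 + (q2 z)\<^sup>2 + (q3 z)\<^sup>2" for z :: quat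
    by (simp add: norm_quat_def)
  show "inverse (0 :: quat) = 0" by (simp add: inverse_quat_def quat_eq_iff)
  show "x div y = x * inverse y" by (rule divide_quat_def)
  show "norm (x * y) = norm x * norm y"
    unfolding norm_quat_def real_sqrt_mult [symmetric]
    by (rule arg_cong [where f = sqrt]) (simp add: power2_eq_square algebra_simps)
  {
    assume "x \<noteq> 0"
    then have nz: "(norm x)\<^sup>2 \<noteq> 0" by simp
    have "qcnj x * x = (norm x)\<^sup>2 *\<^sub>R 1" "x * qcnj x = (norm x)\<^sup>2 *\<^sub>R 1"
      by (simp_all add: quat_eq_iff n2) (simp_all add: power2_eq_square algebra_simps)
    with nz show "inverse x * x = 1" "x * inverse x = 1"
      by (simp_all add: inverse_quat_def)
  }
qed

end

lemma quat_of_real_sel [simp]: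
  "q0 (of_real r) = r" "q1 (of_real r) = 0" "q2 (of_real r) = 0" "q3 (of_real r) = 0"
  by (simp_all add: of_real_def)

lemma quat_mult_qcnj: "x * qcnj x = of_real ((norm x)\<^sup>2)"
proof -
  have n2: "(norm x)\<^sup>2 = (q0 x)\<^sup>2 + (q1 x)\<^sup>2 + (q2 x)\<^sup>2 + (q3 x)\<^sup>2"
    by (simp add: norm_quat_def)
  show ?thesis
    unfolding n2 quat_eq_iff quat_of_real_sel by (simp add: power2_eq_square)
qed

instantiation quat :: euclidean_space
begin

definition Basis_quat :: "quat set"
  where "Basis = {Quat 1 0 0 0, Quat 0 1 0 0, Quat 0 0 1 0, Quat 0 0 0 1}"

instance
proof
  show "(Basis :: quat set) \<noteq> {}" "finite (Basis :: quat set)"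
    by (simp_all add: Basis_quat_def)
  show "inner u v = (if u = v then 1 else 0)" if "u \<in> Basis" "v \<in> Basis" for u v :: quat
    using that unfolding Basis_quat_def inner_quat_def by (elim insertE emptyE; simp)
  show "(\<forall>u\<in>Basis. inner x u = 0) \<longleftrightarrow> x = 0" for x :: quat
    unfolding Basis_quat_def inner_quat_def quat_eq_iff by auto
qed

end


section \<open>The left quaternionic Hilbert space of square-integrable functions\<close>

text \<open>
  An element of \<open>L\<^sup>2(D, \<bbbH>)\<close> is represented by any of its representatives, a total function of
  which only the restriction to \<open>D\<close> matters; equality in the space is equality almost everywhere
  on \<open>D\<close>.
\<close>

definition L2 :: "'a::euclidean_space set \<Rightarrow> ('a \<Rightarrow> quat) set"
  where "L2 D = {f. f \<in> borel_measurable (lebesgue_on D) \<and>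
                    integrable (lebesgue_on D) (\<lambda>\<omega>. (norm (f \<omega>))\<^sup>2)}"

definition L2_inner :: "'a::euclidean_space set \<Rightarrow> ('a \<Rightarrow> quat) \<Rightarrow> ('a \<Rightarrow> quat) \<Rightarrow> quat"
  where "L2_inner D f g = (LINT \<omega>|lebesgue_on D. f \<omega> * qcnj (g \<omega>))"

definition L2_norm :: "'a::euclidean_space set \<Rightarrow> ('a \<Rightarrow> quat) \<Rightarrow> real"
  where "L2_norm D f = sqrt (q0 (L2_inner D f f))"

definition L2_perp :: "'a::euclidean_space set \<Rightarrow> ('a \<Rightarrow> quat) set \<Rightarrow> ('a \<Rightarrow> quat) set"
  where "L2_perp D A = {u \<in> L2 D. \<forall>v\<in>A. L2_inner D u v = 0}"

text \<open>Orthogonal projection onto a closed subspace \<open>M\<close>; unique up to a.e. equality.\<close>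

definition L2_proj :: "'a::euclidean_space set \<Rightarrow> ('a \<Rightarrow> quat) set \<Rightarrow> ('a \<Rightarrow> quat) \<Rightarrow> ('a \<Rightarrow> quat)"
  where "L2_proj D M F = (SOME u. u \<in> M \<and> (\<lambda>\<omega>. F \<omega> - u \<omega>) \<in> L2_perp D M)"

definition left_span :: "('a \<Rightarrow> quat) set \<Rightarrow> ('a \<Rightarrow> quat) set"
  where "left_span B = {(\<lambda>x. \<Sum>b\<in>A. c b * b x) | A c. finite A \<and> A \<subseteq> B}"

text \<open>Density, in the (semi)norm \<open>nrm\<close>, of the left span of \<open>B\<close> in the space \<open>V\<close>.\<close>

definition complete_system ::
    "('a \<Rightarrow> quat) set \<Rightarrow> (('a \<Rightarrow> quat) \<Rightarrow> real) \<Rightarrow> ('a \<Rightarrow> quat) set \<Rightarrow> bool"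
  where "complete_system V nrm B \<longleftrightarrow>
    B \<subseteq> V \<and> (\<forall>f\<in>V. \<forall>\<epsilon>>0. \<exists>g\<in>left_span B. nrm (\<lambda>x. f x - g x) < \<epsilon>)"

definition L2_orthonormal_basis :: "'a::euclidean_space set \<Rightarrow> (nat \<Rightarrow> 'a \<Rightarrow> quat) \<Rightarrow> bool"
  where "L2_orthonormal_basis D e \<longleftrightarrow>
    (\<forall>m n. L2_inner D (e m) (e n) = (if m = n then 1 else 0)) \<and>
    complete_system (L2 D) (L2_norm D) (range e)"


section \<open>The integral transform and its range\<close>

definition transform ::
    "'a::euclidean_space set \<Rightarrow> ('a \<Rightarrow> 'a \<Rightarrow> quat) \<Rightarrow> ('a \<Rightarrow> quat) \<Rightarrow> 'a \<Rightarrow> quat"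
  where "transform D E F x = (LINT \<omega>|lebesgue_on D. F \<omega> * qcnj (E \<omega> x))"

definition kernel_S :: "'a::euclidean_space set \<Rightarrow> ('a \<Rightarrow> 'a \<Rightarrow> quat) \<Rightarrow> 'a \<Rightarrow> 'a \<Rightarrow> quat"
  where "kernel_S D E x y = (LINT \<omega>|lebesgue_on D. E \<omega> y * qcnj (E \<omega> x))"

text \<open>
  Functions on \<open>X\<close> are total functions whose values outside \<open>X\<close> are irrelevant, so membership in
  the range of the transform is equality on \<open>X\<close> with some \<open>transform D E F\<close>.
\<close>

definition bandlimited ::
    "'a::euclidean_space set \<Rightarrow> 'a set \<Rightarrow> ('a \<Rightarrow> 'a \<Rightarrow> quat) \<Rightarrow> ('a \<Rightarrow> quat) set"
  where "bandlimited D X E = {f. \<exists>F\<in>L2 D. \<forall>x\<in>X. f x = transform D E F x}"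

definition transform_null ::
    "'a::euclidean_space set \<Rightarrow> 'a set \<Rightarrow> ('a \<Rightarrow> 'a \<Rightarrow> quat) \<Rightarrow> ('a \<Rightarrow> quat) set"
  where "transform_null D X E = {F \<in> L2 D. \<forall>x\<in>X. transform D E F x = 0}"

definition preimage ::
    "'a::euclidean_space set \<Rightarrow> 'a set \<Rightarrow> ('a \<Rightarrow> 'a \<Rightarrow> quat) \<Rightarrow> ('a \<Rightarrow> quat) \<Rightarrow> ('a \<Rightarrow> quat)"
  where "preimage D X E f = (SOME F. F \<in> L2 D \<and> (\<forall>x\<in>X. f x = transform D E F x))"

text \<open>
  The value does not depend on the chosen preimages, since two preimages of the same function
  differ by an element of the null space, which the projection onto its complement annihilates.
\<close>

definition band_inner ::
    "'a::euclidean_space set \<Rightarrow> 'a set \<Rightarrow> ('a \<Rightarrow> 'a \<Rightarrow> quat) \<Rightarrow> ('a \<Rightarrow> quat) \<Rightarrow> ('a \<Rightarrow> quat) \<Rightarrow> quat"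
  where "band_inner D X E f g =
    (let M = L2_perp D (transform_null D X E)
     in L2_inner D (L2_proj D M (preimage D X E f)) (L2_proj D M (preimage D X E g)))"

definition band_norm ::
    "'a::euclidean_space set \<Rightarrow> 'a set \<Rightarrow> ('a \<Rightarrow> 'a \<Rightarrow> quat) \<Rightarrow> ('a \<Rightarrow> quat) \<Rightarrow> real"
  where "band_norm D X E f = sqrt (q0 (band_inner D X E f f))"

definition concentration ::
    "'a::euclidean_space set \<Rightarrow> 'a set \<Rightarrow> ('a \<Rightarrow> 'a \<Rightarrow> quat) \<Rightarrow> ('a \<Rightarrow> quat) \<Rightarrow> real"
  where "concentration D X E f = (L2_norm D f)\<^sup>2 / (band_norm D X E f)\<^sup>2"

end

theory Submission
  imports Defs "HOL-Complex_Analysis.Great_Picard"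
begin

text \<open>
  Write \<open>E = E\<^sub>0 + E\<^sub>1 i + E\<^sub>2 j + E\<^sub>3 k\<close> with real symmetric kernels \<open>E\<^sub>a\<close>, and let \<open>T\<^sub>a\<close> be the real
  self-adjoint integral operators on \<open>L\<^sup>2(D, \<real>)\<close> with these kernels. That \<open>S\<close> is real and that the
  two products under the integral may be exchanged are statements about the imaginary components
  of integrals of \<open>E\<^sub>a(\<omega>, x) E\<^sub>b(\<omega>, y)\<close>; added and subtracted, they say exactly that the four
  operators \<open>T\<^sub>a\<close> commute (\<open>component_gram_commute\<close>). The quaternionic problem thus reduces to the
  simultaneous diagonalization of commuting real compact operators: the eigenfunctions can be chosen
  real, and only the eigenvalues are quaternions.

  The real spectral theorem (\<open>simultaneous_diagonalization\<close>) is obtained by maximizing the quadratic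
  form of \<open>\<Sigma>\<^sub>a T\<^sub>a\<^sup>2\<close> on the complement of the eigenfunctions found so far. The maximum is attained
  because a continuous kernel maps the unit ball to an equicontinuous family
  (\<open>max_eigenvector\<close>); within the eigenspace the operators \<open>T\<^sub>a\<close> are diagonalized one after the
  other (\<open>common_eigenvector\<close>). This produces an orthonormal sequence \<open>F\<^sub>n\<close> of real continuous
  functions with \<open>T\<^sub>a F\<^sub>n = t\<^sub>a\<^sub>n F\<^sub>n\<close> and \<open>\<mu>\<^sub>n = \<Sigma>\<^sub>a t\<^sub>a\<^sub>n\<^sup>2\<close> decreasing. It is complete because a
  function orthogonal to all \<open>F\<^sub>n\<close> is annihilated by the injective operator \<open>\<Sigma>\<^sub>a T\<^sub>a\<^sup>2\<close>.

  Since \<open>E\<close> is conjugated in the transform, \<open>\<lambda>\<^sub>n = t\<^sub>0\<^sub>n - t\<^sub>1\<^sub>n i - t\<^sub>2\<^sub>n j - t\<^sub>3\<^sub>n k\<close> satisfies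
  \<open>T F\<^sub>n = \<lambda>\<^sub>n F\<^sub>n\<close> on \<open>D\<close>, and the functions sought are \<open>\<phi>\<^sub>n = T F\<^sub>n\<close> on all of \<open>X\<close>. The transform is
  an isometry onto its range, so the \<open>\<phi>\<^sub>n\<close> are orthonormal there, while on \<open>D\<close> they equal
  \<open>\<lambda>\<^sub>n F\<^sub>n\<close>. As \<open>\<phi>\<^sub>n(x)\<close> is the conjugate of the Fourier coefficient of \<open>E(\<cdot>, x)\<close> with respect to \<open>F\<^sub>n\<close>,
  the expansions of \<open>E\<close> and \<open>S\<close>, the sampling formulas and the discrete orthogonality are all
  instances of Parseval's identity; the trace formula integrates the expansion of \<open>S\<close> along the
  diagonal, and the extremal property holds because \<open>T\<close> multiplies the \<open>n\<close>-th coefficient by \<open>\<lambda>\<^sub>n\<close>.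
\<close>

section \<open>Square-integrable functions\<close>

text \<open>
  Both real-valued and quaternion-valued functions are needed, so the elementary facts are proved
  for values in any normed space.
\<close>

definition sq_int :: "'a measure \<Rightarrow> ('a \<Rightarrow> 'b::{real_normed_vector,second_countable_topology}) set"
  where "sq_int M = {f \<in> borel_measurable M. integrable M (\<lambda>x. (norm (f x))\<^sup>2)}"

lemma sq_int_measurable [measurable_dest]: "f \<in> sq_int M \<Longrightarrow> f \<in> borel_measurable M"
  by (simp add: sq_int_def)

lemma sq_int_integrable: "f \<in> sq_int M \<Longrightarrow> integrable M (\<lambda>x. (norm (f x))\<^sup>2)"
  by (simp add: sq_int_def)

lemma sq_int_real_integrable: "f \<in> sq_int M \<Longrightarrow> integrable M (\<lambda>x. (f x :: real)\<^sup>2)"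
  by (simp add: sq_int_def)

lemma sq_int_dominated:
  fixes f :: "'a \<Rightarrow> 'b::{real_normed_vector,second_countable_topology}"
    and g :: "'a \<Rightarrow> 'c::{real_normed_vector,second_countable_topology}"
  assumes "f \<in> borel_measurable M" "g \<in> sq_int M" "\<And>x. x \<in> space M \<Longrightarrow> norm (f x) \<le> c * norm (g x)"
  shows "f \<in> sq_int M"
proof -
  have [measurable]: "f \<in> borel_measurable M" by fact
  have "integrable M (\<lambda>x. c\<^sup>2 * (norm (g x))\<^sup>2)"
    using sq_int_integrable[OF assms(2)] by simp
  then have "integrable M (\<lambda>x. (norm (f x))\<^sup>2)"
  proof (rule Bochner_Integration.integrable_bound)
    show "AE x in M. norm ((norm (f x))\<^sup>2) \<le> norm (c\<^sup>2 * (norm (g x))\<^sup>2)"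
    proof (intro AE_I2)
      fix x assume "x \<in> space M"
      with assms(3)[of x] have "(norm (f x))\<^sup>2 \<le> (c * norm (g x))\<^sup>2"
        by (intro power_mono) auto
      then show "norm ((norm (f x))\<^sup>2) \<le> norm (c\<^sup>2 * (norm (g x))\<^sup>2)"
        by (simp add: power_mult_distrib)
    qed
  qed measurable
  with assms(1) show ?thesis by (simp add: sq_int_def)
qed

lemma sq_int_norm: "f \<in> sq_int M \<Longrightarrow> (\<lambda>x. norm (f x)) \<in> sq_int M"
  by (auto simp: sq_int_def)

lemma sq_int_zero [simp]: "(\<lambda>x. 0) \<in> sq_int M"
  by (simp add: sq_int_def)

lemma sq_int_add:
  assumes "f \<in> sq_int M" "g \<in> sq_int M"
  shows "(\<lambda>x. f x + g x) \<in> sq_int M"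
proof -
  have [measurable]: "f \<in> borel_measurable M" "g \<in> borel_measurable M"
    using assms by (auto simp: sq_int_def)
  have "integrable M (\<lambda>x. 2 * (norm (f x))\<^sup>2 + 2 * (norm (g x))\<^sup>2)"
    using assms by (auto dest!: sq_int_integrable)
  then have "integrable M (\<lambda>x. (norm (f x + g x))\<^sup>2)"
  proof (rule Bochner_Integration.integrable_bound)
    show "AE x in M. norm ((norm (f x + g x))\<^sup>2) \<le> norm (2 * (norm (f x))\<^sup>2 + 2 * (norm (g x))\<^sup>2)"
    proof (intro AE_I2)
      fix x
      have "(norm (f x + g x))\<^sup>2 \<le> (norm (f x) + norm (g x))\<^sup>2"
        by (intro power_mono norm_triangle_ineq) auto
      also have "\<dots> \<le> 2 * (norm (f x))\<^sup>2 + 2 * (norm (g x))\<^sup>2"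
        using zero_le_power2[of "norm (f x) - norm (g x)"]
        by (simp add: power2_eq_square algebra_simps)
      finally show "norm ((norm (f x + g x))\<^sup>2) \<le> norm (2 * (norm (f x))\<^sup>2 + 2 * (norm (g x))\<^sup>2)"
        by simp
    qed
  qed measurable
  then show ?thesis by (simp add: sq_int_def)
qed

lemma sq_int_cmult_left:
  fixes f :: "'a \<Rightarrow> 'b::{real_normed_algebra,second_countable_topology}"
  assumes "f \<in> sq_int M" shows "(\<lambda>x. c * f x) \<in> sq_int M"
  using assms
  by (intro sq_int_dominated[OF _ assms, of _ "norm c"]) (auto simp: sq_int_measurable norm_mult_ineq)

lemma sq_int_uminus: "f \<in> sq_int M \<Longrightarrow> (\<lambda>x. - f x) \<in> sq_int M"
  by (simp add: sq_int_def)

lemma sq_int_diff: "f \<in> sq_int M \<Longrightarrow> g \<in> sq_int M \<Longrightarrow> (\<lambda>x. f x - g x) \<in> sq_int M"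
  using sq_int_add[OF _ sq_int_uminus, of f M g] by simp

lemma sq_int_sum: "(\<And>i. i \<in> I \<Longrightarrow> f i \<in> sq_int M) \<Longrightarrow> (\<lambda>x. \<Sum>i\<in>I. f i x) \<in> sq_int M"
  by (induction I rule: infinite_finite_induct) (auto intro: sq_int_add)

lemma sq_int_mult_integrable:
  fixes f g :: "'a \<Rightarrow> 'b::{banach,real_normed_algebra,second_countable_topology}"
  assumes "f \<in> sq_int M" "g \<in> sq_int M"
  shows "integrable M (\<lambda>x. f x * g x)"
proof -
  have [measurable]: "f \<in> borel_measurable M" "g \<in> borel_measurable M"
    using assms by (auto simp: sq_int_def)
  have "integrable M (\<lambda>x. (norm (f x))\<^sup>2 + (norm (g x))\<^sup>2)"
    using assms by (auto dest!: sq_int_integrable)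
  then show ?thesis
  proof (rule Bochner_Integration.integrable_bound)
    show "AE x in M. norm (f x * g x) \<le> norm ((norm (f x))\<^sup>2 + (norm (g x))\<^sup>2)"
    proof (intro AE_I2)
      fix x
      have "norm (f x * g x) \<le> norm (f x) * norm (g x)" by (rule norm_mult_ineq)
      also have "\<dots> \<le> (norm (f x))\<^sup>2 + (norm (g x))\<^sup>2"
        using zero_le_power2[of "norm (f x) - norm (g x)"] zero_le_power2[of "norm (f x) + norm (g x)"]
        unfolding power2_diff power2_sum by linarith
      finally show "norm (f x * g x) \<le> norm ((norm (f x))\<^sup>2 + (norm (g x))\<^sup>2)"
        by simp
    qed
  qed measurable
qed

lemma discriminant_nonneg_quadratic:
  fixes a b c :: real
  assumes "\<And>t. 0 \<le> a + 2 * t * b + t\<^sup>2 * c" "0 \<le> c"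
  shows "b\<^sup>2 \<le> a * c"
proof (cases "c = 0")
  case True
  have "b = 0"
  proof (rule ccontr)
    assume "b \<noteq> 0"
    with assms(1)[of "- (a + 1) / (2 * b)"] True show False by (simp add: field_simps)
  qed
  with True show ?thesis by simp
next
  case False
  have "0 \<le> c * (a + 2 * (- b / c) * b + (- b / c)\<^sup>2 * c)"
    by (rule mult_nonneg_nonneg[OF assms(2) assms(1)])
  also have "\<dots> = a * c - b\<^sup>2"
    using False by (simp add: power2_eq_square field_simps)
  finally show ?thesis by simp
qed

lemma Cauchy_Schwarz_integral:
  fixes f g :: "'a \<Rightarrow> real"
  assumes "f \<in> sq_int M" "g \<in> sq_int M"
  shows "(LINT x|M. f x * g x)\<^sup>2 \<le> (LINT x|M. (f x)\<^sup>2) * (LINT x|M. (g x)\<^sup>2)"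
proof (rule discriminant_nonneg_quadratic)
  fix t :: real
  have i: "integrable M (\<lambda>x. (f x)\<^sup>2)" "integrable M (\<lambda>x. f x * g x)" "integrable M (\<lambda>x. (g x)\<^sup>2)"
    using assms sq_int_mult_integrable[OF assms] by (auto dest!: sq_int_integrable)
  have "0 \<le> (LINT x|M. (f x + t * g x)\<^sup>2)" by simp
  also have "\<dots> = (LINT x|M. (f x)\<^sup>2 + 2 * t * (f x * g x) + t\<^sup>2 * (g x)\<^sup>2)"
    by (rule Bochner_Integration.integral_cong) (auto simp: power2_eq_square algebra_simps)
  also have "\<dots> = (LINT x|M. (f x)\<^sup>2) + 2 * t * (LINT x|M. f x * g x) + t\<^sup>2 * (LINT x|M. (g x)\<^sup>2)"
    using i by simp
  finally show "0 \<le> \<dots>" .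
qed simp

lemma Cauchy_Schwarz_integral_norm:
  fixes f g :: "'a \<Rightarrow> 'b::{banach,real_normed_algebra,second_countable_topology}"
  assumes "f \<in> sq_int M" "g \<in> sq_int M"
  shows "(norm (LINT x|M. f x * g x))\<^sup>2 \<le> (LINT x|M. (norm (f x))\<^sup>2) * (LINT x|M. (norm (g x))\<^sup>2)"
proof -
  note n = sq_int_norm[OF assms(1)] sq_int_norm[OF assms(2)]
  have "norm (LINT x|M. f x * g x) \<le> (LINT x|M. norm (f x * g x))" by simp
  also have "\<dots> \<le> (LINT x|M. norm (f x) * norm (g x))"
    using sq_int_mult_integrable[OF assms] sq_int_mult_integrable[OF n]
    by (intro integral_mono) (auto simp: norm_mult_ineq)
  finally have "(norm (LINT x|M. f x * g x))\<^sup>2 \<le> (LINT x|M. norm (f x) * norm (g x))\<^sup>2"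
    by (intro power_mono) auto
  also have "\<dots> \<le> (LINT x|M. (norm (f x))\<^sup>2) * (LINT x|M. (norm (g x))\<^sup>2)"
    using Cauchy_Schwarz_integral[OF n] .
  finally show ?thesis .
qed

lemma (in finite_measure) sq_int_bounded:
  assumes [measurable]: "f \<in> borel_measurable M" and "\<And>x. x \<in> space M \<Longrightarrow> norm (f x) \<le> C"
  shows "f \<in> sq_int M"
proof -
  have "integrable M (\<lambda>x. (norm (f x))\<^sup>2)"
    by (rule integrable_const_bound[of _ "C\<^sup>2"]) (auto intro!: AE_I2 power_mono assms(2))
  then show ?thesis by (simp add: sq_int_def)
qed

lemma (in finite_measure) sq_int_imp_integrable:
  fixes f :: "'a \<Rightarrow> 'b::{banach,second_countable_topology}"
  assumes "f \<in> sq_int M"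
  shows "integrable M f"
proof -
  have "integrable M (\<lambda>x. 1 * norm (f x) :: real)"
    by (intro sq_int_mult_integrable sq_int_norm[OF assms] sq_int_bounded) auto
  then show ?thesis
    using assms by (simp add: integrable_norm_iff sq_int_measurable)
qed

lemma (in finite_measure) L1_le_L2:
  fixes f :: "'a \<Rightarrow> real"
  assumes "f \<in> sq_int M"
  shows "(LINT x|M. \<bar>f x\<bar>)\<^sup>2 \<le> measure M (space M) * (LINT x|M. (f x)\<^sup>2)"
proof -
  have "(\<lambda>x. 1::real) \<in> sq_int M" by (intro sq_int_bounded) auto
  then show ?thesis
    using Cauchy_Schwarz_integral[of "\<lambda>x. 1" M "\<lambda>x. \<bar>f x\<bar>"] sq_int_norm[OF assms] by simp
qed

text \<open>
  The theorem of Riesz and Fischer on a finite measure space. A sequence that is Cauchy in the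
  mean square is Cauchy in \<open>L\<^sup>1\<close>, so a subsequence converges almost everywhere, and Fatou's lemma
  turns its pointwise limit into the mean-square limit of the whole sequence.
\<close>

lemma (in finite_measure) L2_complete:
  fixes u :: "nat \<Rightarrow> 'a \<Rightarrow> real"
  assumes u: "\<And>n. u n \<in> sq_int M"
    and cau: "\<And>e. e > 0 \<Longrightarrow> \<exists>N. \<forall>i\<ge>N. \<forall>j\<ge>N. (LINT x|M. (u i x - u j x)\<^sup>2) < e"
  obtains r where "r \<in> sq_int M" "(\<lambda>n. LINT x|M. (u n x - r x)\<^sup>2) \<longlonglongrightarrow> 0"
proof -
  have [measurable]: "u n \<in> borel_measurable M" for n using u by (simp add: sq_int_def)
  define c where "c = measure M (space M) + 1"
  have c: "c > 0" "measure M (space M) \<le> c" by (simp_all add: c_def add_nonneg_pos)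
  have "\<exists>N. \<forall>i\<ge>N. \<forall>j\<ge>N. (LINT x|M. norm (u i x - u j x)) < e" if "e > 0" for e
  proof -
    from that c have "e\<^sup>2 / c > 0" by simp
    from cau[OF this] obtain N where N: "\<And>i j. i \<ge> N \<Longrightarrow> j \<ge> N \<Longrightarrow> (LINT x|M. (u i x - u j x)\<^sup>2) < e\<^sup>2 / c"
      by blast
    have "(LINT x|M. norm (u i x - u j x)) < e" if "i \<ge> N" "j \<ge> N" for i j
    proof -
      have "(LINT x|M. norm (u i x - u j x))\<^sup>2 \<le> measure M (space M) * (LINT x|M. (u i x - u j x)\<^sup>2)"
        using L1_le_L2[OF sq_int_diff[OF u u]] by simp
      also have "\<dots> \<le> c * (LINT x|M. (u i x - u j x)\<^sup>2)"
        using c by (intro mult_right_mono) auto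
      also have "\<dots> < c * (e\<^sup>2 / c)"
        using N[OF that] c by (intro mult_strict_left_mono) auto
      finally have "(LINT x|M. norm (u i x - u j x))\<^sup>2 < e\<^sup>2" using c by simp
      then show ?thesis using \<open>e > 0\<close> by (meson less_eq_real_def power_less_imp_less_base)
    qed
    then show ?thesis by blast
  qed
  then obtain s where s: "strict_mono s" "AE x in M. Cauchy (\<lambda>i. u (s i) x)"
    using cauchy_L1_AE_cauchy_subseq[of M u] sq_int_imp_integrable[OF u] by blast
  define r where "r x = lim (\<lambda>i. u (s i) x)" for x
  have [measurable]: "r \<in> borel_measurable M" unfolding r_def by measurable
  have conv: "AE x in M. (\<lambda>i. u (s i) x) \<longlonglongrightarrow> r x"
    using s(2) by eventually_elim (auto simp: r_def Cauchy_convergent_iff convergent_LIMSEQ_iff)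
  have fatou: "integrable M (\<lambda>x. (u n x - r x)\<^sup>2) \<and> (LINT x|M. (u n x - r x)\<^sup>2) \<le> e"
    if e: "e > 0" and n: "n \<ge> N" and N: "\<And>i j. i \<ge> N \<Longrightarrow> j \<ge> N \<Longrightarrow> (LINT x|M. (u i x - u j x)\<^sup>2) < e" for e n N
  proof -
    have "(\<integral>\<^sup>+x. ennreal ((u n x - r x)\<^sup>2) \<partial>M) = (\<integral>\<^sup>+x. liminf (\<lambda>i. ennreal ((u n x - u (s i) x)\<^sup>2)) \<partial>M)"
    proof (rule nn_integral_cong_AE)
      show "AE x in M. ennreal ((u n x - r x)\<^sup>2) = liminf (\<lambda>i. ennreal ((u n x - u (s i) x)\<^sup>2))"
        using conv
      proof eventually_elim
        case (elim x)
        have "(\<lambda>i. ennreal ((u n x - u (s i) x)\<^sup>2)) \<longlonglongrightarrow> ennreal ((u n x - r x)\<^sup>2)"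
          by (intro tendsto_intros elim)
        then show ?case by (metis lim_imp_Liminf trivial_limit_sequentially)
      qed
    qed
    also have "\<dots> \<le> liminf (\<lambda>i. \<integral>\<^sup>+x. ennreal ((u n x - u (s i) x)\<^sup>2) \<partial>M)"
      by (rule nn_integral_liminf) measurable
    also have "\<dots> \<le> limsup (\<lambda>i. \<integral>\<^sup>+x. ennreal ((u n x - u (s i) x)\<^sup>2) \<partial>M)"
      by (rule Liminf_le_Limsup) simp
    also have "\<dots> \<le> ennreal e"
    proof (rule Limsup_bounded)
      show "\<forall>\<^sub>F i in sequentially. (\<integral>\<^sup>+x. ennreal ((u n x - u (s i) x)\<^sup>2) \<partial>M) \<le> ennreal e"
      proof (rule eventually_sequentiallyI[of N])
        fix i assume "N \<le> i"
        then have "N \<le> s i" using seq_suble[OF s(1), of i] by linarith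
        have "(\<integral>\<^sup>+x. ennreal ((u n x - u (s i) x)\<^sup>2) \<partial>M) = ennreal (LINT x|M. (u n x - u (s i) x)\<^sup>2)"
          using sq_int_integrable[OF sq_int_diff[OF u u]] by (intro nn_integral_eq_integral) auto
        then show "(\<integral>\<^sup>+x. ennreal ((u n x - u (s i) x)\<^sup>2) \<partial>M) \<le> ennreal e"
          using N[OF n \<open>N \<le> s i\<close>] e by (simp add: ennreal_leI)
      qed
    qed
    finally have le: "(\<integral>\<^sup>+x. ennreal ((u n x - r x)\<^sup>2) \<partial>M) \<le> ennreal e" .
    then have int: "integrable M (\<lambda>x. (u n x - r x)\<^sup>2)"
      by (intro integrableI_bounded) (auto simp: top_unique less_top[symmetric])
    then have "ennreal (LINT x|M. (u n x - r x)\<^sup>2) \<le> ennreal e"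
      using le by (subst (asm) nn_integral_eq_integral) auto
    with int show ?thesis using e by simp
  qed
  obtain N where N: "\<And>i j. i \<ge> N \<Longrightarrow> j \<ge> N \<Longrightarrow> (LINT x|M. (u i x - u j x)\<^sup>2) < 1"
    using cau[of 1] by auto
  have "(\<lambda>x. u N x - r x) \<in> sq_int M"
    using fatou[of 1 N N] N by (simp add: sq_int_def)
  from sq_int_diff[OF u[of N] this] have "r \<in> sq_int M" by simp
  moreover have "(\<lambda>n. LINT x|M. (u n x - r x)\<^sup>2) \<longlonglongrightarrow> 0"
  proof (rule LIMSEQ_I)
    fix e :: real assume "e > 0"
    with cau[of "e/2"] obtain K where K: "\<And>i j. i \<ge> K \<Longrightarrow> j \<ge> K \<Longrightarrow> (LINT x|M. (u i x - u j x)\<^sup>2) < e/2"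
      by (metis half_gt_zero)
    have "norm ((LINT x|M. (u n x - r x)\<^sup>2) - 0) < e" if "n \<ge> K" for n
      using fatou[of "e/2" K n] K \<open>e > 0\<close> that by simp
    then show "\<exists>no. \<forall>n\<ge>no. norm ((LINT x|M. (u n x - r x)\<^sup>2) - 0) < e" by blast
  qed
  ultimately show ?thesis by (rule that)
qed

section \<open>Integral operators with continuous kernels on a compact set\<close>

lemma square_le: "\<bar>a\<bar> \<le> b \<Longrightarrow> a\<^sup>2 \<le> b\<^sup>2" for a b :: real
  using power_mono[of "\<bar>a\<bar>" b 2] by simp

lemma power2_less_imp_less_abs: "a\<^sup>2 < b\<^sup>2 \<Longrightarrow> \<bar>a\<bar> < \<bar>b\<bar>" for a b :: real
  using power2_less_imp_less[of "\<bar>a\<bar>" "\<bar>b\<bar>"] by simp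

locale compact_domain =
  fixes D :: "'a::euclidean_space set"
  assumes compact_D: "compact D"
begin

abbreviation M :: "'a measure" where "M \<equiv> lebesgue_on D"

lemma D_lmeasurable: "D \<in> lmeasurable"
  using compact_D by (rule lmeasurable_compact)

sublocale finite_measure M
  by (rule finite_measure_lebesgue_on[OF D_lmeasurable])

sublocale pair: pair_sigma_finite M M ..

lemma continuous_measurable: "continuous_on D f \<Longrightarrow> f \<in> borel_measurable M"
  by (rule continuous_imp_measurable_on_sets_lebesgue[OF _ fmeasurableD[OF D_lmeasurable]])

lemma continuous_bounded:
  assumes "continuous_on D (f :: 'a \<Rightarrow> 'b::real_normed_vector)"
  obtains C where "C \<ge> 0" "\<And>x. x \<in> D \<Longrightarrow> norm (f x) \<le> C"
proof -
  have "bounded (f ` D)"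
    by (intro compact_imp_bounded compact_continuous_image assms compact_D)
  then obtain C where "\<And>x. x \<in> D \<Longrightarrow> norm (f x) \<le> C" by (auto simp: bounded_iff)
  then have "norm (f x) \<le> max C 0" if "x \<in> D" for x using that by (simp add: le_max_iff_disj)
  then show ?thesis using that[of "max C 0"] by simp
qed

lemma continuous_sq_int:
  fixes f :: "'a \<Rightarrow> 'b::{real_normed_vector,second_countable_topology}"
  assumes "continuous_on D f"
  shows "f \<in> sq_int M"
proof -
  obtain C where "\<And>x. x \<in> D \<Longrightarrow> norm (f x) \<le> C" using continuous_bounded[OF assms] by blast
  then show ?thesis by (intro sq_int_bounded[of _ C] continuous_measurable assms) simp
qed

lemma kernel_section_continuous:
  assumes "continuous_on (D \<times> P) (\<lambda>(w, p). k w p)" "p \<in> P"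
  shows "continuous_on D (\<lambda>w. k w p)"
proof -
  have "continuous_on D ((\<lambda>(w, p). k w p) \<circ> (\<lambda>w. (w, p)))"
    using assms(2)
    by (intro continuous_on_compose continuous_intros continuous_on_subset[OF assms(1)]) auto
  then show ?thesis by (simp add: comp_def)
qed

lemma kernel_bounded:
  fixes k :: "'a \<Rightarrow> 'p::metric_space \<Rightarrow> 'b::real_normed_vector"
  assumes "continuous_on (D \<times> P) (\<lambda>(w, p). k w p)" "compact P"
  obtains C where "C \<ge> 0" "\<And>w p. w \<in> D \<Longrightarrow> p \<in> P \<Longrightarrow> norm (k w p) \<le> C"
proof -
  have "bounded ((\<lambda>(w, p). k w p) ` (D \<times> P))"
    by (intro compact_imp_bounded compact_continuous_image assms compact_Times compact_D)
  then obtain C where C: "\<And>z. z \<in> D \<times> P \<Longrightarrow> norm ((\<lambda>(w, p). k w p) z) \<le> C"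
    by (auto simp: bounded_iff)
  have "norm (k w p) \<le> max C 0" if "w \<in> D" "p \<in> P" for w p
    using C[of "(w, p)"] that by (simp add: le_max_iff_disj)
  then show ?thesis using that[of "max C 0"] by simp
qed

lemma integrable_mult_continuous:
  fixes f :: "'a \<Rightarrow> 'b::{banach,real_normed_algebra,second_countable_topology}"
  assumes f: "integrable M f" and g: "continuous_on D g"
  shows "integrable M (\<lambda>w. f w * g w)"
proof -
  obtain C where C: "\<And>x. x \<in> D \<Longrightarrow> norm (g x) \<le> C" using continuous_bounded[OF g] by blast
  have [measurable]: "f \<in> borel_measurable M" "g \<in> borel_measurable M"
    using f continuous_measurable[OF g] by auto
  have "integrable M (\<lambda>w. C * norm (f w))" using f by simp
  then show ?thesis
  proof (rule Bochner_Integration.integrable_bound)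
    show "AE x in M. norm (f x * g x) \<le> norm (C * norm (f x))"
    proof (intro AE_I2)
      fix x assume "x \<in> space M"
      then have "norm (f x) * norm (g x) \<le> norm (f x) * C"
        by (intro mult_left_mono C) auto
      then show "norm (f x * g x) \<le> norm (C * norm (f x))"
        using norm_mult_ineq[of "f x" "g x"] abs_ge_self[of "C * norm (f x)"]
        by (simp add: mult.commute)
    qed
  qed measurable
qed

text \<open>
  The parameter \<open>x\<close> of the kernel may range over another space than \<open>D\<close>: over \<open>X\<close> for the transform,
  and over pairs of points for the continuity of kernels that are themselves integrals.
\<close>

definition kernel_op :: "('a \<Rightarrow> 'p \<Rightarrow> 'b) \<Rightarrow> ('a \<Rightarrow> 'b) \<Rightarrow> 'p \<Rightarrow> 'b::{banach,real_normed_algebra,second_countable_topology}"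
  where "kernel_op k u x = (LINT w|M. u w * k w x)"

text \<open>
  Along a convergent sequence of parameters the kernel stays bounded, because the points of the
  sequence together with its limit form a compact set; so dominated convergence applies.
\<close>

lemma kernel_op_continuous:
  fixes k :: "'a \<Rightarrow> 'p::heine_borel \<Rightarrow> 'b::{banach,real_normed_algebra,second_countable_topology}"
  assumes u: "integrable M u" and k: "continuous_on (D \<times> P) (\<lambda>(w, p). k w p)"
  shows "continuous_on P (kernel_op k u)"
proof (rule continuous_on_sequentiallyI)
  fix s a assume s: "\<forall>n. s n \<in> P" and a: "a \<in> P" and lim: "s \<longlonglongrightarrow> a"
  have "compact (insert a (range s))"
    using lim by (rule compact_sequence_with_limit)
  moreover have sub: "insert a (range s) \<subseteq> P" using s a by auto
  ultimately obtain C where C: "C \<ge> 0" "\<And>w p. w \<in> D \<Longrightarrow> p \<in> insert a (range s) \<Longrightarrow> norm (k w p) \<le> C"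
    using kernel_bounded[of "insert a (range s)" k] continuous_on_subset[OF k]
    by (metis Sigma_mono order_refl)
  note sec = integrable_mult_continuous[OF u kernel_section_continuous[OF k]]
  show "(\<lambda>n. kernel_op k u (s n)) \<longlonglongrightarrow> kernel_op k u a"
    unfolding kernel_op_def
  proof (rule integral_dominated_convergence[where w = "\<lambda>w. norm (u w) * C"])
    show "(\<lambda>w. u w * k w a) \<in> borel_measurable M" "\<And>i. (\<lambda>w. u w * k w (s i)) \<in> borel_measurable M"
      using s a sec by auto
    show "integrable M (\<lambda>w. norm (u w) * C)" using u by simp
    show "AE w in M. (\<lambda>i. u w * k w (s i)) \<longlonglongrightarrow> u w * k w a"
    proof (intro AE_I2 tendsto_mult tendsto_const)
      fix w assume "w \<in> space M"
      then have w: "w \<in> D" by simp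
      have "(\<lambda>i. (w, s i)) \<longlonglongrightarrow> (w, a)" by (intro tendsto_intros lim)
      with k w s a have "(\<lambda>i. (\<lambda>(w, p). k w p) (w, s i)) \<longlonglongrightarrow> (\<lambda>(w, p). k w p) (w, a)"
        by (intro continuous_on_tendsto_compose[OF k]) auto
      then show "(\<lambda>i. k w (s i)) \<longlonglongrightarrow> k w a" by simp
    qed
    show "AE w in M. norm (u w * k w (s i)) \<le> norm (u w) * C" for i
    proof (intro AE_I2)
      fix w assume "w \<in> space M"
      then have "norm (u w) * norm (k w (s i)) \<le> norm (u w) * C"
        by (intro mult_left_mono C) auto
      then show "norm (u w * k w (s i)) \<le> norm (u w) * C"
        using norm_mult_ineq[of "u w" "k w (s i)"] by linarith
    qed
  qed
qed

text \<open>
  Only the restriction of \<open>k\<close> to \<open>D \<times> D\<close> is continuous, so \<open>k\<close> is first extended by zero to a Borel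
  function; a bound for it makes the integrand dominated by a product of integrable functions.
\<close>

lemma Fubini_continuous_kernel:
  fixes f g :: "'a \<Rightarrow> 'b::{banach,real_normed_algebra,second_countable_topology}"
  assumes f: "integrable M f" and g: "integrable M g"
    and k: "continuous_on (D \<times> D) (\<lambda>(w, x). k w x)"
  shows "(LINT x|M. LINT w|M. f w * k w x * g x) = (LINT w|M. LINT x|M. f w * k w x * g x)"
proof -
  obtain C where C: "C \<ge> 0" "\<And>w x. w \<in> D \<Longrightarrow> x \<in> D \<Longrightarrow> norm (k w x) \<le> C"
    using kernel_bounded[OF k compact_D] by blast
  have [measurable]: "f \<in> borel_measurable M" "g \<in> borel_measurable M"
    using f g by auto
  have DD: "D \<times> D \<in> sets borel"
    using compact_D by (intro borel_compact compact_Times)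
  have [measurable]: "(\<lambda>z. z) \<in> measurable M borel" using id_borel_measurable_lebesgue_on[of D] by (simp add: id_def)
  define k' where "k' z = indicator (D \<times> D) z *\<^sub>R (\<lambda>(w, x). k w x) z" for z
  have k'[measurable]: "k' \<in> borel_measurable borel"
    unfolding k'_def by (rule borel_measurable_continuous_on_indicator[OF DD k])
  have k'_eq: "k' (w, x) = k w x" if "w \<in> D" "x \<in> D" for w x using that by (simp add: k'_def)
  have k'_le: "norm (k' z) \<le> C" for z
    using C by (cases "z \<in> D \<times> D") (auto simp: k'_def)
  define h where "h w x = f w * k' (w, x) * g x" for w x
  have [measurable]: "(\<lambda>z. k' (fst z, snd z)) \<in> borel_measurable (M \<Otimes>\<^sub>M M)"
    by measurable
  have meas: "case_prod h \<in> borel_measurable (M \<Otimes>\<^sub>M M)"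
    unfolding h_def split_beta' by measurable
  have int: "integrable (M \<Otimes>\<^sub>M M) (case_prod h)"
  proof (rule Bochner_Integration.integrable_bound)
    show "integrable (M \<Otimes>\<^sub>M M) (\<lambda>z. C * (norm (f (fst z)) * norm (g (snd z))))"
    proof (rule pair.Fubini_integrable)
      show "integrable M (\<lambda>x. LINT y|M. norm (C * (norm (f (fst (x, y))) * norm (g (snd (x, y))))))"
        using f C by (simp add: abs_mult)
      show "AE x in M. integrable M (\<lambda>y. C * (norm (f (fst (x, y))) * norm (g (snd (x, y)))))"
        using g by simp
    qed measurable
    show "case_prod h \<in> borel_measurable (M \<Otimes>\<^sub>M M)" by (rule meas)
    show "AE z in M \<Otimes>\<^sub>M M. norm (case_prod h z) \<le> norm (C * (norm (f (fst z)) * norm (g (snd z))))"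
    proof (intro AE_I2)
      fix z :: "'a \<times> 'a"
      have "norm (case_prod h z) \<le> norm (f (fst z)) * norm (k' z) * norm (g (snd z))"
        unfolding h_def split_beta'
        by (rule order_trans[OF norm_mult_ineq]) (simp add: mult_right_mono norm_mult_ineq)
      also have "\<dots> \<le> norm (f (fst z)) * C * norm (g (snd z))"
        by (intro mult_right_mono mult_left_mono k'_le) auto
      finally show "norm (case_prod h z) \<le> norm (C * (norm (f (fst z)) * norm (g (snd z))))"
        using C(1) by (simp add: abs_mult algebra_simps)
    qed
  qed
  have "(LINT x|M. LINT w|M. h w x) = (LINT w|M. LINT x|M. h w x)"
    using pair.Fubini_integral[OF int] .
  moreover have "(LINT x|M. LINT w|M. h w x) = (LINT x|M. LINT w|M. f w * k w x * g x)"
    by (intro Bochner_Integration.integral_cong refl) (simp add: h_def k'_eq)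
  moreover have "(LINT w|M. LINT x|M. h w x) = (LINT w|M. LINT x|M. f w * k w x * g x)"
    by (intro Bochner_Integration.integral_cong refl) (simp add: h_def k'_eq)
  ultimately show ?thesis by simp
qed

section \<open>The real space of square-integrable functions\<close>

abbreviation L :: "('a \<Rightarrow> real) set" where "L \<equiv> sq_int M"

definition ip :: "('a \<Rightarrow> real) \<Rightarrow> ('a \<Rightarrow> real) \<Rightarrow> real"
  where "ip u v = (LINT x|M. u x * v x)"

abbreviation sqn :: "('a \<Rightarrow> real) \<Rightarrow> real"
  where "sqn u \<equiv> ip u u"

lemma ip_commute: "ip u v = ip v u"
  by (simp add: ip_def mult.commute)

lemma ip_cong: "(\<And>x. x \<in> D \<Longrightarrow> u x = u' x) \<Longrightarrow> (\<And>x. x \<in> D \<Longrightarrow> v x = v' x) \<Longrightarrow> ip u v = ip u' v'"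
  unfolding ip_def by (intro Bochner_Integration.integral_cong) auto

lemma ip_cong_AE:
  assumes "u \<in> L" "u' \<in> L" "v \<in> L" "AE x in M. u x = u' x"
  shows "ip u v = ip u' v"
  unfolding ip_def
proof (rule integral_cong_AE)
  show "AE x in M. u x * v x = u' x * v x" using assms(4) by eventually_elim simp
qed (use assms sq_int_mult_integrable in auto)

lemma ip_add: "u \<in> L \<Longrightarrow> v \<in> L \<Longrightarrow> w \<in> L \<Longrightarrow> ip (\<lambda>x. u x + v x) w = ip u w + ip v w"
  using sq_int_mult_integrable[of u M w] sq_int_mult_integrable[of v M w]
  by (simp add: ip_def algebra_simps)

lemma ip_diff: "u \<in> L \<Longrightarrow> v \<in> L \<Longrightarrow> w \<in> L \<Longrightarrow> ip (\<lambda>x. u x - v x) w = ip u w - ip v w"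
  using sq_int_mult_integrable[of u M w] sq_int_mult_integrable[of v M w]
  by (simp add: ip_def algebra_simps)

lemma ip_scale: "ip (\<lambda>x. c * u x) w = c * ip u w"
  by (simp add: ip_def mult.assoc)

lemma ip_sum:
  assumes "\<And>i. i \<in> I \<Longrightarrow> u i \<in> L" "w \<in> L"
  shows "ip (\<lambda>x. \<Sum>i\<in>I. u i x) w = (\<Sum>i\<in>I. ip (u i) w)"
proof -
  have "ip (\<lambda>x. \<Sum>i\<in>I. u i x) w = (LINT x|M. (\<Sum>i\<in>I. u i x * w x))"
    by (simp add: ip_def sum_distrib_right)
  also have "\<dots> = (\<Sum>i\<in>I. ip (u i) w)"
    unfolding ip_def using assms by (intro Bochner_Integration.integral_sum sq_int_mult_integrable) auto
  finally show ?thesis .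
qed

lemma ip_ge_0: "0 \<le> ip u u"
  by (simp add: ip_def)

lemma ip_self: "ip u u = (LINT x|M. (u x)\<^sup>2)"
  by (simp add: ip_def power2_eq_square)

lemma ip_self_le:
  assumes u: "u \<in> L" and le: "\<And>x. x \<in> D \<Longrightarrow> \<bar>u x\<bar> \<le> c"
  shows "ip u u \<le> c\<^sup>2 * measure M D"
proof -
  have "ip u u \<le> (LINT x|M. c\<^sup>2)"
    unfolding ip_self
  proof (rule integral_mono)
    show "(u x)\<^sup>2 \<le> c\<^sup>2" if "x \<in> space M" for x
      using that by (intro square_le le) simp
  qed (use sq_int_real_integrable[OF u] in auto)
  then show ?thesis by (simp add: mult.commute)
qed

lemma ip_eq_0_AE:
  assumes "u \<in> L" shows "ip u u = 0 \<longleftrightarrow> (AE x in M. u x = 0)"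
  unfolding ip_self using sq_int_real_integrable[OF assms]
  by (subst integral_nonneg_eq_0_iff_AE) auto

lemma ip_Cauchy_Schwarz: "u \<in> L \<Longrightarrow> v \<in> L \<Longrightarrow> (ip u v)\<^sup>2 \<le> ip u u * ip v v"
  using Cauchy_Schwarz_integral[of u M v] by (simp add: ip_self) (simp add: ip_def)

lemma ip_diff_self:
  assumes u: "u \<in> L" and v: "v \<in> L"
  shows "sqn (\<lambda>x. u x - v x) = ip u u - 2 * ip u v + ip v v"
proof -
  have d: "(\<lambda>x. u x - v x) \<in> L" by (rule sq_int_diff[OF u v])
  have "sqn (\<lambda>x. u x - v x) = ip u (\<lambda>x. u x - v x) - ip v (\<lambda>x. u x - v x)"
    by (rule ip_diff[OF u v d])
  also have "ip u (\<lambda>x. u x - v x) = ip u u - ip v u"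
    using ip_diff[OF u v u] by (metis ip_commute)
  also have "ip v (\<lambda>x. u x - v x) = ip u v - ip v v"
    using ip_diff[OF u v v] by (metis ip_commute)
  finally show ?thesis by (simp add: ip_commute[of v u])
qed

lemma L_scale: "u \<in> L \<Longrightarrow> (\<lambda>x. c * u x) \<in> L"
  by (rule sq_int_cmult_left)

lemma ip_tendsto:
  assumes "\<And>n. u n \<in> L" "g \<in> L" "h \<in> L"
    and lim: "(\<lambda>n. sqn (\<lambda>x. u n x - g x)) \<longlonglongrightarrow> 0"
  shows "(\<lambda>n. ip (u n) h) \<longlonglongrightarrow> ip g h"
proof -
  have "(\<lambda>n. (ip (u n) h - ip g h)\<^sup>2) \<longlonglongrightarrow> 0"
  proof (rule tendsto_sandwich[OF _ _ tendsto_const])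
    show "\<forall>\<^sub>F n in sequentially. (ip (u n) h - ip g h)\<^sup>2 \<le> sqn (\<lambda>x. u n x - g x) * ip h h"
      using assms(1-3) ip_Cauchy_Schwarz[OF sq_int_diff[OF assms(1,2)] assms(3)] by (simp add: ip_diff)
    show "(\<lambda>n. sqn (\<lambda>x. u n x - g x) * ip h h) \<longlonglongrightarrow> 0"
      using tendsto_mult_right[OF lim, of "ip h h"] by simp
  qed simp
  then show ?thesis
    by (simp add: LIM_zero_iff)
qed

section \<open>Real symmetric kernels\<close>

definition sym_kernel :: "('a \<Rightarrow> 'a \<Rightarrow> real) \<Rightarrow> bool"
  where "sym_kernel k \<longleftrightarrow> continuous_on (D \<times> D) (\<lambda>(w, x). k w x) \<and> (\<forall>w\<in>D. \<forall>x\<in>D. k w x = k x w)"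

lemma kernI:
  "continuous_on (D \<times> D) (\<lambda>(w, x). k w x) \<Longrightarrow> (\<And>w x. w \<in> D \<Longrightarrow> x \<in> D \<Longrightarrow> k w x = k x w) \<Longrightarrow> sym_kernel k"
  by (simp add: sym_kernel_def)

lemma sym_kernel_cont: "sym_kernel k \<Longrightarrow> continuous_on (D \<times> D) (\<lambda>(w, x). k w x)"
  by (simp add: sym_kernel_def)

lemma sym_kernel_sym: "sym_kernel k \<Longrightarrow> w \<in> D \<Longrightarrow> x \<in> D \<Longrightarrow> k w x = k x w"
  by (auto simp: sym_kernel_def)

lemma sym_kernel_section: "sym_kernel k \<Longrightarrow> x \<in> D \<Longrightarrow> continuous_on D (\<lambda>w. k w x)"
  using kernel_section_continuous[OF sym_kernel_cont] .

lemma sym_kernel_section_L: "sym_kernel k \<Longrightarrow> x \<in> D \<Longrightarrow> (\<lambda>w. k w x) \<in> L"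
  by (intro continuous_sq_int sym_kernel_section)

lemma kernel_op_ip: "kernel_op k u x = ip u (\<lambda>w. k w x)"
  by (simp add: kernel_op_def ip_def)

lemma kernel_op_sym_kernel_continuous: "sym_kernel k \<Longrightarrow> u \<in> L \<Longrightarrow> continuous_on D (kernel_op k u)"
  by (rule kernel_op_continuous[OF sq_int_imp_integrable sym_kernel_cont])

lemma kernel_op_L: "sym_kernel k \<Longrightarrow> u \<in> L \<Longrightarrow> kernel_op k u \<in> L"
  by (rule continuous_sq_int[OF kernel_op_sym_kernel_continuous])

lemma kernel_op_add: "sym_kernel k \<Longrightarrow> u \<in> L \<Longrightarrow> v \<in> L \<Longrightarrow> x \<in> D \<Longrightarrow> kernel_op k (\<lambda>x. u x + v x) x = kernel_op k u x + kernel_op k v x"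
  by (simp add: kernel_op_ip ip_add sym_kernel_section_L)

lemma kernel_op_scale: "kernel_op k (\<lambda>x. c * u x) x = c * kernel_op k u x" for u :: "'a \<Rightarrow> real"
  by (simp add: kernel_op_ip ip_scale)

lemma kernel_op_cong_AE: "sym_kernel k \<Longrightarrow> u \<in> L \<Longrightarrow> v \<in> L \<Longrightarrow> AE x in M. u x = v x \<Longrightarrow> x \<in> D \<Longrightarrow> kernel_op k u x = kernel_op k v x"
  unfolding kernel_op_ip by (intro ip_cong_AE) (auto intro: sym_kernel_section_L)

lemma kernel_op_cong: "(\<And>x. x \<in> D \<Longrightarrow> u x = v x) \<Longrightarrow> kernel_op k u x = kernel_op k v x"
  unfolding kernel_op_def by (intro Bochner_Integration.integral_cong) auto

lemma sym_kernel_linear: "sym_kernel k \<Longrightarrow> sym_kernel l \<Longrightarrow> sym_kernel (\<lambda>w x. k w x + c * l w x)"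
  unfolding sym_kernel_def split_beta' by (auto intro!: continuous_intros)

lemma kernel_op_sym_kernel_linear:
  assumes "sym_kernel k" "sym_kernel l" "u \<in> L" "x \<in> D"
  shows "kernel_op (\<lambda>w x. k w x + c * l w x) u x = kernel_op k u x + c * kernel_op l u x"
proof -
  have "integrable M (\<lambda>w. u w * k w x)" "integrable M (\<lambda>w. u w * l w x)"
    using assms by (auto intro!: sq_int_mult_integrable sym_kernel_section_L)
  then show ?thesis by (simp add: kernel_op_def algebra_simps)
qed

lemma kernel_op_symmetric:
  assumes k: "sym_kernel k" and u: "u \<in> L" and v: "v \<in> L"
  shows "ip (kernel_op k u) v = ip u (kernel_op k v)"
proof -
  have "ip (kernel_op k u) v = (LINT x|M. LINT w|M. u w * k w x * v x)"
    by (simp add: ip_def kernel_op_def)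
  also have "\<dots> = (LINT w|M. LINT x|M. u w * k w x * v x)"
    by (rule Fubini_continuous_kernel[OF sq_int_imp_integrable[OF u] sq_int_imp_integrable[OF v] sym_kernel_cont[OF k]])
  also have "\<dots> = (LINT w|M. u w * (LINT x|M. v x * k x w))"
  proof (rule Bochner_Integration.integral_cong[OF refl])
    fix w assume "w \<in> space M"
    then have "(LINT x|M. u w * k w x * v x) = (LINT x|M. u w * (v x * k x w))"
      by (intro Bochner_Integration.integral_cong) (auto simp: sym_kernel_sym[OF k])
    then show "(LINT x|M. u w * k w x * v x) = u w * (LINT x|M. v x * k x w)" by simp
  qed
  finally show ?thesis by (simp add: ip_def kernel_op_def)
qed

lemma kernel_op_bound:
  assumes k: "sym_kernel k"
  obtains C where "C > 0" "\<And>u x. u \<in> L \<Longrightarrow> x \<in> D \<Longrightarrow> (kernel_op k u x)\<^sup>2 \<le> C * ip u u"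
    "\<And>u. u \<in> L \<Longrightarrow> sqn (kernel_op k u) \<le> C * ip u u"
proof -
  obtain C where C: "C \<ge> 0" "\<And>w x. w \<in> D \<Longrightarrow> x \<in> D \<Longrightarrow> norm (k w x) \<le> C"
    using kernel_bounded[OF sym_kernel_cont[OF k] compact_D] by blast
  define m where "m = measure M D"
  have m: "m \<ge> 0" by (simp add: m_def)
  have sec: "sqn (\<lambda>w. k w x) \<le> C\<^sup>2 * m" if "x \<in> D" for x
    unfolding m_def using C(2) that by (intro ip_self_le sym_kernel_section_L[OF k]) auto
  have b: "(kernel_op k u x)\<^sup>2 \<le> C\<^sup>2 * m * ip u u" if "u \<in> L" "x \<in> D" for u x
  proof -
    have "(kernel_op k u x)\<^sup>2 \<le> ip u u * sqn (\<lambda>w. k w x)"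
      unfolding kernel_op_ip using that by (intro ip_Cauchy_Schwarz sym_kernel_section_L[OF k])
    also have "\<dots> \<le> ip u u * (C\<^sup>2 * m)"
      by (intro mult_left_mono sec that ip_ge_0)
    finally show ?thesis by (simp add: mult_ac)
  qed
  have b2: "sqn (kernel_op k u) \<le> C\<^sup>2 * m * m * ip u u" if u: "u \<in> L" for u
  proof -
    have "sqn (kernel_op k u) \<le> (sqrt (C\<^sup>2 * m * ip u u))\<^sup>2 * measure M D"
      using b[OF u] by (intro ip_self_le kernel_op_L[OF k u]) (simp add: real_le_rsqrt)
    then show ?thesis using m ip_ge_0[of u] by (simp add: m_def mult_ac)
  qed
  define K where "K = C\<^sup>2 * m + C\<^sup>2 * m * m + 1"
  have nn: "C\<^sup>2 * m \<ge> 0" "C\<^sup>2 * m * m \<ge> 0" using m by simp_all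
  show ?thesis
  proof (rule that[of K])
    show "K > 0" using nn by (simp add: K_def)
    show "(kernel_op k u x)\<^sup>2 \<le> K * ip u u" if "u \<in> L" "x \<in> D" for u x
      using b[OF that] nn mult_right_mono[of "C\<^sup>2 * m" K "ip u u"] ip_ge_0[of u] by (auto simp: K_def)
    show "sqn (kernel_op k u) \<le> K * ip u u" if "u \<in> L" for u
      using b2[OF that] nn mult_right_mono[of "C\<^sup>2 * m * m" K "ip u u"] ip_ge_0[of u] by (auto simp: K_def)
  qed
qed

text \<open>
  Compactness of the operator in a strong form: the images of the unit ball are uniformly bounded
  and, by uniform continuity of the kernel, equicontinuous, so the theorem of Arzela and Ascoli
  gives even a uniformly convergent subsequence with a continuous limit.
\<close>

lemma kernel_op_compact:
  assumes k: "sym_kernel k" and u: "\<And>n. u n \<in> L" "\<And>n. sqn (u n) = 1"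
  obtains g r where "continuous_on D g" "strict_mono (r :: nat \<Rightarrow> nat)" "uniform_limit D (\<lambda>n. kernel_op k (u (r n))) g sequentially"
proof -
  obtain C where C: "C > 0" "\<And>u x. u \<in> L \<Longrightarrow> x \<in> D \<Longrightarrow> (kernel_op k u x)\<^sup>2 \<le> C * ip u u"
    by (rule kernel_op_bound[OF k]) metis
  define m where "m = measure M D + 1"
  have m: "m > 0" by (simp add: m_def add_nonneg_pos)
  have unif: "uniformly_continuous_on (D \<times> D) (\<lambda>(w, x). k w x)"
    by (intro compact_uniformly_continuous sym_kernel_cont[OF k] compact_Times compact_D)
  obtain g r where gr: "continuous_on D g" "strict_mono (r :: nat \<Rightarrow> nat)"
    "\<And>e. 0 < e \<Longrightarrow> \<exists>N. \<forall>n x. n \<ge> N \<and> x \<in> D \<longrightarrow> norm (kernel_op k (u (r n)) x - g x) < e"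
  proof (rule Arzela_Ascoli[OF compact_D, of "\<lambda>n. kernel_op k (u n)" "sqrt C"])
    show "norm (kernel_op k (u n) x) \<le> sqrt C" if "x \<in> D" for n x
      using C(2)[OF u(1) that, of n] u(2) by (simp add: real_le_rsqrt)
    show "\<exists>d>0. \<forall>n y. y \<in> D \<and> norm (x - y) < d \<longrightarrow> norm (kernel_op k (u n) x - kernel_op k (u n) y) < e"
      if x: "x \<in> D" and e: "0 < e" for x e
    proof -
      define e' where "e' = sqrt (e\<^sup>2 / (2 * m))"
      have e': "e' > 0" "e'\<^sup>2 = e\<^sup>2 / (2 * m)" using e m by (simp_all add: e'_def)
      obtain d where d: "d > 0" "\<And>z z'. z \<in> D \<times> D \<Longrightarrow> z' \<in> D \<times> D \<Longrightarrow> dist z' z < d \<Longrightarrow>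
          dist ((\<lambda>(w, x). k w x) z') ((\<lambda>(w, x). k w x) z) < e'"
        using unif e' unfolding uniformly_continuous_on_def by metis
      have "norm (kernel_op k (u n) x - kernel_op k (u n) y) < e" if y: "y \<in> D" "norm (x - y) < d" for n y
      proof -
        have close: "\<bar>k w x - k w y\<bar> < e'" if "w \<in> D" for w
          using d(2)[of "(w, y)" "(w, x)"] that x y by (auto simp: dist_Pair_Pair dist_norm)
        have sL: "(\<lambda>w. k w x - k w y) \<in> L"
          by (intro sq_int_diff sym_kernel_section_L[OF k] x y)
        have "(kernel_op k (u n) x - kernel_op k (u n) y)\<^sup>2 = (ip (u n) (\<lambda>w. k w x - k w y))\<^sup>2"
          using u by (simp add: kernel_op_ip ip_diff sym_kernel_section_L[OF k] x y ip_commute[of "u n"])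
        also have "\<dots> \<le> sqn (u n) * sqn (\<lambda>w. k w x - k w y)"
          by (rule ip_Cauchy_Schwarz[OF u(1) sL])
        also have "\<dots> = sqn (\<lambda>w. k w x - k w y)" by (simp add: u)
        also have "\<dots> \<le> e'\<^sup>2 * measure M D"
          using close by (intro ip_self_le[OF sL]) (simp add: less_imp_le)
        also have "\<dots> \<le> m * e'\<^sup>2" by (simp add: m_def algebra_simps)
        also have "\<dots> < e\<^sup>2" using e m by (simp add: e')
        finally have "\<bar>kernel_op k (u n) x - kernel_op k (u n) y\<bar> < \<bar>e\<bar>"
          by (rule power2_less_imp_less_abs)
        then show ?thesis using e by simp
      qed
      with d(1) show ?thesis by blast
    qed
  qed blast
  have "uniform_limit D (\<lambda>n. kernel_op k (u (r n))) g sequentially"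
    unfolding uniform_limit_sequentially_iff dist_norm using gr(3) by meson
  with gr that show ?thesis by blast
qed

lemma uniform_limit_ip:
  assumes f: "\<And>n. f n \<in> L" and g: "g \<in> L" and lim: "uniform_limit D f g sequentially"
  shows "(\<lambda>n. sqn (\<lambda>x. f n x - g x)) \<longlonglongrightarrow> 0"
proof (rule LIMSEQ_I)
  fix e :: real assume e: "e > 0"
  define m where "m = measure M D + 1"
  have m: "m > 0" by (simp add: m_def add_nonneg_pos)
  define d where "d = sqrt (e / (2 * m))"
  have d: "d > 0" "d\<^sup>2 = e / (2 * m)" using e m by (simp_all add: d_def)
  obtain N where N: "\<And>n x. n \<ge> N \<Longrightarrow> x \<in> D \<Longrightarrow> \<bar>f n x - g x\<bar> < d"
    using lim d(1) unfolding uniform_limit_sequentially_iff dist_real_def by meson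
  have "norm (sqn (\<lambda>x. f n x - g x) - 0) < e" if "n \<ge> N" for n
  proof -
    have "sqn (\<lambda>x. f n x - g x) \<le> d\<^sup>2 * measure M D"
      using N[OF that] by (intro ip_self_le sq_int_diff f g) (simp add: less_imp_le)
    also have "\<dots> \<le> m * d\<^sup>2" by (simp add: m_def algebra_simps)
    also have "\<dots> < e" using e m by (simp add: d)
    finally show ?thesis using ip_ge_0 by simp
  qed
  then show "\<exists>no. \<forall>n\<ge>no. norm (sqn (\<lambda>x. f n x - g x) - 0) < e" by blast
qed

section \<open>Common eigenfunctions of commuting kernels\<close>

lemma ip_add_scaled:
  assumes u: "u \<in> L" and w: "w \<in> L" and v: "v \<in> L"
  shows "ip (\<lambda>x. u x + t * w x) v = ip u v + t * ip w v"
  by (simp add: ip_add[OF u L_scale[OF w] v] ip_scale)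

lemma L_add_scaled: "u \<in> L \<Longrightarrow> w \<in> L \<Longrightarrow> (\<lambda>x. u x + t * w x) \<in> L"
  by (intro sq_int_add L_scale)

lemma ip_quadratic:
  assumes u: "u \<in> L" and w: "w \<in> L"
  shows "sqn (\<lambda>x. u x + t * w x) = ip u u + 2 * t * ip u w + t\<^sup>2 * ip w w"
proof -
  note uw = L_add_scaled[OF u w, of t]
  have "sqn (\<lambda>x. u x + t * w x) = ip (\<lambda>x. u x + t * w x) u + t * ip (\<lambda>x. u x + t * w x) w"
    using ip_add_scaled[OF u w uw] by (metis ip_commute)
  then show ?thesis
    by (simp add: ip_add_scaled u w ip_commute[of w u] power2_eq_square algebra_simps)
qed

lemma kernel_op_quadratic:
  assumes k: "sym_kernel k" and u: "u \<in> L" and w: "w \<in> L"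
  shows "ip (kernel_op k (\<lambda>x. u x + t * w x)) (\<lambda>x. u x + t * w x)
       = ip (kernel_op k u) u + 2 * t * ip (kernel_op k u) w + t\<^sup>2 * ip (kernel_op k w) w"
proof -
  note uw = L_add_scaled[OF u w, of t]
  note B = kernel_op_L[OF k u] kernel_op_L[OF k w]
  have "ip (kernel_op k (\<lambda>x. u x + t * w x)) (\<lambda>x. u x + t * w x)
      = ip (\<lambda>x. kernel_op k u x + t * kernel_op k w x) (\<lambda>x. u x + t * w x)"
    by (intro ip_cong) (simp_all add: kernel_op_add[OF k u L_scale[OF w]] kernel_op_scale)
  also have "\<dots> = ip (kernel_op k u) (\<lambda>x. u x + t * w x) + t * ip (kernel_op k w) (\<lambda>x. u x + t * w x)"
    by (rule ip_add_scaled[OF B uw])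
  also have "ip (kernel_op k u) (\<lambda>x. u x + t * w x) = ip (kernel_op k u) u + t * ip (kernel_op k u) w"
    using ip_add_scaled[OF u w B(1)] by (metis ip_commute)
  also have "ip (kernel_op k w) (\<lambda>x. u x + t * w x) = ip (kernel_op k u) w + t * ip (kernel_op k w) w"
    using ip_add_scaled[OF u w B(2)] kernel_op_symmetric[OF k w u] by (metis ip_commute)
  finally show ?thesis by (simp add: power2_eq_square algebra_simps)
qed

definition closed_subspace :: "('a \<Rightarrow> real) set \<Rightarrow> bool"
  where "closed_subspace V \<longleftrightarrow> V \<subseteq> L \<and> (\<forall>u\<in>V. \<forall>v\<in>V. \<forall>c. (\<lambda>x. u x + c * v x) \<in> V) \<and>
    (\<forall>u g. (\<forall>n. u n \<in> V) \<and> g \<in> L \<and>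
      (\<lambda>n. sqn (\<lambda>x. u n x - g x)) \<longlonglongrightarrow> 0 \<longrightarrow> g \<in> V)"

lemma closed_subspace_L: "closed_subspace V \<Longrightarrow> u \<in> V \<Longrightarrow> u \<in> L"
  by (auto simp: closed_subspace_def)

lemma closed_subspace_add: "closed_subspace V \<Longrightarrow> u \<in> V \<Longrightarrow> v \<in> V \<Longrightarrow> (\<lambda>x. u x + c * v x) \<in> V"
  unfolding closed_subspace_def by blast

lemma closed_subspace_scale: "closed_subspace V \<Longrightarrow> u \<in> V \<Longrightarrow> (\<lambda>x. c * u x) \<in> V"
  using closed_subspace_add[of V u u "c - 1"] by (simp add: algebra_simps)

lemma closed_subspace_closed:
  "closed_subspace V \<Longrightarrow> (\<And>n. u n \<in> V) \<Longrightarrow> g \<in> L \<Longrightarrow>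
    (\<lambda>n. sqn (\<lambda>x. u n x - g x)) \<longlonglongrightarrow> 0 \<Longrightarrow> g \<in> V"
  unfolding closed_subspace_def by blast

text \<open>
  The form \<open>P v = m \<parallel>v\<parallel>\<^sup>2 - (k v, v)\<close> is nonnegative on \<open>V\<close>. Evaluated at \<open>u - w / c\<close>, where
  \<open>w = m u - k u\<close> is the defect of \<open>u\<close> as an eigenvector and \<open>c = m + \<surd>C\<close>, it bounds \<open>\<parallel>w\<parallel>\<^sup>2\<close> by
  \<open>c P u\<close>. So vectors that almost maximize the form are almost eigenvectors.
\<close>

lemma eigen_defect_le:
  assumes k: "sym_kernel k" and V: "closed_subspace V" and inv: "\<And>u. u \<in> V \<Longrightarrow> kernel_op k u \<in> V"
    and C: "C > 0" "\<And>u. u \<in> L \<Longrightarrow> sqn (kernel_op k u) \<le> C * ip u u"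
    and m: "m > 0" "\<And>u. u \<in> V \<Longrightarrow> ip (kernel_op k u) u \<le> m * ip u u"
    and u: "u \<in> V"
  shows "sqn (\<lambda>x. m * u x - kernel_op k u x) \<le> (m + sqrt C) * (m * ip u u - ip (kernel_op k u) u)"
proof -
  define w where "w = (\<lambda>x. m * u x - kernel_op k u x)"
  define W where "W = ip w w"
  define c where "c = m + sqrt C"
  have c: "c > 0" using m C by (simp add: c_def add_pos_pos)
  have uL: "u \<in> L" by (rule closed_subspace_L[OF V u])
  have wV: "w \<in> V"
    using closed_subspace_add[OF V closed_subspace_scale[OF V u, of m] inv[OF u], of "-1"] by (simp add: w_def)
  have wL: "w \<in> L" by (rule closed_subspace_L[OF V wV])
  have "\<bar>ip (kernel_op k w) w\<bar> \<le> sqrt C * W"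
  proof -
    have "(ip (kernel_op k w) w)\<^sup>2 \<le> sqn (kernel_op k w) * ip w w"
      by (intro ip_Cauchy_Schwarz kernel_op_L[OF k] wL)
    also have "\<dots> \<le> C * ip w w * ip w w"
      by (intro mult_right_mono C(2) wL ip_ge_0)
    also have "\<dots> = (sqrt C * W)\<^sup>2" using C by (simp add: W_def power2_eq_square)
    finally have "\<bar>ip (kernel_op k w) w\<bar> \<le> \<bar>sqrt C * W\<bar>" by (simp add: abs_le_square_iff)
    then show ?thesis using C ip_ge_0[of w] by (simp add: W_def)
  qed
  then have Pw: "m * W - ip (kernel_op k w) w \<le> c * W" by (simp add: c_def algebra_simps)
  have cross: "m * ip u w - ip (kernel_op k u) w = W"
    unfolding W_def using ip_diff[OF L_scale[OF uL] kernel_op_L[OF k uL] wL, of m]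
    by (simp add: ip_scale flip: w_def)
  define t where "t = - 1 / c"
  have "0 \<le> m * sqn (\<lambda>x. u x + t * w x) - ip (kernel_op k (\<lambda>x. u x + t * w x)) (\<lambda>x. u x + t * w x)"
    using m(2)[OF closed_subspace_add[OF V u wV, of t]] by simp
  also have "\<dots> = (m * ip u u - ip (kernel_op k u) u) + 2 * t * (m * ip u w - ip (kernel_op k u) w) + t\<^sup>2 * (m * W - ip (kernel_op k w) w)"
    unfolding ip_quadratic[OF uL wL] kernel_op_quadratic[OF k uL wL] W_def by (simp add: algebra_simps)
  also have "\<dots> \<le> (m * ip u u - ip (kernel_op k u) u) + 2 * t * W + t\<^sup>2 * (c * W)"
    unfolding cross by (intro add_left_mono mult_left_mono Pw) simp
  also have "\<dots> = (m * ip u u - ip (kernel_op k u) u) - W / c"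
    using c by (simp add: t_def power2_eq_square field_simps)
  finally have "W \<le> c * (m * ip u u - ip (kernel_op k u) u)"
    using c by (simp add: field_simps)
  then show ?thesis by (simp add: W_def w_def c_def)
qed

lemma ip_sum_le: 
  assumes u: "u \<in> L" and v: "v \<in> L"
  shows "sqn (\<lambda>x. u x + v x) \<le> 2 * ip u u + 2 * ip v v"
  using ip_quadratic[OF u v, of 1] ip_quadratic[OF u v, of "-1"] ip_ge_0[of "\<lambda>x. u x + (-1) * v x"]
  by simp

text \<open>
  A maximizing sequence for the quadratic form consists of almost-eigenvectors, and compactness
  makes their images, hence the vectors themselves, converge along a subsequence.
\<close>

lemma max_eigenvector:
  assumes k: "sym_kernel k" and V: "closed_subspace V" and inv: "\<And>u. u \<in> V \<Longrightarrow> kernel_op k u \<in> V"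
    and u1: "u1 \<in> V" "ip (kernel_op k u1) u1 > 0"
  obtains g m where "g \<in> V" "ip g g = 1" "m > 0" "\<And>x. x \<in> D \<Longrightarrow> kernel_op k g x = m * g x"
    "\<And>u. u \<in> V \<Longrightarrow> ip (kernel_op k u) u \<le> m * ip u u"
proof -
  obtain C where C: "C > 0" "\<And>u x. u \<in> L \<Longrightarrow> x \<in> D \<Longrightarrow> (kernel_op k u x)\<^sup>2 \<le> C * ip u u"
    "\<And>u. u \<in> L \<Longrightarrow> sqn (kernel_op k u) \<le> C * ip u u"
    by (rule kernel_op_bound[OF k]) metis
  have quad: "(ip (kernel_op k u) u)\<^sup>2 \<le> C * (ip u u)\<^sup>2" if "u \<in> L" for u
  proof -
    have "(ip (kernel_op k u) u)\<^sup>2 \<le> sqn (kernel_op k u) * ip u u"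
      by (intro ip_Cauchy_Schwarz kernel_op_L[OF k] that)
    also have "\<dots> \<le> C * ip u u * ip u u"
      by (intro mult_right_mono C(3) that ip_ge_0)
    finally show ?thesis by (simp add: power2_eq_square mult.assoc)
  qed
  define A where "A = (\<lambda>u. ip (kernel_op k u) u) ` {u \<in> V. ip u u = 1}"
  have norm1: "(\<lambda>x. inverse (sqrt (ip u u)) * u x) \<in> V \<and>
      sqn (\<lambda>x. inverse (sqrt (ip u u)) * u x) = 1 \<and>
      ip (kernel_op k (\<lambda>x. inverse (sqrt (ip u u)) * u x)) (\<lambda>x. inverse (sqrt (ip u u)) * u x) = ip (kernel_op k u) u / ip u u"
    if "u \<in> V" "ip u u > 0" for u
  proof -
    define c where "c = inverse (sqrt (ip u u))"
    have c2: "c * c = inverse (ip u u)"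
      using that(2) by (simp add: c_def flip: real_sqrt_inverse)
    have sc: "ip v (\<lambda>x. c * u x) = c * ip v u" for v
      using ip_scale[of c u v] by (simp add: ip_commute)
    have "sqn (\<lambda>x. c * u x) = c * c * ip u u" by (simp add: ip_scale sc)
    moreover have "ip (kernel_op k (\<lambda>x. c * u x)) (\<lambda>x. c * u x) = c * c * ip (kernel_op k u) u"
    proof -
      have "kernel_op k (\<lambda>x. c * u x) = (\<lambda>x. c * kernel_op k u x)" by (rule ext) (rule kernel_op_scale)
      then show ?thesis by (simp add: ip_scale sc)
    qed
    ultimately show ?thesis
      using that closed_subspace_scale[OF V that(1), of c] unfolding c_def[symmetric] c2
      by (simp add: field_simps)
  qed
  have u1L: "u1 \<in> L" by (rule closed_subspace_L[OF V u1(1)])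
  have u1p: "ip u1 u1 > 0"
    using quad[OF u1L] u1(2) ip_ge_0[of u1] by (cases "ip u1 u1 = 0") auto
  have Abd: "bdd_above A"
    unfolding A_def
  proof (rule bdd_aboveI2)
    fix u assume "u \<in> {u \<in> V. ip u u = 1}"
    then show "ip (kernel_op k u) u \<le> sqrt C"
      using quad[of u] closed_subspace_L[OF V] by (auto intro: real_le_rsqrt)
  qed
  define m where "m = Sup A"
  have pos_A: "ip (kernel_op k u1) u1 / ip u1 u1 \<in> A"
    unfolding A_def image_iff using norm1[OF u1(1) u1p] by (metis (mono_tags, lifting) mem_Collect_eq)
  then have "ip (kernel_op k u1) u1 / ip u1 u1 \<le> m" unfolding m_def by (rule cSup_upper[OF _ Abd])
  then have m0: "m > 0" using u1(2) u1p by (meson divide_pos_pos less_le_trans)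
  have m_le: "ip (kernel_op k u) u \<le> m * ip u u" if "u \<in> V" for u
  proof (cases "ip u u > 0")
    case True
    have "ip (kernel_op k u) u / ip u u \<in> A"
      unfolding A_def image_iff using norm1[OF that True] by (metis (mono_tags, lifting) mem_Collect_eq)
    then have "ip (kernel_op k u) u / ip u u \<le> m" unfolding m_def by (rule cSup_upper[OF _ Abd])
    then show ?thesis using True by (simp add: field_simps)
  next
    case False
    then have "ip u u = 0" using ip_ge_0[of u] by simp
    then show ?thesis using quad[OF closed_subspace_L[OF V that]] by simp
  qed
  have "\<exists>u. u \<in> V \<and> ip u u = 1 \<and> m - 1 / real (Suc n) < ip (kernel_op k u) u" for n
  proof -
    have "m - 1 / real (Suc n) < Sup A" by (simp add: m_def)
    then obtain a where "a \<in> A" "m - 1 / real (Suc n) < a"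
      using less_cSupE[of "m - 1 / real (Suc n)" A] pos_A by blast
    then show ?thesis by (auto simp: A_def)
  qed
  then obtain u where u: "\<And>n. u n \<in> V" "\<And>n. sqn (u n) = 1" "\<And>n. m - 1 / real (Suc n) < ip (kernel_op k (u n)) (u n)"
    by metis
  have uL: "u n \<in> L" for n by (rule closed_subspace_L[OF V u(1)])
  define w where "w n = (\<lambda>x. m * u n x - kernel_op k (u n) x)" for n
  have wL: "w n \<in> L" for n unfolding w_def by (intro sq_int_diff L_scale kernel_op_L[OF k] uL)
  have w_le: "sqn (w n) \<le> (m + sqrt C) * (1 / real (Suc n))" for n
  proof -
    have "sqn (w n) \<le> (m + sqrt C) * (m * sqn (u n) - ip (kernel_op k (u n)) (u n))"
      unfolding w_def by (rule eigen_defect_le[OF k V inv C(1,3) m0 m_le u(1)])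
    also have "\<dots> \<le> (m + sqrt C) * (1 / real (Suc n))"
      using u(2)[of n] u(3)[of n] m0 C(1) by (intro mult_left_mono) (auto intro: add_nonneg_nonneg)
    finally show ?thesis .
  qed
  obtain g0 r where g0: "continuous_on D g0" "strict_mono (r :: nat \<Rightarrow> nat)"
    "uniform_limit D (\<lambda>n. kernel_op k (u (r n))) g0 sequentially"
    by (rule kernel_op_compact[OF k uL u(2)])
  have g0L: "g0 \<in> L" by (rule continuous_sq_int[OF g0(1)])
  define g where "g = (\<lambda>x. (1 / m) * g0 x)"
  have gL: "g \<in> L" unfolding g_def by (rule L_scale[OF g0L])
  define y where "y n = (\<lambda>x. kernel_op k (u (r n)) x - g0 x)" for n
  have yL: "y n \<in> L" for n unfolding y_def by (intro sq_int_diff kernel_op_L[OF k] uL g0L)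
  have y0: "(\<lambda>n. sqn (y n)) \<longlonglongrightarrow> 0"
    unfolding y_def by (rule uniform_limit_ip[OF kernel_op_L[OF k uL] g0L g0(3)])
  have w0: "(\<lambda>n. sqn (w (r n))) \<longlonglongrightarrow> 0"
  proof -
    have "(\<lambda>n. sqn (w n)) \<longlonglongrightarrow> 0"
    proof (rule tendsto_sandwich[OF _ _ tendsto_const])
      show "\<forall>\<^sub>F n in sequentially. sqn (w n) \<le> (m + sqrt C) * (1 / real (Suc n))"
        by (simp only: w_le eventually_True)
      have "(\<lambda>n. (m + sqrt C) * (1 / real (Suc n))) \<longlonglongrightarrow> (m + sqrt C) * 0"
        by (intro tendsto_mult tendsto_const LIMSEQ_Suc[OF lim_1_over_n])
      then show "(\<lambda>n. (m + sqrt C) * (1 / real (Suc n))) \<longlonglongrightarrow> 0" by simp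
    qed (simp add: ip_ge_0)
    then show ?thesis using LIMSEQ_subseq_LIMSEQ[OF _ g0(2)] by (simp add: comp_def)
  qed
  have conv: "(\<lambda>n. sqn (\<lambda>x. u (r n) x - g x)) \<longlonglongrightarrow> 0"
  proof (rule tendsto_sandwich[OF _ _ tendsto_const])
    show "\<forall>\<^sub>F n in sequentially. 0 \<le> sqn (\<lambda>x. u (r n) x - g x)"
      by (simp add: ip_ge_0)
    show "\<forall>\<^sub>F n in sequentially. sqn (\<lambda>x. u (r n) x - g x)
      \<le> (1 / m) * (1 / m) * (2 * sqn (w (r n)) + 2 * sqn (y n))"
    proof (intro always_eventually allI)
      fix n
      have eq: "(\<lambda>x. u (r n) x - g x) = (\<lambda>x. (1 / m) * (w (r n) x + y n x))"
        using m0 by (auto simp: w_def y_def g_def field_simps)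
      have sc: "sqn (\<lambda>x. c * v x) = c * c * ip v v" for c v
        unfolding ip_scale using ip_scale[of c v v] by (simp add: ip_commute)
      have "sqn (\<lambda>x. u (r n) x - g x)
          = (1 / m) * (1 / m) * sqn (\<lambda>x. w (r n) x + y n x)"
        unfolding eq by (rule sc)
      also have "\<dots> \<le> (1 / m) * (1 / m) * (2 * sqn (w (r n)) + 2 * sqn (y n))"
        using m0 by (intro mult_left_mono ip_sum_le wL yL) simp
      finally show "sqn (\<lambda>x. u (r n) x - g x)
        \<le> (1 / m) * (1 / m) * (2 * sqn (w (r n)) + 2 * sqn (y n))" .
    qed
    have "(\<lambda>n. (1 / m) * (1 / m) * (2 * sqn (w (r n)) + 2 * sqn (y n)))
        \<longlonglongrightarrow> (1 / m) * (1 / m) * (2 * 0 + 2 * 0)"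
      by (intro tendsto_intros w0 y0)
    then show "(\<lambda>n. (1 / m) * (1 / m) * (2 * sqn (w (r n)) + 2 * sqn (y n))) \<longlonglongrightarrow> 0" by simp
  qed
  have gV: "g \<in> V" by (rule closed_subspace_closed[OF V u(1) gL conv])
  have "ip g g = 1"
  proof -
    have "(\<lambda>n. sqn (u (r n)) - 2 * ip (u (r n)) g + ip g g) \<longlonglongrightarrow> 1 - 2 * ip g g + ip g g"
      unfolding u(2) by (intro tendsto_intros ip_tendsto[OF uL gL gL conv])
    from LIMSEQ_unique[OF conv[unfolded ip_diff_self[OF uL gL]] this]
    show ?thesis by simp
  qed
  moreover have "kernel_op k g x = m * g x" if x: "x \<in> D" for x
  proof -
    have "(\<lambda>n. kernel_op k (u (r n)) x) \<longlonglongrightarrow> g0 x"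
      by (rule tendsto_uniform_limitI[OF g0(3) x])
    moreover have "(\<lambda>n. kernel_op k (u (r n)) x) \<longlonglongrightarrow> kernel_op k g x"
      unfolding kernel_op_ip by (rule ip_tendsto[OF uL gL sym_kernel_section_L[OF k x] conv])
    ultimately have "kernel_op k g x = g0 x" by (rule LIMSEQ_unique[rotated])
    then show ?thesis using m0 by (simp add: g_def)
  qed
  ultimately show ?thesis by (rule that[OF gV _ m0 _ m_le])
qed

text \<open>
  For the closedness, symmetry moves the operator to the test function, so that the eigenvalue
  equation passes to mean-square limits weakly; it holds almost everywhere because the defect of
  the limit may itself be used as test function.
\<close>

lemma closed_subspace_eigenspace:
  assumes V: "closed_subspace V" and k: "sym_kernel k"
  shows "closed_subspace {u \<in> V. AE x in M. kernel_op k u x = t * u x}"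
  unfolding closed_subspace_def
proof (intro conjI ballI allI impI)
  show "{u \<in> V. AE x in M. kernel_op k u x = t * u x} \<subseteq> L" using closed_subspace_L[OF V] by auto
next
  fix u v c assume u: "u \<in> {u \<in> V. AE x in M. kernel_op k u x = t * u x}" and v: "v \<in> {u \<in> V. AE x in M. kernel_op k u x = t * u x}"
  have "AE x in M. kernel_op k (\<lambda>x. u x + c * v x) x = t * (u x + c * v x)"
  proof -
    have "AE x in M. kernel_op k u x = t * u x" "AE x in M. kernel_op k v x = t * v x" "AE x in M. x \<in> D"
      using u v by auto
    then show ?thesis
    proof eventually_elim
      case (elim x)
      have "kernel_op k (\<lambda>x. u x + c * v x) x = kernel_op k u x + c * kernel_op k v x"
        using kernel_op_add[OF k closed_subspace_L[OF V] L_scale[OF closed_subspace_L[OF V]] elim(3)] u v by (simp add: kernel_op_scale)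
      then show ?case using elim by (simp add: algebra_simps)
    qed
  qed
  then show "(\<lambda>x. u x + c * v x) \<in> {u \<in> V. AE x in M. kernel_op k u x = t * u x}"
    using closed_subspace_add[OF V] u v by auto
next
  fix u g
  assume *: "(\<forall>n. u n \<in> {u \<in> V. AE x in M. kernel_op k u x = t * u x}) \<and> g \<in> L \<and>
    (\<lambda>n. sqn (\<lambda>x. u n x - g x)) \<longlonglongrightarrow> 0"
  then have uV: "\<And>n. u n \<in> V" and gL: "g \<in> L" and ev: "\<And>n. AE x in M. kernel_op k (u n) x = t * u n x"
    and lim: "(\<lambda>n. sqn (\<lambda>x. u n x - g x)) \<longlonglongrightarrow> 0" by auto
  have uL: "u n \<in> L" for n by (rule closed_subspace_L[OF V uV])
  define h where "h = (\<lambda>x. kernel_op k g x - t * g x)"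
  have hL: "h \<in> L" unfolding h_def by (intro sq_int_diff kernel_op_L[OF k] L_scale gL)
  have eq: "ip (u n) (kernel_op k h) = t * ip (u n) h" for n
    using ip_cong_AE[OF kernel_op_L[OF k uL] L_scale[OF uL] hL ev[of n]]
    by (simp add: kernel_op_symmetric[OF k uL hL] ip_scale)
  have "(\<lambda>n. ip (u n) (kernel_op k h)) \<longlonglongrightarrow> ip g (kernel_op k h)"
    by (rule ip_tendsto[OF uL gL kernel_op_L[OF k hL] lim])
  moreover have "(\<lambda>n. ip (u n) (kernel_op k h)) \<longlonglongrightarrow> t * ip g h"
    unfolding eq by (intro tendsto_intros ip_tendsto[OF uL gL hL lim])
  ultimately have "ip g (kernel_op k h) = t * ip g h" by (rule LIMSEQ_unique)
  then have "ip h h = 0"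
    using ip_diff[OF kernel_op_L[OF k gL] L_scale[OF gL] hL, of t]
    by (simp add: kernel_op_symmetric[OF k gL hL] ip_scale flip: h_def)
  then have "AE x in M. h x = 0" using ip_eq_0_AE[OF hL] by simp
  then have "AE x in M. kernel_op k g x = t * g x" by (simp add: h_def)
  then show "g \<in> {u \<in> V. AE x in M. kernel_op k u x = t * u x}"
    using closed_subspace_closed[OF V uV gL lim] by simp
qed

definition commuting :: "('a \<Rightarrow> 'a \<Rightarrow> real) \<Rightarrow> ('a \<Rightarrow> 'a \<Rightarrow> real) \<Rightarrow> bool"
  where "commuting k l \<longleftrightarrow> (\<forall>u\<in>L. \<forall>x\<in>D. kernel_op k (kernel_op l u) x = kernel_op l (kernel_op k u) x)"

lemma eigenspace_invariant:
  assumes k: "sym_kernel k" and l: "sym_kernel l" and comm: "commuting k l"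
    and uL: "u \<in> L" and ev: "AE x in M. kernel_op k u x = t * u x"
  shows "AE x in M. kernel_op k (kernel_op l u) x = t * kernel_op l u x"
proof (intro AE_I2)
  fix x assume "x \<in> space M"
  then have x: "x \<in> D" by simp
  have "kernel_op k (kernel_op l u) x = kernel_op l (kernel_op k u) x" using comm uL x by (simp add: commuting_def)
  also have "\<dots> = kernel_op l (\<lambda>x. t * u x) x"
    by (rule kernel_op_cong_AE[OF l kernel_op_L[OF k uL] L_scale[OF uL] ev x])
  finally show "kernel_op k (kernel_op l u) x = t * kernel_op l u x" by (simp add: kernel_op_scale)
qed

text \<open>
  Since \<open>s\<close> acts on \<open>V\<close> as a positive scalar, adding a large multiple of it makes the form of an
  operator positive somewhere on \<open>V\<close> and only shifts the eigenvalues; so the operator has an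
  eigenvector in \<open>V\<close>. The other operators leave its eigenspace invariant, and the next one is
  diagonalized there.
\<close>

lemma common_eigenvector:
  fixes K :: "'i \<Rightarrow> 'a \<Rightarrow> 'a \<Rightarrow> real"
  assumes I: "finite I" and kernK: "\<And>i. i \<in> I \<Longrightarrow> sym_kernel (K i)" and s: "sym_kernel s" and m: "m > 0"
    and comm: "\<And>i j. i \<in> I \<Longrightarrow> j \<in> I \<Longrightarrow> commuting (K i) (K j)" "\<And>i. i \<in> I \<Longrightarrow> commuting (K i) s"
    and V: "closed_subspace V" "\<And>u. u \<in> V \<Longrightarrow> AE x in M. kernel_op s u x = m * u x"
    and inv: "\<And>i u. i \<in> I \<Longrightarrow> u \<in> V \<Longrightarrow> kernel_op (K i) u \<in> V" "\<And>u. u \<in> V \<Longrightarrow> kernel_op s u \<in> V"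
    and u1: "u1 \<in> V" "ip u1 u1 > 0"
  shows "\<exists>g\<in>V. ip g g = 1 \<and> (\<forall>i\<in>I. \<exists>t. AE x in M. kernel_op (K i) g x = t * g x)"
proof -
  have "\<exists>g\<in>V. ip g g = 1 \<and> (\<forall>i\<in>J. \<exists>t. AE x in M. kernel_op (K i) g x = t * g x)"
    if "finite J" "J \<subseteq> I" "closed_subspace V" "\<And>u. u \<in> V \<Longrightarrow> AE x in M. kernel_op s u x = m * u x"
      "\<And>i u. i \<in> I \<Longrightarrow> u \<in> V \<Longrightarrow> kernel_op (K i) u \<in> V" "\<And>u. u \<in> V \<Longrightarrow> kernel_op s u \<in> V"
      "u1 \<in> V" "ip u1 u1 > 0" for J V u1
    using that
  proof (induction J arbitrary: V u1)
    case empty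
    define c where "c = 1 / sqrt (ip u1 u1)"
    have "c * c * ip u1 u1 = 1" using empty.prems(7) by (simp add: c_def)
    moreover have "sqn (\<lambda>x. c * u1 x) = c * c * ip u1 u1"
      unfolding ip_scale using ip_scale[of c u1 u1] by (simp add: ip_commute)
    ultimately show ?case
      by (intro bexI[OF _ closed_subspace_scale[OF empty.prems(2,6), of c]]) auto
  next
    case (insert i J)
    note V = insert.prems(2,3) and inv = insert.prems(4,5) and u1 = insert.prems(6,7)
    have i: "i \<in> I" using insert.prems(1) by simp
    have VL: "\<And>u. u \<in> V \<Longrightarrow> u \<in> L" using closed_subspace_L[OF V(1)] .
    define a where "a = ip (kernel_op (K i) u1) u1"
    define c where "c = (1 + \<bar>a\<bar>) / (m * ip u1 u1)"
    define B where "B = (\<lambda>w x. K i w x + c * s w x)"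
    have B: "sym_kernel B" unfolding B_def by (rule sym_kernel_linear[OF kernK[OF i] s])
    have B_kernel_op: "kernel_op B u x = kernel_op (K i) u x + c * kernel_op s u x" if "u \<in> L" "x \<in> D" for u x
      unfolding B_def by (rule kernel_op_sym_kernel_linear[OF kernK[OF i] s that])
    have B_AE: "AE x in M. kernel_op B u x = kernel_op (K i) u x + c * m * u x" if u: "u \<in> V" for u
    proof -
      have "AE x in M. x \<in> D" by (auto intro: AE_I2)
      with V(2)[OF u] show ?thesis by eventually_elim (simp add: B_kernel_op VL[OF u])
    qed
    have invB: "kernel_op B u \<in> V" if u: "u \<in> V" for u
    proof -
      have v: "(\<lambda>x. kernel_op (K i) u x + c * kernel_op s u x) \<in> V"
        by (rule closed_subspace_add[OF V(1) inv(1)[OF i u] inv(2)[OF u]])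
      show ?thesis
      proof (rule closed_subspace_closed[OF V(1), of "\<lambda>_. \<lambda>x. kernel_op (K i) u x + c * kernel_op s u x"])
        have "sqn (\<lambda>x. (kernel_op (K i) u x + c * kernel_op s u x) - kernel_op B u x) = sqn (\<lambda>x. 0)"
          by (intro ip_cong) (simp_all add: B_kernel_op VL[OF u])
        then show "(\<lambda>n. sqn (\<lambda>x. (kernel_op (K i) u x + c * kernel_op s u x) - kernel_op B u x)) \<longlonglongrightarrow> 0"
          by (simp add: ip_def)
      qed (use v kernel_op_L[OF B VL[OF u]] in auto)
    qed
    have "ip (kernel_op B u1) u1 > 0"
    proof -
      have "ip (kernel_op B u1) u1 = ip (\<lambda>x. kernel_op (K i) u1 x + (c * m) * u1 x) u1"
        by (rule ip_cong_AE[OF kernel_op_L[OF B] _ _ B_AE])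
          (auto intro: u1 VL L_add_scaled kernel_op_L[OF kernK[OF i]])
      also have "\<dots> = a + c * m * ip u1 u1"
        unfolding a_def by (rule ip_add_scaled[OF kernel_op_L[OF kernK[OF i]]]) (auto intro: u1 VL)
      also have "c * m * ip u1 u1 = 1 + \<bar>a\<bar>"
        using m u1(2) by (simp add: c_def)
      finally show ?thesis by simp
    qed
    then obtain g t where g: "g \<in> V" "ip g g = 1" "\<And>x. x \<in> D \<Longrightarrow> kernel_op B g x = t * g x"
      using max_eigenvector[OF B V(1) invB u1(1)] by metis
    define V' where "V' = {u \<in> V. AE x in M. kernel_op (K i) u x = (t - c * m) * u x}"
    have gV': "g \<in> V'"
    proof -
      have "AE x in M. x \<in> D" by (auto intro: AE_I2)
      with B_AE[OF g(1)] have "AE x in M. kernel_op (K i) g x = (t - c * m) * g x"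
        by eventually_elim (use g(3) in \<open>auto simp: algebra_simps\<close>)
      then show ?thesis using g(1) by (simp add: V'_def)
    qed
    have "\<exists>g\<in>V'. ip g g = 1 \<and> (\<forall>i\<in>J. \<exists>t. AE x in M. kernel_op (K i) g x = t * g x)"
    proof (rule insert.IH[OF _ _ _ _ _ gV'])
      show "closed_subspace V'" unfolding V'_def by (rule closed_subspace_eigenspace[OF V(1) kernK[OF i]])
      show "AE x in M. kernel_op s u x = m * u x" if "u \<in> V'" for u using that V(2) by (simp add: V'_def)
      show "kernel_op (K j) u \<in> V'" if "j \<in> I" "u \<in> V'" for j u
        using that inv(1) eigenspace_invariant[OF kernK[OF i] kernK[OF \<open>j \<in> I\<close>] comm(1)[OF i \<open>j \<in> I\<close>] VL]
        by (auto simp: V'_def)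
      show "kernel_op s u \<in> V'" if "u \<in> V'" for u
        using that inv(2) eigenspace_invariant[OF kernK[OF i] s comm(2)[OF i] VL]
        by (auto simp: V'_def)
      show "ip g g > 0" using g by simp
    qed (use insert.prems(1) in auto)
    then show ?case unfolding V'_def by blast
  qed
  from this[OF I order_refl V inv u1] show ?thesis .
qed

lemma orthonormal_remainder:
  assumes "finite A" and f: "\<And>i. i \<in> A \<Longrightarrow> f i \<in> L"
    and on: "\<And>i j. i \<in> A \<Longrightarrow> j \<in> A \<Longrightarrow> ip (f i) (f j) = (if i = j then 1 else 0)"
    and u: "u \<in> L"
  defines "r \<equiv> (\<lambda>x. u x - (\<Sum>i\<in>A. ip u (f i) * f i x))"
  shows "r \<in> L" "\<And>j. j \<in> A \<Longrightarrow> ip r (f j) = 0" "ip r r = ip u u - (\<Sum>i\<in>A. (ip u (f i))\<^sup>2)"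
proof -
  define P where "P = (\<lambda>x. (\<Sum>i\<in>A. ip u (f i) * f i x))"
  have PL: "P \<in> L" unfolding P_def by (intro sq_int_sum L_scale f)
  have r: "r = (\<lambda>x. u x - P x)" by (simp add: r_def P_def)
  show rL: "r \<in> L" unfolding r by (rule sq_int_diff[OF u PL])
  have ipP: "ip P v = (\<Sum>i\<in>A. ip u (f i) * ip (f i) v)" if "v \<in> L" for v
    unfolding P_def by (subst ip_sum) (auto simp: ip_scale f that L_scale)
  show orth: "ip r (f j) = 0" if j: "j \<in> A" for j
  proof -
    have "ip P (f j) = (\<Sum>i\<in>A. if i = j then ip u (f i) else 0)"
      unfolding ipP[OF f[OF j]] by (intro sum.cong refl) (simp add: on j)
    also have "\<dots> = ip u (f j)" using j \<open>finite A\<close> by simp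
    finally show ?thesis unfolding r by (simp add: ip_diff[OF u PL f[OF j]])
  qed
  have "ip P r = 0" unfolding ipP[OF rL] using orth by (intro sum.neutral) (simp add: ip_commute)
  then have "ip r r = ip u r" using ip_diff[OF u PL rL] by (simp flip: r)
  also have "\<dots> = ip u u - ip P u" unfolding ip_commute[of u r] by (simp add: r ip_diff[OF u PL u])
  also have "ip P u = (\<Sum>i\<in>A. (ip u (f i))\<^sup>2)"
    unfolding ipP[OF u] by (intro sum.cong refl) (simp add: power2_eq_square ip_commute)
  finally show "ip r r = ip u u - (\<Sum>i\<in>A. (ip u (f i))\<^sup>2)" .
qed

lemma Bessel:
  assumes "finite A" and f: "\<And>i. i \<in> A \<Longrightarrow> f i \<in> L"
    and on: "\<And>i j. i \<in> A \<Longrightarrow> j \<in> A \<Longrightarrow> ip (f i) (f j) = (if i = j then 1 else 0)"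
    and u: "u \<in> L"
  shows "(\<Sum>i\<in>A. (ip u (f i))\<^sup>2) \<le> ip u u"
  using orthonormal_remainder(3)[OF assms] ip_ge_0[of "\<lambda>x. u x - (\<Sum>i\<in>A. ip u (f i) * f i x)"] by simp

end

section \<open>The spectral theorem for commuting kernels\<close>

text \<open>
  The inner products compared in \<open>gram_commute\<close> are the kernels of the two products of a pair of
  operators, so the assumption expresses that the operators commute.
\<close>

locale commuting_kernels = compact_domain +
  fixes I :: "'i set" and K :: "'i \<Rightarrow> 'a \<Rightarrow> 'a \<Rightarrow> real"
  assumes finite_I: "finite I"
    and kernK: "\<And>i. i \<in> I \<Longrightarrow> sym_kernel (K i)"
    and gram_commute: "\<And>i j x y. i \<in> I \<Longrightarrow> j \<in> I \<Longrightarrow> x \<in> D \<Longrightarrow> y \<in> D \<Longrightarrow>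
      ip (\<lambda>w. K i w x) (\<lambda>w. K j w y) = ip (\<lambda>w. K j w x) (\<lambda>w. K i w y)"
    and jointly_injective: "\<And>u. u \<in> L \<Longrightarrow> (\<And>i. i \<in> I \<Longrightarrow> AE x in M. kernel_op (K i) u x = 0) \<Longrightarrow> AE x in M. u x = 0"
    and D_nonnull: "\<not> negligible D"
begin

lemma kernel_op_kernel_op: 
  assumes k: "sym_kernel k" and l: "sym_kernel l" and u: "u \<in> L" and x: "x \<in> D"
  shows "kernel_op l (kernel_op k u) x = ip u (\<lambda>y. ip (\<lambda>w. l w x) (\<lambda>w. k w y))"
  using kernel_op_symmetric[OF k u sym_kernel_section_L[OF l x]] unfolding kernel_op_ip .

lemma commuting_K: "i \<in> I \<Longrightarrow> j \<in> I \<Longrightarrow> commuting (K i) (K j)"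
  unfolding commuting_def by (intro ballI) (simp add: kernel_op_kernel_op kernK gram_commute cong: ip_cong)

text \<open>The kernel of the sum of the squares of the operators.\<close>

definition sq_kernel :: "'a \<Rightarrow> 'a \<Rightarrow> real"
  where "sq_kernel x y = (\<Sum>i\<in>I. ip (\<lambda>w. K i w x) (\<lambda>w. K i w y))"

lemma sym_kernel_sq_kernel: "sym_kernel sq_kernel"
proof (rule kernI)
  show "sq_kernel x y = sq_kernel y x" for x y by (simp add: sq_kernel_def ip_commute)
  have "continuous_on (D \<times> D) (\<lambda>p. ip (\<lambda>w. K i w (fst p)) (\<lambda>w. K i w (snd p)))" if i: "i \<in> I" for i
  proof -
    have "continuous_on (D \<times> (D \<times> D)) ((\<lambda>(w, x). K i w x) \<circ> (\<lambda>z. (fst z, fst (snd z))))"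
      by (intro continuous_on_compose continuous_intros continuous_on_subset[OF sym_kernel_cont[OF kernK[OF i]]]) auto
    moreover have "continuous_on (D \<times> (D \<times> D)) ((\<lambda>(w, x). K i w x) \<circ> (\<lambda>z. (fst z, snd (snd z))))"
      by (intro continuous_on_compose continuous_intros continuous_on_subset[OF sym_kernel_cont[OF kernK[OF i]]]) auto
    ultimately have "continuous_on (D \<times> (D \<times> D)) (\<lambda>(w, p). K i w (fst p) * K i w (snd p))"
      by (simp add: comp_def split_beta' continuous_on_mult)
    from kernel_op_continuous[OF _ this, of "\<lambda>_. 1"] show ?thesis
      by (simp add: kernel_op_def ip_def)
  qed
  then show "continuous_on (D \<times> D) (\<lambda>(x, y). sq_kernel x y)"
    unfolding sq_kernel_def split_beta' by (rule continuous_on_sum)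
qed

lemma kernel_op_sq_kernel:
  assumes u: "u \<in> L" and x: "x \<in> D"
  shows "kernel_op sq_kernel u x = (\<Sum>i\<in>I. kernel_op (K i) (kernel_op (K i) u) x)"
proof -
  have *: "(\<lambda>y. ip (\<lambda>w. K i w x) (\<lambda>w. K i w y)) \<in> L" if "i \<in> I" for i
    using kernel_op_L[OF kernK[OF that] sym_kernel_section_L[OF kernK[OF that] x]] unfolding kernel_op_ip .
  have "kernel_op sq_kernel u x = ip (\<lambda>y. (\<Sum>i\<in>I. ip (\<lambda>w. K i w x) (\<lambda>w. K i w y))) u"
    unfolding kernel_op_ip sq_kernel_def by (subst ip_commute) (simp add: ip_commute)
  also have "\<dots> = (\<Sum>i\<in>I. ip (\<lambda>y. ip (\<lambda>w. K i w x) (\<lambda>w. K i w y)) u)"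
    by (rule ip_sum[OF * u])
  also have "\<dots> = (\<Sum>i\<in>I. kernel_op (K i) (kernel_op (K i) u) x)"
    by (intro sum.cong refl) (simp add: kernel_op_kernel_op[OF kernK kernK u x] ip_commute)
  finally show ?thesis .
qed

lemma ip_kernel_op_sq_kernel:
  assumes u: "u \<in> L" and v: "v \<in> L"
  shows "ip (kernel_op sq_kernel u) v = (\<Sum>i\<in>I. ip (kernel_op (K i) u) (kernel_op (K i) v))"
proof -
  have "ip (kernel_op sq_kernel u) v = ip (\<lambda>x. (\<Sum>i\<in>I. kernel_op (K i) (kernel_op (K i) u) x)) v"
    by (intro ip_cong) (simp_all add: kernel_op_sq_kernel[OF u])
  also have "\<dots> = (\<Sum>i\<in>I. ip (kernel_op (K i) (kernel_op (K i) u)) v)"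
    by (intro ip_sum kernel_op_L kernK u v)
  also have "\<dots> = (\<Sum>i\<in>I. ip (kernel_op (K i) u) (kernel_op (K i) v))"
    by (intro sum.cong refl kernel_op_symmetric kernK kernel_op_L u v)
  finally show ?thesis .
qed

lemma commuting_sq_kernel: assumes i: "i \<in> I" shows "commuting (K i) sq_kernel"
  unfolding commuting_def
proof (intro ballI)
  fix u x assume u: "u \<in> L" and x: "x \<in> D"
  have KK: "kernel_op (K j) (kernel_op (K j) u) \<in> L" if "j \<in> I" for j by (intro kernel_op_L kernK that u)
  have "kernel_op (K i) (kernel_op sq_kernel u) x = kernel_op (K i) (\<lambda>x. (\<Sum>j\<in>I. kernel_op (K j) (kernel_op (K j) u) x)) x"
    by (intro kernel_op_cong) (simp add: kernel_op_sq_kernel[OF u])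
  also have "\<dots> = (\<Sum>j\<in>I. kernel_op (K i) (kernel_op (K j) (kernel_op (K j) u)) x)"
    unfolding kernel_op_ip[of "K i"] by (intro ip_sum KK sym_kernel_section_L[OF kernK[OF i] x])
  also have "\<dots> = (\<Sum>j\<in>I. kernel_op (K j) (kernel_op (K j) (kernel_op (K i) u)) x)"
  proof (intro sum.cong refl)
    fix j assume j: "j \<in> I"
    have "kernel_op (K i) (kernel_op (K j) (kernel_op (K j) u)) x = kernel_op (K j) (kernel_op (K i) (kernel_op (K j) u)) x"
      using commuting_K[OF i j] kernel_op_L[OF kernK[OF j] u] x by (simp add: commuting_def)
    also have "\<dots> = kernel_op (K j) (kernel_op (K j) (kernel_op (K i) u)) x"
      using commuting_K[OF i j] u by (intro kernel_op_cong) (simp add: commuting_def)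
    finally show "kernel_op (K i) (kernel_op (K j) (kernel_op (K j) u)) x = kernel_op (K j) (kernel_op (K j) (kernel_op (K i) u)) x" .
  qed
  also have "\<dots> = kernel_op sq_kernel (kernel_op (K i) u) x"
    by (rule kernel_op_sq_kernel[OF kernel_op_L[OF kernK[OF i] u] x, symmetric])
  finally show "kernel_op (K i) (kernel_op sq_kernel u) x = kernel_op sq_kernel (kernel_op (K i) u) x" .
qed

lemma ip_kernel_op_sq_kernel_pos:
  assumes u: "u \<in> L" "ip u u > 0" shows "ip (kernel_op sq_kernel u) u > 0"
proof (rule ccontr)
  assume "\<not> ip (kernel_op sq_kernel u) u > 0"
  then have "(\<Sum>i\<in>I. sqn (kernel_op (K i) u)) = 0"
    using ip_kernel_op_sq_kernel[OF u(1) u(1)] sum_nonneg[of I "\<lambda>i. sqn (kernel_op (K i) u)"] by (simp add: ip_ge_0)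
  then have "sqn (kernel_op (K i) u) = 0" if "i \<in> I" for i
    using that sum_nonneg_eq_0_iff[OF finite_I, of "\<lambda>i. sqn (kernel_op (K i) u)"] by (simp add: ip_ge_0)
  then have "AE x in M. kernel_op (K i) u x = 0" if "i \<in> I" for i
    using that ip_eq_0_AE[OF kernel_op_L[OF kernK[OF that] u(1)]] by simp
  then have "AE x in M. u x = 0" by (rule jointly_injective[OF u(1)])
  then show False using ip_eq_0_AE[OF u(1)] u(2) by simp
qed

definition perp :: "('a \<Rightarrow> real) set \<Rightarrow> ('a \<Rightarrow> real) set"
  where "perp G = {u \<in> L. \<forall>g\<in>G. ip u g = 0}"

lemma closed_subspace_perp:
  assumes G: "G \<subseteq> L" shows "closed_subspace (perp G)"
  unfolding closed_subspace_def
proof (intro conjI ballI allI impI)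
  show "perp G \<subseteq> L" by (auto simp: perp_def)
  show "(\<lambda>x. u x + c * v x) \<in> perp G" if "u \<in> perp G" "v \<in> perp G" for u v c
    using that G by (auto simp: perp_def ip_add_scaled subsetD intro: L_add_scaled)
  show "g \<in> perp G"
    if *: "(\<forall>n. u n \<in> perp G) \<and> g \<in> L \<and> (\<lambda>n. sqn (\<lambda>x. u n x - g x)) \<longlonglongrightarrow> 0" for u g
  proof -
    have "ip g h = 0" if h: "h \<in> G" for h
    proof -
      have "(\<lambda>n. ip (u n) h) \<longlonglongrightarrow> ip g h"
        using * G h by (intro ip_tendsto) (auto simp: perp_def)
      moreover have "ip (u n) h = 0" for n using * h by (auto simp: perp_def)
      ultimately show ?thesis by (simp add: LIMSEQ_const_iff)
    qed
    with * show ?thesis by (simp add: perp_def)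
  qed
qed

definition eigenfunction :: "('a \<Rightarrow> real) \<Rightarrow> bool"
  where "eigenfunction g \<longleftrightarrow> continuous_on D g \<and> ip g g = 1 \<and> (\<exists>m. \<forall>x\<in>D. kernel_op sq_kernel g x = m * g x) \<and>
    (\<forall>i\<in>I. \<exists>t. \<forall>x\<in>D. kernel_op (K i) g x = t * g x)"

lemma eigenfunction_L: "eigenfunction g \<Longrightarrow> g \<in> L"
  unfolding eigenfunction_def by (intro continuous_sq_int) auto

lemma perp_invariant:
  assumes k: "sym_kernel k" and G: "\<And>g. g \<in> G \<Longrightarrow> g \<in> L \<and> (\<exists>t. \<forall>x\<in>D. kernel_op k g x = t * g x)"
    and u: "u \<in> perp G"
  shows "kernel_op k u \<in> perp G"
proof -
  have uL: "u \<in> L" using u by (simp add: perp_def)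
  have "ip (kernel_op k u) g = 0" if g: "g \<in> G" for g
  proof -
    obtain t where t: "\<And>x. x \<in> D \<Longrightarrow> kernel_op k g x = t * g x" using G[OF g] by blast
    have "ip (kernel_op k u) g = ip u (kernel_op k g)" using G[OF g] by (intro kernel_op_symmetric[OF k uL]) simp
    also have "\<dots> = ip u (\<lambda>x. t * g x)" by (intro ip_cong refl t)
    also have "\<dots> = t * ip u g" using ip_scale[of t g u] by (simp add: ip_commute)
    finally show ?thesis using u g by (simp add: perp_def)
  qed
  then show ?thesis using kernel_op_L[OF k uL] by (simp add: perp_def)
qed

text \<open>
  Finitely many balls of a given small radius cover the compact domain, so one of them meets it in
  a set of positive measure.
\<close>

lemma small_set:
  assumes e: "e > 0"
  obtains B where "B \<in> sets M" "measure M B > 0" "measure M B < e"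
proof -
  have lim: "((\<lambda>r. measure lebesgue (ball (0::'a) r)) \<longlongrightarrow> 0) (at_right 0)"
  proof -
    have "((\<lambda>r. unit_ball_vol (real DIM('a)) * r ^ DIM('a)) \<longlongrightarrow> unit_ball_vol (real DIM('a)) * 0 ^ DIM('a)) (at_right 0)"
      by (intro tendsto_intros)
    then have "((\<lambda>r. unit_ball_vol (real DIM('a)) * r ^ DIM('a)) \<longlongrightarrow> 0) (at_right 0)"
      by (simp add: zero_power)
    moreover have "\<forall>\<^sub>F r in at_right 0. unit_ball_vol (real DIM('a)) * r ^ DIM('a) = measure lebesgue (ball (0::'a) r)"
      using eventually_at_right_less[of "0::real"] by eventually_elim (simp add: content_ball)
    ultimately show ?thesis by (rule Lim_transform_eventually)
  qed
  have "\<forall>\<^sub>F r in at_right 0. measure lebesgue (ball (0::'a) r) < e"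
    using order_tendstoD(2)[OF lim e] .
  then have "\<exists>r>0. measure lebesgue (ball (0::'a) r) < e"
    using eventually_at_right_less[of "0::real"] by (metis (mono_tags, lifting) eventually_conj eventually_happens trivial_limit_at_right_real)
  then obtain r where r: "r > 0" "measure lebesgue (ball (0::'a) r) < e" by blast
  have "D \<subseteq> (\<Union>c\<in>D. ball c r)" using r by auto
  then obtain F where F: "F \<subseteq> D" "finite F" "D \<subseteq> (\<Union>c\<in>F. ball c r)"
    by (rule compactE_image[OF compact_D open_ball])
  have ms: "D \<inter> ball c r \<in> lmeasurable" for c
    by (intro fmeasurable.Int D_lmeasurable lmeasurable_ball)
  have "\<exists>c\<in>F. \<not> negligible (D \<inter> ball c r)"
  proof (rule ccontr)
    assume "\<not> ?thesis"
    then have "negligible (\<Union>c\<in>F. D \<inter> ball c r)" using F(2) by (intro negligible_Union) auto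
    moreover have "D \<subseteq> (\<Union>c\<in>F. D \<inter> ball c r)" using F(3) by auto
    ultimately show False using D_nonnull negligible_subset by blast
  qed
  then obtain c where c: "\<not> negligible (D \<inter> ball c r)" by blast
  have eq: "measure M (D \<inter> ball c r) = measure lebesgue (D \<inter> ball c r)"
    using fmeasurableD[OF D_lmeasurable] by (intro measure_restrict_space) auto
  show ?thesis
  proof (rule that[of "D \<inter> ball c r"])
    show "D \<inter> ball c r \<in> sets M"
      using fmeasurableD[OF ms] fmeasurableD[OF D_lmeasurable] by (simp add: sets_restrict_space_iff)
    show "measure M (D \<inter> ball c r) > 0"
      unfolding eq using c ms[of c] negligible_iff_measure0[of "D \<inter> ball c r"]
      by (simp add: zero_less_measure_iff negligible_iff_measure)
    have "measure lebesgue (D \<inter> ball c r) \<le> measure lebesgue (ball c r)"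
      using fmeasurableD[OF ms] by (intro measure_mono_fmeasurable) auto
    also have "\<dots> = measure lebesgue (ball (0::'a) r)" by (simp add: content_ball r less_imp_le)
    finally show "measure M (D \<inter> ball c r) < e" unfolding eq using r by simp
  qed
qed

text \<open>
  The indicator function of a set of small positive measure \<open>b\<close> has norm \<open>\<surd>b\<close>, but its
  coefficients with respect to the finitely many bounded functions in \<open>G\<close> are of order \<open>b\<close>; so
  its remainder is not zero. This is why the sequence of eigenfunctions never ends.
\<close>

lemma perp_nontrivial:
  assumes G: "finite G" "\<And>g. g \<in> G \<Longrightarrow> continuous_on D g"
    and on: "\<And>g h. g \<in> G \<Longrightarrow> h \<in> G \<Longrightarrow> ip g h = (if g = h then 1 else 0)"
  obtains u where "u \<in> perp G" "ip u u > 0"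
proof -
  have "\<exists>C\<ge>0. \<forall>x\<in>D. \<bar>g x\<bar> \<le> C" if "g \<in> G" for g
    using continuous_bounded[OF G(2)[OF that]] by (metis real_norm_def)
  then obtain c where c: "\<And>g. g \<in> G \<Longrightarrow> c g \<ge> 0" "\<And>g x. g \<in> G \<Longrightarrow> x \<in> D \<Longrightarrow> \<bar>g x\<bar> \<le> c g" by metis
  define C where "C = (\<Sum>g\<in>G. (c g)\<^sup>2)"
  have C: "C \<ge> 0" unfolding C_def by (intro sum_nonneg) simp
  obtain B where B: "B \<in> sets M" "measure M B > 0" "measure M B < 1 / (C + 1)"
    using small_set[of "1 / (C + 1)"] C by (metis add_nonneg_pos divide_pos_pos zero_less_one)
  have BD: "B \<inter> D = B" using sets.sets_into_space[OF B(1)] by auto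
  define b where "b = measure M B"
  have b: "0 < b" "b * C < 1"
  proof -
    show "0 < b" using B by (simp add: b_def)
    have "b * (C + 1) < 1" using B(3) C by (simp add: b_def field_simps)
    then show "b * C < 1" using \<open>0 < b\<close> by (simp add: algebra_simps)
  qed
  define f where "f = (indicator B :: 'a \<Rightarrow> real)"
  have fL: "f \<in> L" unfolding f_def using B(1) by (intro sq_int_bounded[of _ 1]) auto
  have ff: "ip f f = b"
  proof -
    have "ip f f = (LINT x|M. indicator B x)" by (simp add: ip_def f_def flip: indicator_inter_arith)
    then show ?thesis using B(1) BD by (simp add: b_def)
  qed
  have fg: "(ip f g)\<^sup>2 \<le> (c g)\<^sup>2 * b\<^sup>2" if g: "g \<in> G" for g
  proof -
    have gL: "g \<in> L" by (rule continuous_sq_int[OF G(2)[OF g]])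
    have "\<bar>ip f g\<bar> \<le> (LINT x|M. \<bar>f x * g x\<bar>)" unfolding ip_def by simp
    also have "\<dots> \<le> (LINT x|M. c g * indicator B x)"
    proof (rule integral_mono)
      show "integrable M (\<lambda>x. \<bar>f x * g x\<bar>)" using sq_int_mult_integrable[OF fL gL] by simp
      have "integrable M (indicat_real B)"
        using B(1) by (intro integrable_real_indicator) (simp_all add: less_top[symmetric])
      then show "integrable M (\<lambda>x. c g * indicator B x)" by simp
      show "\<bar>f x * g x\<bar> \<le> c g * indicator B x" if "x \<in> space M" for x
        using c(2)[OF g, of x] that by (auto simp: f_def indicator_def)
    qed
    also have "\<dots> = c g * b" using B(1) BD by (simp add: b_def)
    finally have "(ip f g)\<^sup>2 \<le> (c g * b)\<^sup>2" by (rule square_le)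
    then show ?thesis by (simp add: power_mult_distrib)
  qed
  note rem = orthonormal_remainder[of G "\<lambda>g. g" f, OF G(1) continuous_sq_int[OF G(2)] on fL]
  define u where "u = (\<lambda>x. f x - (\<Sum>g\<in>G. ip f g * g x))"
  have "u \<in> perp G" unfolding perp_def u_def using rem(1,2) by simp
  moreover have "ip u u > 0"
  proof -
    have "(\<Sum>g\<in>G. (ip f g)\<^sup>2) \<le> (\<Sum>g\<in>G. (c g)\<^sup>2 * b\<^sup>2)" by (intro sum_mono fg)
    also have "\<dots> = b * (b * C)" by (simp add: C_def power2_eq_square mult_ac sum_distrib_left)
    also have "\<dots> < b * 1" using b by (intro mult_strict_left_mono)
    finally show ?thesis using rem(3) by (simp add: ff u_def)
  qed
  ultimately show ?thesis by (rule that)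
qed

text \<open>
  The complement of known eigenfunctions is invariant under all the operators, so the maximal
  eigenspace of the sum of squares in it contains a common eigenfunction. Maximality is recorded
  because it makes the eigenvalues decrease and later forces completeness.
\<close>

lemma next_eigenfunction:
  assumes G: "finite G" "\<And>g. g \<in> G \<Longrightarrow> eigenfunction g"
    and on: "\<And>g h. g \<in> G \<Longrightarrow> h \<in> G \<Longrightarrow> ip g h = (if g = h then 1 else 0)"
  obtains g where "eigenfunction g" "g \<in> perp G" "ip (kernel_op sq_kernel g) g > 0"
    "\<And>u. u \<in> perp G \<Longrightarrow> ip (kernel_op sq_kernel u) u \<le> ip (kernel_op sq_kernel g) g * ip u u"
proof -
  have GL: "G \<subseteq> L" using G(2) eigenfunction_L by blast
  note cs = closed_subspace_perp[OF GL]
  have inv_sq: "kernel_op sq_kernel u \<in> perp G" if "u \<in> perp G" for u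
    using G(2) eigenfunction_L by (intro perp_invariant[OF sym_kernel_sq_kernel _ that]) (auto simp: eigenfunction_def)
  have inv_K: "kernel_op (K i) u \<in> perp G" if "i \<in> I" "u \<in> perp G" for i u
    using G(2) eigenfunction_L that(1) by (intro perp_invariant[OF kernK[OF that(1)] _ that(2)]) (auto simp: eigenfunction_def)
  obtain u1 where u1: "u1 \<in> perp G" "ip u1 u1 > 0"
    using perp_nontrivial[OF G(1) _ on] G(2) unfolding eigenfunction_def by metis
  have "ip (kernel_op sq_kernel u1) u1 > 0" using ip_kernel_op_sq_kernel_pos u1 by (simp add: perp_def)
  then obtain g0 m where g0: "g0 \<in> perp G" "ip g0 g0 = 1" "m > 0" "\<And>x. x \<in> D \<Longrightarrow> kernel_op sq_kernel g0 x = m * g0 x"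
    and max: "\<And>u. u \<in> perp G \<Longrightarrow> ip (kernel_op sq_kernel u) u \<le> m * ip u u"
    using max_eigenvector[OF sym_kernel_sq_kernel cs inv_sq u1(1)] by metis
  define V where "V = {u \<in> perp G. AE x in M. kernel_op sq_kernel u x = m * u x}"
  have "\<exists>g\<in>V. ip g g = 1 \<and> (\<forall>i\<in>I. \<exists>t. AE x in M. kernel_op (K i) g x = t * g x)"
  proof (rule common_eigenvector[OF finite_I kernK sym_kernel_sq_kernel g0(3)])
    show "commuting (K i) (K j)" if "i \<in> I" "j \<in> I" for i j by (rule commuting_K[OF that])
    show "commuting (K i) sq_kernel" if "i \<in> I" for i by (rule commuting_sq_kernel[OF that])
    show "closed_subspace V" unfolding V_def by (rule closed_subspace_eigenspace[OF cs sym_kernel_sq_kernel])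
    show "AE x in M. kernel_op sq_kernel u x = m * u x" if "u \<in> V" for u using that by (simp add: V_def)
    show "kernel_op (K i) u \<in> V" if i: "i \<in> I" and u: "u \<in> V" for i u
    proof -
      have "commuting sq_kernel (K i)" using commuting_sq_kernel[OF i] by (simp add: commuting_def)
      from eigenspace_invariant[OF sym_kernel_sq_kernel kernK[OF i] this, of u m]
      show ?thesis using u inv_K[OF i] by (simp add: V_def perp_def)
    qed
    show "kernel_op sq_kernel u \<in> V" if u: "u \<in> V" for u
    proof -
      have "commuting sq_kernel sq_kernel" by (simp add: commuting_def)
      from eigenspace_invariant[OF sym_kernel_sq_kernel sym_kernel_sq_kernel this, of u m]
      show ?thesis using u inv_sq by (simp add: V_def perp_def)
    qed
    show "g0 \<in> V" using g0(1,4) by (auto simp: V_def intro!: AE_I2)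
    show "ip g0 g0 > 0" using g0 by simp
  qed
  then obtain g1 where g1: "g1 \<in> perp G" "AE x in M. kernel_op sq_kernel g1 x = m * g1 x" "ip g1 g1 = 1"
    "\<And>i. i \<in> I \<Longrightarrow> \<exists>t. AE x in M. kernel_op (K i) g1 x = t * g1 x" by (auto simp: V_def)
  have g1L: "g1 \<in> L" using g1(1) by (simp add: perp_def)
  \<comment> \<open>Replacing the eigenfunction by its image makes it continuous and the eigenvalue equations
    hold everywhere rather than almost everywhere.\<close>
  define g where "g = (\<lambda>x. (1 / m) * kernel_op sq_kernel g1 x)"
  have gV: "g \<in> perp G" unfolding g_def by (rule closed_subspace_scale[OF cs inv_sq[OF g1(1)]])
  have gL: "g \<in> L" using gV by (simp add: perp_def)
  have ae: "AE x in M. g x = g1 x" using g1(2) by eventually_elim (use g0(3) in \<open>simp add: g_def\<close>)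
  have cont: "continuous_on D g"
    unfolding g_def by (intro continuous_intros kernel_op_sym_kernel_continuous[OF sym_kernel_sq_kernel g1L])
  have s_g: "kernel_op sq_kernel g x = m * g x" if x: "x \<in> D" for x
    using kernel_op_cong_AE[OF sym_kernel_sq_kernel gL g1L ae x] g0(3) by (simp add: g_def)
  have gg: "ip g g = 1"
    using ip_cong_AE[OF gL g1L gL ae] ip_cong_AE[OF gL g1L g1L ae] g1(3) by (simp add: ip_commute)
  have K_g: "\<exists>t. \<forall>x\<in>D. kernel_op (K i) g x = t * g x" if i: "i \<in> I" for i
  proof -
    obtain t where t: "AE x in M. kernel_op (K i) g1 x = t * g1 x" using g1(4)[OF i] by blast
    have "kernel_op (K i) g x = t * g x" if x: "x \<in> D" for x
    proof -
      have "kernel_op (K i) g x = (1 / m) * kernel_op (K i) (kernel_op sq_kernel g1) x" unfolding g_def by (rule kernel_op_scale)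
      also have "kernel_op (K i) (kernel_op sq_kernel g1) x = kernel_op sq_kernel (kernel_op (K i) g1) x"
        using commuting_sq_kernel[OF i] g1L x by (simp add: commuting_def)
      also have "\<dots> = kernel_op sq_kernel (\<lambda>x. t * g1 x) x"
        by (rule kernel_op_cong_AE[OF sym_kernel_sq_kernel kernel_op_L[OF kernK[OF i] g1L] L_scale[OF g1L] t x])
      also have "\<dots> = t * kernel_op sq_kernel g1 x" by (rule kernel_op_scale)
      finally show ?thesis by (simp add: g_def)
    qed
    then show ?thesis by blast
  qed
  have m_eq: "ip (kernel_op sq_kernel g) g = m"
  proof -
    have "ip (kernel_op sq_kernel g) g = ip (\<lambda>x. m * g x) g" by (intro ip_cong refl s_g)
    then show ?thesis by (simp add: ip_scale gg)
  qed
  have "eigenfunction g" using cont gg s_g K_g by (auto simp: eigenfunction_def)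
  then show ?thesis using gV max g0(3) by (intro that[of g]) (simp_all add: m_eq)
qed

lemma eigenfunction_sequence:
  obtains F :: "nat \<Rightarrow> 'a \<Rightarrow> real" where "\<And>n. eigenfunction (F n)"
    "\<And>m n. ip (F m) (F n) = (if m = n then 1 else 0)" "\<And>n. ip (kernel_op sq_kernel (F n)) (F n) > 0"
    "\<And>n u. u \<in> perp (F ` {..<n}) \<Longrightarrow> ip (kernel_op sq_kernel u) u \<le> ip (kernel_op sq_kernel (F n)) (F n) * ip u u"
proof -
  \<comment> \<open>The state of the recursion is the set of the earlier functions together with the new one.\<close>
  define P where "P = (\<lambda>(n::nat) (Gg :: ('a \<Rightarrow> real) set \<times> ('a \<Rightarrow> real)). case Gg of (G, g) \<Rightarrow>
    (n = 0 \<longrightarrow> G = {}) \<and> finite G \<and> (\<forall>g\<in>G. eigenfunction g) \<and> (\<forall>g\<in>G. \<forall>h\<in>G. ip g h = (if g = h then 1 else 0)) \<and>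
    eigenfunction g \<and> g \<in> perp G \<and> ip (kernel_op sq_kernel g) g > 0 \<and> (\<forall>u\<in>perp G. ip (kernel_op sq_kernel u) u \<le> ip (kernel_op sq_kernel g) g * ip u u))"
  define Q where "Q = (\<lambda>(n::nat) (Gg :: ('a \<Rightarrow> real) set \<times> ('a \<Rightarrow> real)) (Hh :: ('a \<Rightarrow> real) set \<times> ('a \<Rightarrow> real)). fst Hh = insert (snd Gg) (fst Gg))"
  have "\<exists>f. \<forall>n. P n (f n) \<and> Q n (f n) (f (Suc n))"
  proof (rule dependent_nat_choice)
    obtain g where "eigenfunction g" "g \<in> perp {}" "ip (kernel_op sq_kernel g) g > 0"
      "\<And>u. u \<in> perp {} \<Longrightarrow> ip (kernel_op sq_kernel u) u \<le> ip (kernel_op sq_kernel g) g * ip u u"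
      by (rule next_eigenfunction[of "{}"]) auto
    then show "\<exists>x. P 0 x" by (intro exI[of _ "({}, g)"]) (simp add: P_def)
    show "\<exists>y. P (Suc n) y \<and> Q n x y" if x: "P n x" for x n
    proof -
      obtain G g where Gg: "x = (G, g)" by (cases x)
      have G: "finite G" "\<And>g. g \<in> G \<Longrightarrow> eigenfunction g" "\<And>g h. g \<in> G \<Longrightarrow> h \<in> G \<Longrightarrow> ip g h = (if g = h then 1 else 0)"
        and g: "eigenfunction g" "g \<in> perp G" using x by (auto simp: P_def Gg)
      have fin: "finite (insert g G)" using G(1) by simp
      have ei: "eigenfunction h" if "h \<in> insert g G" for h using that G(2) g(1) by auto
      have on: "ip h h' = (if h = h' then 1 else 0)" if h: "h \<in> insert g G" "h' \<in> insert g G" for h h'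
      proof (cases "h = h'")
        case True then show ?thesis using ei[OF h(1)] by (simp add: eigenfunction_def)
      next
        case False
        then have "ip h h' = 0"
          using h g(2) G(3)[of h h'] by (auto simp: perp_def ip_commute[of _ g])
        with False show ?thesis by simp
      qed
      obtain g' where "eigenfunction g'" "g' \<in> perp (insert g G)" "ip (kernel_op sq_kernel g') g' > 0"
        "\<And>u. u \<in> perp (insert g G) \<Longrightarrow> ip (kernel_op sq_kernel u) u \<le> ip (kernel_op sq_kernel g') g' * ip u u"
        using next_eigenfunction[OF fin ei on] by metis
      then show ?thesis
        using fin ei on by (intro exI[of _ "(insert g G, g')"]) (simp add: P_def Q_def Gg)
    qed
  qed
  then obtain f where f: "\<And>n. P n (f n)" "\<And>n. Q n (f n) (f (Suc n))" by blast
  define F where "F n = snd (f n)" for n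
  have fstf: "fst (f n) = F ` {..<n}" for n
  proof (induction n)
    case 0 then show ?case using f(1)[of 0] by (simp add: P_def split_beta')
  next
    case (Suc n) then show ?case using f(2)[of n] by (simp add: Q_def F_def lessThan_Suc)
  qed
  have P: "eigenfunction (F n)" "F n \<in> perp (F ` {..<n})" "ip (kernel_op sq_kernel (F n)) (F n) > 0"
    "\<And>u. u \<in> perp (F ` {..<n}) \<Longrightarrow> ip (kernel_op sq_kernel u) u \<le> ip (kernel_op sq_kernel (F n)) (F n) * ip u u" for n
    using f(1)[of n] by (auto simp: P_def split_beta' fstf simp flip: F_def)
  have lt: "ip (F n) (F m) = 0" if "m < n" for m n
    using P(2)[of n] that by (auto simp: perp_def)
  have "ip (F m) (F n) = (if m = n then 1 else 0)" for m n
    using lt[of m n] lt[of n m] P(1)[of n] ip_commute[of "F m" "F n"]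
    by (cases m n rule: linorder_cases) (auto simp: eigenfunction_def)
  with P show ?thesis by (intro that[of F]) auto
qed

text \<open>
  Bessel's inequality for the sections of the kernels makes the squares of the eigenvalues summable,
  so they tend to zero. The remainders of an expansion form a Cauchy sequence; their limit, which
  exists by the theorem of Riesz and Fischer, is orthogonal to all \<open>F\<^sub>n\<close>. By maximality its quadratic
  form is then bounded by every eigenvalue, hence zero, and joint injectivity makes it vanish.
\<close>

theorem simultaneous_diagonalization:
  obtains F :: "nat \<Rightarrow> 'a \<Rightarrow> real" and t :: "'i \<Rightarrow> nat \<Rightarrow> real" where
    "\<And>n. continuous_on D (F n)"
    "\<And>m n. ip (F m) (F n) = (if m = n then 1 else 0)"
    "\<And>i n x. i \<in> I \<Longrightarrow> x \<in> D \<Longrightarrow> kernel_op (K i) (F n) x = t i n * F n x"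
    "\<And>n. (\<Sum>i\<in>I. (t i (Suc n))\<^sup>2) \<le> (\<Sum>i\<in>I. (t i n)\<^sup>2)"
    "\<And>n. (\<Sum>i\<in>I. (t i n)\<^sup>2) > 0"
    "summable (\<lambda>n. \<Sum>i\<in>I. (t i n)\<^sup>2)"
    "\<And>u. u \<in> L \<Longrightarrow> (\<lambda>N. sqn (\<lambda>x. u x - (\<Sum>n<N. ip u (F n) * F n x))) \<longlonglongrightarrow> 0"
proof -
  obtain F :: "nat \<Rightarrow> 'a \<Rightarrow> real" where F: "\<And>n. eigenfunction (F n)"
    and on: "\<And>m n. ip (F m) (F n) = (if m = n then 1 else 0)"
    and pos: "\<And>n. ip (kernel_op sq_kernel (F n)) (F n) > 0"
    and max: "\<And>n u. u \<in> perp (F ` {..<n}) \<Longrightarrow> ip (kernel_op sq_kernel u) u \<le> ip (kernel_op sq_kernel (F n)) (F n) * ip u u"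
    by (rule eigenfunction_sequence) blast
  have FL: "F n \<in> L" for n by (rule eigenfunction_L[OF F])
  have "\<forall>i n. \<exists>t. i \<in> I \<longrightarrow> (\<forall>x\<in>D. kernel_op (K i) (F n) x = t * F n x)" using F by (auto simp: eigenfunction_def)
  then obtain t where t: "\<And>i n x. i \<in> I \<Longrightarrow> x \<in> D \<Longrightarrow> kernel_op (K i) (F n) x = t i n * F n x" by metis
  define \<mu> where "\<mu> n = ip (kernel_op sq_kernel (F n)) (F n)" for n
  have KF: "sqn (kernel_op (K i) (F n)) = (t i n)\<^sup>2" if "i \<in> I" for i n
  proof -
    have "sqn (kernel_op (K i) (F n)) = sqn (\<lambda>x. t i n * F n x)"
      by (intro ip_cong t that)
    also have "\<dots> = (t i n)\<^sup>2 * sqn (F n)"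
      unfolding ip_scale using ip_scale[of "t i n" "F n" "F n"] by (simp add: ip_commute power2_eq_square)
    finally show ?thesis by (simp add: on)
  qed
  have \<mu>: "\<mu> n = (\<Sum>i\<in>I. (t i n)\<^sup>2)" for n
    unfolding \<mu>_def ip_kernel_op_sq_kernel[OF FL FL] by (intro sum.cong refl KF)
  have "\<mu> (Suc n) \<le> \<mu> n" for n
  proof -
    have "F (Suc n) \<in> perp (F ` {..<n})" using on FL by (auto simp: perp_def)
    from max[OF this] show ?thesis by (simp add: \<mu>_def on)
  qed
  then have anti: "(\<Sum>i\<in>I. (t i (Suc n))\<^sup>2) \<le> (\<Sum>i\<in>I. (t i n)\<^sup>2)" for n by (simp add: \<mu>)
  have mpos: "(\<Sum>i\<in>I. (t i n)\<^sup>2) > 0" for n using pos[of n] by (simp flip: \<mu> add: \<mu>_def)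
  have "summable (\<lambda>n. (t i n)\<^sup>2)" if i: "i \<in> I" for i
  proof -
    obtain C where C: "\<And>w x. w \<in> D \<Longrightarrow> x \<in> D \<Longrightarrow> \<bar>K i w x\<bar> \<le> C"
      using kernel_bounded[OF sym_kernel_cont[OF kernK[OF i]] compact_D] by (metis real_norm_def)
    define b where "b = C\<^sup>2 * measure M D"
    have pt: "(\<Sum>n<N. (kernel_op (K i) (F n) x)\<^sup>2) \<le> b" if x: "x \<in> D" for N x
    proof -
      have "(\<Sum>n<N. (ip (\<lambda>w. K i w x) (F n))\<^sup>2) \<le> sqn (\<lambda>w. K i w x)"
        by (intro Bessel FL on sym_kernel_section_L[OF kernK[OF i] x]) auto
      also have "\<dots> \<le> b" unfolding b_def using C x by (intro ip_self_le sym_kernel_section_L[OF kernK[OF i] x]) auto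
      finally show ?thesis by (simp add: kernel_op_ip ip_commute)
    qed
    have "(\<Sum>n<N. (t i n)\<^sup>2) \<le> b * measure M D" for N
    proof -
      have int: "integrable M (\<lambda>x. (kernel_op (K i) (F n) x)\<^sup>2)" for n
        by (intro sq_int_real_integrable kernel_op_L[OF kernK[OF i]] FL)
      have "(\<Sum>n<N. (t i n)\<^sup>2) = (\<Sum>n<N. LINT x|M. (kernel_op (K i) (F n) x)\<^sup>2)"
        by (simp only: KF[OF i, symmetric] ip_self)
      also have "\<dots> = (LINT x|M. (\<Sum>n<N. (kernel_op (K i) (F n) x)\<^sup>2))"
        by (rule Bochner_Integration.integral_sum[symmetric]) (rule int)
      also have "\<dots> \<le> (LINT x|M. b)" by (intro integral_mono Bochner_Integration.integrable_sum int) (auto simp: pt)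
      finally show ?thesis by (simp add: mult.commute)
    qed
    then show ?thesis by (intro summableI_nonneg_bounded) auto
  qed
  then have summ: "summable (\<lambda>n. \<Sum>i\<in>I. (t i n)\<^sup>2)" by (rule summable_sum)
  then have \<mu>0: "\<mu> \<longlonglongrightarrow> 0" unfolding \<mu>[abs_def] by (rule summable_LIMSEQ_zero)
  have complete: "(\<lambda>N. sqn (\<lambda>x. u x - (\<Sum>n<N. ip u (F n) * F n x))) \<longlonglongrightarrow> 0"
    if u: "u \<in> L" for u
  proof -
    define R where "R N = (\<lambda>x. u x - (\<Sum>n<N. ip u (F n) * F n x))" for N
    define c where "c n = ip u (F n)" for n
    note rem = orthonormal_remainder[of "{..<N}" F for N, OF finite_lessThan FL on u, folded R_def]
    have RL: "R N \<in> L" for N by (rule rem(1))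
    have sq: "summable (\<lambda>n. (c n)\<^sup>2)"
      unfolding c_def by (intro summableI_nonneg_bounded[of _ "ip u u"] Bessel FL on u) auto
    have diff: "sqn (\<lambda>x. R i x - R j x) = (\<Sum>n=i..<j. (c n)\<^sup>2)" if "i \<le> j" for i j
    proof -
      have "ip (R i) (R j) = sqn (R j)"
      proof -
        have eq: "R i = (\<lambda>x. R j x + (\<Sum>n=i..<j. c n * F n x))"
        proof
          fix x
          have "{..<j} = {..<i} \<union> {i..<j}" using that by auto
          then have "(\<Sum>n<j. c n * F n x) = (\<Sum>n<i. c n * F n x) + (\<Sum>n=i..<j. c n * F n x)"
            by (simp add: sum.union_disjoint ivl_disj_int_one)
          then show "R i x = R j x + (\<Sum>n=i..<j. c n * F n x)" by (simp add: R_def c_def)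
        qed
        have "ip (\<lambda>x. (\<Sum>n=i..<j. c n * F n x)) (R j) = (\<Sum>n=i..<j. c n * ip (F n) (R j))"
          by (subst ip_sum) (auto simp: ip_scale FL RL L_scale)
        also have "\<dots> = 0" using rem(2)[of _ j] by (intro sum.neutral) (auto simp: ip_commute)
        finally show ?thesis
          by (subst (1) eq) (simp add: ip_add RL sq_int_sum L_scale FL)
      qed
      then have "sqn (\<lambda>x. R i x - R j x) = sqn (R i) - sqn (R j)"
        by (simp add: ip_diff_self RL)
      also have "\<dots> = (\<Sum>n<j. (c n)\<^sup>2) - (\<Sum>n<i. (c n)\<^sup>2)" by (simp add: rem(3) c_def)
      also have "\<dots> = (\<Sum>n=i..<j. (c n)\<^sup>2)"
        using sum_diff_nat_ivl[of 0 i j "\<lambda>n. (c n)\<^sup>2"] that by (simp add: lessThan_atLeast0)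
      finally show ?thesis .
    qed
    have cau: "\<exists>N. \<forall>i\<ge>N. \<forall>j\<ge>N. (LINT x|M. (R i x - R j x)\<^sup>2) < e" if e: "e > 0" for e
    proof -
      obtain N where N: "\<And>m n. m \<ge> N \<Longrightarrow> norm (\<Sum>n=m..<n. (c n)\<^sup>2) < e"
        using sq e unfolding summable_Cauchy by blast
      have le: "(LINT x|M. (R i x - R j x)\<^sup>2) < e" if "i \<ge> N" "i \<le> j" for i j
        using diff[OF that(2)] N[OF that(1), of j] by (simp add: ip_self)
      have "(LINT x|M. (R i x - R j x)\<^sup>2) < e" if "i \<ge> N" "j \<ge> N" for i j
        using le[of i j] le[of j i] that by (cases "i \<le> j") (auto simp: power2_commute)
      then show ?thesis by blast
    qed
    obtain r where r: "r \<in> L" "(\<lambda>n. LINT x|M. (R n x - r x)\<^sup>2) \<longlonglongrightarrow> 0"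
      by (rule L2_complete[of R, OF RL cau])
    have lim: "(\<lambda>n. sqn (\<lambda>x. R n x - r x)) \<longlonglongrightarrow> 0"
      using r(2) by (simp add: ip_self)
    have rF: "ip r (F n) = 0" for n
    proof -
      have "(\<lambda>N. ip (R N) (F n)) \<longlonglongrightarrow> ip r (F n)" by (rule ip_tendsto[OF RL r(1) FL lim])
      moreover have "(\<lambda>N. ip (R N) (F n)) \<longlonglongrightarrow> 0"
        using rem(2) by (intro tendsto_eventually eventually_sequentiallyI[of "Suc n"]) auto
      ultimately show ?thesis by (rule LIMSEQ_unique)
    qed
    have "ip (kernel_op sq_kernel r) r \<le> \<mu> n * ip r r" for n
      unfolding \<mu>_def using r(1) rF by (intro max) (auto simp: perp_def)
    then have "ip (kernel_op sq_kernel r) r \<le> 0"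
      using tendsto_mult_right[OF \<mu>0, of "ip r r"] by (intro LIMSEQ_le_const[of _ 0]) auto
    then have "ip r r = 0" using ip_kernel_op_sq_kernel_pos[OF r(1)] ip_ge_0[of r] by force
    then have "AE x in M. r x = 0" using ip_eq_0_AE[OF r(1)] by simp
    then have "sqn (\<lambda>x. R n x - r x) = sqn (R n)" for n
      unfolding ip_self by (intro integral_cong_AE)
        (use RL[THEN sq_int_measurable] r(1)[THEN sq_int_measurable] in auto)
    then show ?thesis using lim by (simp add: R_def)
  qed
  show ?thesis
  proof (rule that[of F t])
    show "continuous_on D (F n)" for n using F[of n] by (simp add: eigenfunction_def)
  qed (fact on t anti mpos summ complete)+
qed

end

section \<open>Quaternions\<close>

lemma qcnj_simps [simp]:
  "qcnj 0 = 0" "qcnj 1 = 1" "qcnj (of_real r) = of_real r" "qcnj (qcnj a) = a"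
  "qcnj (a + b) = qcnj a + qcnj b" "qcnj (a - b) = qcnj a - qcnj b" "qcnj (- a) = - qcnj a"
  "qcnj (a * b) = qcnj b * qcnj a" "norm (qcnj a) = norm a"
  by (simp_all add: quat_eq_iff norm_quat_def algebra_simps)

lemma qcnj_mult_self: "qcnj a * a = of_real ((norm a)\<^sup>2)"
  using quat_mult_qcnj[of "qcnj a"] by simp

lemma of_real_commute: "of_real r * a = a * of_real r" for a :: quat
  by (simp add: quat_eq_iff)

lemma norm_quat_power2: "(norm a)\<^sup>2 = (q0 a)\<^sup>2 + (q1 a)\<^sup>2 + (q2 a)\<^sup>2 + (q3 a)\<^sup>2"
  by (simp add: norm_quat_def)

lemma bounded_linear_qcnj: "bounded_linear qcnj"
  by (rule bounded_linear_intro[of _ 1]) (simp_all add: quat_eq_iff)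

lemma bounded_linear_quat_components:
  "bounded_linear q0" "bounded_linear q1" "bounded_linear q2" "bounded_linear q3"
proof -
  have "\<bar>q0 a\<bar> \<le> norm a * 1" "\<bar>q1 a\<bar> \<le> norm a * 1" "\<bar>q2 a\<bar> \<le> norm a * 1" "\<bar>q3 a\<bar> \<le> norm a * 1" for a
    unfolding norm_quat_def by (auto intro!: real_le_rsqrt)
  then show "bounded_linear q0" "bounded_linear q1" "bounded_linear q2" "bounded_linear q3"
    by (auto intro!: bounded_linear_intro[of _ 1])
qed

lemma continuous_on_qcnj [continuous_intros]:
  "continuous_on S f \<Longrightarrow> continuous_on S (\<lambda>x. qcnj (f x))"
  by (rule bounded_linear.continuous_on[OF bounded_linear_qcnj])

lemma borel_measurable_qcnj [measurable]: "qcnj \<in> borel_measurable borel"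
  by (intro borel_measurable_continuous_onI continuous_intros)

lemma borel_measurable_quat_components [measurable]:
  "q0 \<in> borel_measurable borel" "q1 \<in> borel_measurable borel"
  "q2 \<in> borel_measurable borel" "q3 \<in> borel_measurable borel"
  by (intro borel_measurable_continuous_onI bounded_linear.continuous_on[OF bounded_linear_quat_components(1)]
      bounded_linear.continuous_on[OF bounded_linear_quat_components(2)]
      bounded_linear.continuous_on[OF bounded_linear_quat_components(3)]
      bounded_linear.continuous_on[OF bounded_linear_quat_components(4)] continuous_on_id)+

lemma sq_int_qcnj: "f \<in> sq_int M \<Longrightarrow> (\<lambda>x. qcnj (f x)) \<in> sq_int M"
  by (auto simp: sq_int_def)

section \<open>The quaternionic Hilbert space\<close>

lemma L2_eq_sq_int: "L2 D = sq_int (lebesgue_on D)"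
  by (auto simp: L2_def sq_int_def)

context compact_domain
begin

abbreviation H :: "('a \<Rightarrow> quat) set" where "H \<equiv> L2 D"
abbreviation hp :: "('a \<Rightarrow> quat) \<Rightarrow> ('a \<Rightarrow> quat) \<Rightarrow> quat" where "hp \<equiv> L2_inner D"
abbreviation hnorm :: "('a \<Rightarrow> quat) \<Rightarrow> real" where "hnorm \<equiv> L2_norm D"

lemma H_sq_int: "f \<in> H \<Longrightarrow> f \<in> sq_int M"
  by (simp add: L2_eq_sq_int)

lemma H_measurable: "f \<in> H \<Longrightarrow> f \<in> borel_measurable M"
  by (simp add: L2_def)

lemma H_add: "f \<in> H \<Longrightarrow> g \<in> H \<Longrightarrow> (\<lambda>x. f x + g x) \<in> H"
  unfolding L2_eq_sq_int by (rule sq_int_add)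

lemma H_diff: "f \<in> H \<Longrightarrow> g \<in> H \<Longrightarrow> (\<lambda>x. f x - g x) \<in> H"
  unfolding L2_eq_sq_int by (rule sq_int_diff)

lemma H_cmult: "f \<in> H \<Longrightarrow> (\<lambda>x. c * f x) \<in> H"
  unfolding L2_eq_sq_int by (rule sq_int_cmult_left)

lemma H_sum: "(\<And>i. i \<in> A \<Longrightarrow> f i \<in> H) \<Longrightarrow> (\<lambda>x. \<Sum>i\<in>A. f i x) \<in> H"
  unfolding L2_eq_sq_int by (rule sq_int_sum)

lemma H_combination: "(\<And>i. i \<in> A \<Longrightarrow> f i \<in> H) \<Longrightarrow> (\<lambda>x. \<Sum>i\<in>A. c i * f i x) \<in> H"
  by (intro H_sum H_cmult)

lemma hp_integrable: "f \<in> H \<Longrightarrow> g \<in> H \<Longrightarrow> integrable M (\<lambda>x. f x * qcnj (g x))"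
  by (intro sq_int_mult_integrable sq_int_qcnj H_sq_int)

lemma hp_add: "f \<in> H \<Longrightarrow> g \<in> H \<Longrightarrow> h \<in> H \<Longrightarrow> hp (\<lambda>x. f x + g x) h = hp f h + hp g h"
  using hp_integrable[of f h] hp_integrable[of g h] by (simp add: L2_inner_def distrib_right)

lemma hp_diff: "f \<in> H \<Longrightarrow> g \<in> H \<Longrightarrow> h \<in> H \<Longrightarrow> hp (\<lambda>x. f x - g x) h = hp f h - hp g h"
  using hp_integrable[of f h] hp_integrable[of g h] by (simp add: L2_inner_def left_diff_distrib)

lemma hp_cmult: "f \<in> H \<Longrightarrow> h \<in> H \<Longrightarrow> hp (\<lambda>x. c * f x) h = c * hp f h"
  by (simp add: L2_inner_def mult.assoc hp_integrable)

lemma hp_combination: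
  assumes "\<And>i. i \<in> A \<Longrightarrow> f i \<in> H" "h \<in> H"
  shows "hp (\<lambda>x. \<Sum>i\<in>A. c i * f i x) h = (\<Sum>i\<in>A. c i * hp (f i) h)"
proof -
  have "hp (\<lambda>x. \<Sum>i\<in>A. c i * f i x) h = (LINT x|M. (\<Sum>i\<in>A. (c i * f i x) * qcnj (h x)))"
    by (simp add: L2_inner_def sum_distrib_right)
  also have "\<dots> = (\<Sum>i\<in>A. hp (\<lambda>x. c i * f i x) h)"
    unfolding L2_inner_def by (intro Bochner_Integration.integral_sum hp_integrable H_cmult assms)
  also have "\<dots> = (\<Sum>i\<in>A. c i * hp (f i) h)"
    by (intro sum.cong refl hp_cmult assms)
  finally show ?thesis .
qed

lemma hp_commute:
  assumes "f \<in> H" "g \<in> H" shows "hp f g = qcnj (hp g f)"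
  using integral_bounded_linear[OF bounded_linear_qcnj hp_integrable[OF assms(2,1)]]
  by (simp add: L2_inner_def)

lemma hp_cong_AE:
  assumes "f \<in> H" "f' \<in> H" "g \<in> H" "g' \<in> H" "AE x in M. f x = f' x" "AE x in M. g x = g' x"
  shows "hp f g = hp f' g'"
  unfolding L2_inner_def
proof (rule integral_cong_AE)
  show "AE x in M. f x * qcnj (g x) = f' x * qcnj (g' x)"
    using assms(5,6) by eventually_elim simp
qed (use hp_integrable assms in auto)

lemma hp_cong: "(\<And>x. x \<in> D \<Longrightarrow> f x = f' x) \<Longrightarrow> (\<And>x. x \<in> D \<Longrightarrow> g x = g' x) \<Longrightarrow> hp f g = hp f' g'"
  unfolding L2_inner_def by (intro Bochner_Integration.integral_cong) auto

lemma hp_self: "hp f f = of_real (LINT x|M. (norm (f x))\<^sup>2)"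
  unfolding L2_inner_def quat_mult_qcnj
  by (rule integral_bounded_linear'[OF bounded_linear_of_real bounded_linear_quat_components(1)]) simp

lemma hnorm_power2: "(hnorm f)\<^sup>2 = (LINT x|M. (norm (f x))\<^sup>2)"
  by (simp add: L2_norm_def hp_self)

lemma hp_self_hnorm: "hp f f = of_real ((hnorm f)\<^sup>2)"
  by (simp add: hp_self hnorm_power2)

lemma hnorm_nonneg [simp]: "hnorm f \<ge> 0"
  by (simp add: L2_norm_def hp_self)

lemma hnorm_cong: "(\<And>x. x \<in> D \<Longrightarrow> f x = g x) \<Longrightarrow> hnorm f = hnorm g"
  unfolding L2_norm_def by (metis hp_cong)

lemma hp_self_0_AE:
  assumes "f \<in> H" "hp f f = 0" shows "AE x in M. f x = 0"
proof -
  have "(LINT x|M. (norm (f x))\<^sup>2) = 0" using assms(2) by (simp add: hp_self)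
  moreover have "integrable M (\<lambda>x. (norm (f x))\<^sup>2)" using assms(1) by (simp add: L2_def)
  ultimately show ?thesis by (subst (asm) integral_nonneg_eq_0_iff_AE) auto
qed

lemma hp_0_left: "(AE x in M. f x = 0) \<Longrightarrow> f \<in> H \<Longrightarrow> g \<in> H \<Longrightarrow> hp f g = 0"
  using hp_cong_AE[of f "\<lambda>_. 0" g g] by (simp add: L2_eq_sq_int) (simp add: L2_inner_def)

lemma hp_Cauchy_Schwarz:
  assumes f: "f \<in> H" and g: "g \<in> H" shows "norm (hp f g) \<le> hnorm f * hnorm g"
proof -
  have "(norm (hp f g))\<^sup>2 \<le> (hnorm f * hnorm g)\<^sup>2"
    using Cauchy_Schwarz_integral_norm[OF H_sq_int[OF f] sq_int_qcnj[OF H_sq_int[OF g]]]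
    by (simp add: L2_inner_def hnorm_power2 power_mult_distrib)
  then show ?thesis by (rule power2_le_imp_le) simp
qed

lemma hnorm_Pythagoras:
  assumes f: "f \<in> H" and g: "g \<in> H" and 0: "hp f g = 0"
  shows "(hnorm (\<lambda>x. f x + g x))\<^sup>2 = (hnorm f)\<^sup>2 + (hnorm g)\<^sup>2"
proof -
  note fg = H_add[OF f g]
  have "hp g f = 0" using hp_commute[OF g f] 0 by simp
  then have "hp f (\<lambda>x. f x + g x) = hp f f" "hp g (\<lambda>x. f x + g x) = hp g g"
    using hp_commute[OF f fg] hp_commute[OF g fg] hp_commute[OF f f] hp_commute[OF g g] 0
    by (simp_all add: hp_add[OF f g f] hp_add[OF f g g])
  then have "hp (\<lambda>x. f x + g x) (\<lambda>x. f x + g x) = hp f f + hp g g"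
    by (simp add: hp_add[OF f g fg])
  then show ?thesis by (simp only: hp_self_hnorm flip: of_real_add) (simp only: of_real_eq_iff)
qed

text \<open>Scalars act from the left, so the Fourier coefficients \<open>(f, e\<^sub>n)\<close> stand to the left of \<open>e\<^sub>n\<close>.\<close>

definition remainder :: "(nat \<Rightarrow> 'a \<Rightarrow> quat) \<Rightarrow> ('a \<Rightarrow> quat) \<Rightarrow> nat \<Rightarrow> 'a \<Rightarrow> quat"
  where "remainder e f N = (\<lambda>x. f x - (\<Sum>n<N. hp f (e n) * e n x))"

definition orthonormal :: "(nat \<Rightarrow> 'a \<Rightarrow> quat) \<Rightarrow> bool"
  where "orthonormal e \<longleftrightarrow> (\<forall>n. e n \<in> H) \<and> (\<forall>m n. hp (e m) (e n) = (if m = n then 1 else 0))"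

lemma orthonormal_H: "orthonormal e \<Longrightarrow> e n \<in> H"
  by (simp add: orthonormal_def)

lemma remainder_H: "orthonormal e \<Longrightarrow> f \<in> H \<Longrightarrow> remainder e f N \<in> H"
  unfolding remainder_def by (intro H_diff H_combination) (auto intro: orthonormal_H)

lemma remainder_orthogonal:
  assumes e: "orthonormal e" and f: "f \<in> H" and n: "n < N"
  shows "hp (remainder e f N) (e n) = 0"
proof -
  have "(\<Sum>m<N. hp f (e m) * hp (e m) (e n)) = (\<Sum>m<N. if m = n then hp f (e m) else 0)"
    using e by (intro sum.cong refl) (simp add: orthonormal_def)
  then show ?thesis
    using n unfolding remainder_def
    by (simp add: hp_diff H_combination hp_combination orthonormal_H[OF e] f)
qed

lemma remainder_orthogonal_combination:
  assumes e: "orthonormal e" and f: "f \<in> H" and A: "A \<subseteq> {..<N}"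
  shows "hp (remainder e f N) (\<lambda>x. \<Sum>n\<in>A. c n * e n x) = 0"
proof -
  note r = remainder_H[OF e f, of N]
  have "hp (\<lambda>x. \<Sum>n\<in>A. c n * e n x) (remainder e f N) = (\<Sum>n\<in>A. c n * hp (e n) (remainder e f N))"
    by (intro hp_combination orthonormal_H[OF e] r)
  also have "\<dots> = 0"
    using remainder_orthogonal[OF e f] A hp_commute[OF orthonormal_H[OF e] r]
    by (intro sum.neutral) (auto simp: subset_iff)
  finally show ?thesis using hp_commute[OF r H_combination[of A e c]] orthonormal_H[OF e] by simp
qed

lemma hnorm_combination:
  assumes e: "orthonormal e" and "finite A"
  shows "(hnorm (\<lambda>x. \<Sum>n\<in>A. c n * e n x))\<^sup>2 = (\<Sum>n\<in>A. (norm (c n))\<^sup>2)"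
proof -
  define P where "P = (\<lambda>x. \<Sum>n\<in>A. c n * e n x)"
  have PH: "P \<in> H" unfolding P_def by (intro H_combination orthonormal_H[OF e])
  have "hp P (e n) = c n" if "n \<in> A" for n
  proof -
    have "hp P (e n) = (\<Sum>m\<in>A. if m = n then c m else 0)"
      unfolding P_def hp_combination[OF orthonormal_H[OF e] orthonormal_H[OF e]]
      using e by (intro sum.cong refl) (simp add: orthonormal_def)
    then show ?thesis using that \<open>finite A\<close> by simp
  qed
  then have "hp P P = (\<Sum>n\<in>A. c n * qcnj (c n))"
    using hp_combination[of A e P c] orthonormal_H[OF e] PH hp_commute[OF orthonormal_H[OF e] PH]
    by (simp flip: P_def)
  then show ?thesis
    by (simp only: hp_self_hnorm quat_mult_qcnj P_def flip: of_real_sum) (simp only: of_real_eq_iff)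
qed

lemma hnorm_remainder:
  assumes e: "orthonormal e" and f: "f \<in> H"
  shows "(hnorm (remainder e f N))\<^sup>2 = (hnorm f)\<^sup>2 - (\<Sum>n<N. (norm (hp f (e n)))\<^sup>2)"
proof -
  have "(hnorm (\<lambda>x. remainder e f N x + (\<Sum>n<N. hp f (e n) * e n x)))\<^sup>2
      = (hnorm (remainder e f N))\<^sup>2 + (hnorm (\<lambda>x. \<Sum>n<N. hp f (e n) * e n x))\<^sup>2"
    by (intro hnorm_Pythagoras remainder_H e f H_combination orthonormal_H[OF e]
        remainder_orthogonal_combination) auto
  then show ?thesis by (simp add: hnorm_combination[OF e]) (simp add: remainder_def)
qed

lemma hp_Bessel: "orthonormal e \<Longrightarrow> f \<in> H \<Longrightarrow> (\<Sum>n<N. (norm (hp f (e n)))\<^sup>2) \<le> (hnorm f)\<^sup>2"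
  using hnorm_remainder[of e f N] by (smt (verit) zero_le_power2)

lemma best_approximation:
  assumes e: "orthonormal e" and f: "f \<in> H" and A: "A \<subseteq> {..<N}"
  shows "hnorm (remainder e f N) \<le> hnorm (\<lambda>x. f x - (\<Sum>n\<in>A. c n * e n x))"
proof -
  define d where "d n = hp f (e n) - (if n \<in> A then c n else 0)" for n
  have eq: "(\<lambda>x. f x - (\<Sum>n\<in>A. c n * e n x)) = (\<lambda>x. remainder e f N x + (\<Sum>n<N. d n * e n x))"
  proof
    fix x
    have "(\<Sum>n\<in>A. c n * e n x) = (\<Sum>n<N. (if n \<in> A then c n else 0) * e n x)"
      using A by (intro sum.mono_neutral_cong_left) auto
    then show "f x - (\<Sum>n\<in>A. c n * e n x) = remainder e f N x + (\<Sum>n<N. d n * e n x)"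
      by (simp add: remainder_def d_def left_diff_distrib sum_subtractf)
  qed
  have "(hnorm (remainder e f N))\<^sup>2 \<le> (hnorm (\<lambda>x. remainder e f N x + (\<Sum>n<N. d n * e n x)))\<^sup>2"
    by (subst hnorm_Pythagoras)
      (auto intro!: remainder_H e f H_combination orthonormal_H[OF e] remainder_orthogonal_combination)
  then show ?thesis unfolding eq by (rule power2_le_imp_le) simp
qed

definition hilbert_basis :: "(nat \<Rightarrow> 'a \<Rightarrow> quat) \<Rightarrow> bool"
  where "hilbert_basis e \<longleftrightarrow> orthonormal e \<and> (\<forall>f\<in>H. (\<lambda>N. hnorm (remainder e f N)) \<longlonglongrightarrow> 0)"

lemma hilbert_basis_orthonormal: "hilbert_basis e \<Longrightarrow> orthonormal e"
  by (simp add: hilbert_basis_def)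

text \<open>
  The partial sums of the Fourier series are the best approximations from the spans of initial
  segments, so density of the span already forces them to converge.
\<close>

lemma hilbert_basisI:
  assumes H: "\<And>n. e n \<in> H" and basis: "L2_orthonormal_basis D e"
  shows "hilbert_basis e"
  unfolding hilbert_basis_def
proof (intro conjI ballI)
  show e: "orthonormal e" using assms by (simp add: orthonormal_def L2_orthonormal_basis_def)
  fix f assume f: "f \<in> H"
  show "(\<lambda>N. hnorm (remainder e f N)) \<longlonglongrightarrow> 0"
  proof (rule LIMSEQ_I)
    fix \<epsilon> :: real assume "\<epsilon> > 0"
    then obtain g where g: "g \<in> left_span (range e)" "hnorm (\<lambda>x. f x - g x) < \<epsilon>"
      using basis f unfolding L2_orthonormal_basis_def complete_system_def by blast
    then obtain B c where B: "finite B" "B \<subseteq> range e" "g = (\<lambda>x. \<Sum>b\<in>B. c b * b x)"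
      unfolding left_span_def by blast
    then obtain A where A: "inj_on e A" "B = e ` A" by (metis subset_image_inj)
    with B(1) have "finite A" by (metis finite_imageD)
    then obtain N where N: "A \<subseteq> {..<N}" by (meson finite_nat_bounded)
    have g_eq: "g = (\<lambda>x. \<Sum>n\<in>A. c (e n) * e n x)"
      unfolding B(3) A(2) by (simp add: sum.reindex[OF A(1)])
    have "norm (hnorm (remainder e f M) - 0) < \<epsilon>" if "M \<ge> N" for M
      using best_approximation[OF e f, of A M "\<lambda>n. c (e n)"] N that g(2) by (force simp: g_eq)
    then show "\<exists>no. \<forall>n\<ge>no. norm (hnorm (remainder e f n) - 0) < \<epsilon>" by blast
  qed
qed

lemma hp_summable_norm:
  assumes e: "orthonormal e" and f: "f \<in> H" and g: "g \<in> H"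
  shows "summable (\<lambda>n. norm (hp f (e n) * qcnj (hp g (e n))))"
proof -
  have s: "summable (\<lambda>n. (norm (hp h (e n)))\<^sup>2)" if "h \<in> H" for h
    using hp_Bessel[OF e that] by (intro summableI_nonneg_bounded) auto
  have "norm (norm (hp f (e n) * qcnj (hp g (e n)))) \<le> (norm (hp f (e n)))\<^sup>2 + (norm (hp g (e n)))\<^sup>2" for n
  proof -
    have "norm (norm (hp f (e n) * qcnj (hp g (e n)))) = norm (hp f (e n)) * norm (hp g (e n))"
      by (simp add: norm_mult)
    also have "\<dots> \<le> 2 * norm (hp f (e n)) * norm (hp g (e n))"
      using mult_nonneg_nonneg[OF norm_ge_zero norm_ge_zero, of "hp f (e n)" "hp g (e n)"] by linarith
    also have "\<dots> \<le> (norm (hp f (e n)))\<^sup>2 + (norm (hp g (e n)))\<^sup>2" by (rule sum_squares_bound)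
    finally show ?thesis .
  qed
  then show ?thesis by (intro summable_comparison_test'[OF summable_add[OF s[OF f] s[OF g]]]) auto
qed

text \<open>
  Keeping the remainders of both arguments makes the error of the partial sums quadratic in them,
  as is needed for uniform convergence.
\<close>

lemma hp_remainder_remainder:
  assumes e: "orthonormal e" and f: "f \<in> H" and g: "g \<in> H"
  shows "hp f g - (\<Sum>n<N. hp f (e n) * qcnj (hp g (e n))) = hp (remainder e f N) (remainder e g N)"
proof -
  note rf = remainder_H[OF e f, of N] and rg = remainder_H[OF e g, of N]
  define P where "P = (\<lambda>x. \<Sum>n<N. hp g (e n) * e n x)"
  have PH: "P \<in> H" unfolding P_def by (intro H_combination orthonormal_H[OF e])
  have g_eq: "g = (\<lambda>x. remainder e g N x + P x)" by (simp add: remainder_def P_def)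
  have "hp (remainder e f N) P = 0"
    unfolding P_def by (rule remainder_orthogonal_combination[OF e f]) simp
  then have "hp P (remainder e f N) = 0" using hp_commute[OF PH rf] by simp
  then have "hp g (remainder e f N) = hp (remainder e g N) (remainder e f N)"
    using hp_add[OF rg PH rf] by (simp flip: g_eq)
  then have "hp (remainder e f N) (remainder e g N) = hp (remainder e f N) g"
    using hp_commute[OF rf rg] hp_commute[OF rf g] by simp
  also have "\<dots> = hp f g - (\<Sum>n<N. hp f (e n) * hp (e n) g)"
    unfolding remainder_def
    by (simp add: hp_diff[OF f H_combination g] hp_combination g orthonormal_H[OF e])
  also have "(\<Sum>n<N. hp f (e n) * hp (e n) g) = (\<Sum>n<N. hp f (e n) * qcnj (hp g (e n)))"
    by (intro sum.cong refl arg_cong[where f = "\<lambda>a. _ * a"] hp_commute orthonormal_H[OF e] g)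
  finally show ?thesis by simp
qed

lemma Parseval:
  assumes e: "hilbert_basis e" and f: "f \<in> H" and g: "g \<in> H"
  shows "(\<lambda>n. hp f (e n) * qcnj (hp g (e n))) sums hp f g"
proof -
  note on = hilbert_basis_orthonormal[OF e]
  have "(\<lambda>N. hp f g - (\<Sum>n<N. hp f (e n) * qcnj (hp g (e n)))) \<longlonglongrightarrow> 0"
  proof (rule Lim_null_comparison)
    show "\<forall>\<^sub>F N in sequentially. norm (hp f g - (\<Sum>n<N. hp f (e n) * qcnj (hp g (e n))))
        \<le> hnorm (remainder e f N) * hnorm (remainder e g N)"
      unfolding hp_remainder_remainder[OF on f g]
      by (intro always_eventually allI hp_Cauchy_Schwarz remainder_H on f g)
    have "(\<lambda>N. hnorm (remainder e f N) * hnorm (remainder e g N)) \<longlonglongrightarrow> 0 * 0"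
      using e f g by (intro tendsto_mult) (auto simp: hilbert_basis_def)
    then show "(\<lambda>N. hnorm (remainder e f N) * hnorm (remainder e g N)) \<longlonglongrightarrow> 0" by simp
  qed
  from tendsto_diff[OF tendsto_const[of "hp f g"] this] show ?thesis
    by (simp add: sums_def)
qed

lemma Parseval_norm:
  assumes e: "hilbert_basis e" and f: "f \<in> H"
  shows "(\<lambda>n. (norm (hp f (e n)))\<^sup>2) sums (hnorm f)\<^sup>2"
proof -
  have "(\<lambda>N. (hnorm (remainder e f N))\<^sup>2) \<longlonglongrightarrow> 0\<^sup>2"
    using e f by (intro tendsto_power) (auto simp: hilbert_basis_def)
  then have "(\<lambda>N. (hnorm f)\<^sup>2 - ((hnorm f)\<^sup>2 - (\<Sum>n<N. (norm (hp f (e n)))\<^sup>2))) \<longlonglongrightarrow> (hnorm f)\<^sup>2 - 0\<^sup>2"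
    unfolding hnorm_remainder[OF hilbert_basis_orthonormal[OF e] f] by (intro tendsto_diff tendsto_const)
  then show ?thesis by (simp add: sums_def)
qed

end

lemma left_span_combination:
  assumes inj: "inj f" and A: "finite A"
  shows "(\<lambda>x. \<Sum>n\<in>A. c n * f n x) \<in> left_span (range f)"
proof -
  have "(\<Sum>n\<in>A. c n * f n x) = (\<Sum>b\<in>f ` A. c (inv f b) * b x)" for x
    using inj by (simp add: sum.reindex inj_on_subset)
  then show ?thesis
    unfolding left_span_def using A by (intro CollectI exI[of _ "f ` A"] exI[of _ "\<lambda>b. c (inv f b)"]) auto
qed

text \<open>
  Dini's theorem. Near each point some member of the sequence is small, by monotonicity so are all
  later ones, and finitely many such neighbourhoods cover the compact set.
\<close>

lemma Dini_decreasing: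
  fixes g :: "nat \<Rightarrow> 'a::metric_space \<Rightarrow> real"
  assumes S: "compact S" and cont: "\<And>n. continuous_on S (g n)"
    and dec: "\<And>n x. x \<in> S \<Longrightarrow> g (Suc n) x \<le> g n x"
    and lim: "\<And>x. x \<in> S \<Longrightarrow> (\<lambda>n. g n x) \<longlonglongrightarrow> 0" and e: "e > 0"
  shows "\<exists>N. \<forall>n\<ge>N. \<forall>x\<in>S. g n x < e"
proof -
  have mono: "g n x \<le> g m x" if "m \<le> n" "x \<in> S" for m n x
    using that(1) by (induction rule: dec_induct) (use dec[OF that(2)] in \<open>auto intro: order_trans\<close>)
  have "\<exists>N T. open T \<and> x \<in> T \<and> (\<forall>y\<in>S \<inter> T. g N y < e)" if x: "x \<in> S" for x
  proof -
    obtain N where "g N x < e"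
      using order_tendstoD(2)[OF lim[OF x] e] by (auto simp: eventually_sequentially)
    moreover obtain T where "open T" "T \<inter> S = g N -` {..<e} \<inter> S"
      using continuous_on_open_invariant[of S "g N"] cont[of N] open_lessThan[of e] by metis
    ultimately show ?thesis using x by (intro exI[of _ N] exI[of _ T]) blast
  qed
  then obtain N T where NT: "\<And>x. x \<in> S \<Longrightarrow> open (T x)" "\<And>x. x \<in> S \<Longrightarrow> x \<in> T x"
    "\<And>x y. x \<in> S \<Longrightarrow> y \<in> S \<inter> T x \<Longrightarrow> g (N x) y < e" by metis
  have "S \<subseteq> (\<Union>x\<in>S. T x)" using NT(2) by auto
  then obtain C where C: "C \<subseteq> S" "finite C" "S \<subseteq> (\<Union>x\<in>C. T x)"
    using compactE_image[OF S, of S T] NT(1) by metis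
  have "g n y < e" if "n \<ge> Max (insert 0 (N ` C))" "y \<in> S" for n y
  proof -
    obtain x where x: "x \<in> C" "y \<in> T x" using C(3) \<open>y \<in> S\<close> by auto
    have "N x \<le> Max (insert 0 (N ` C))" using x(1) C(2) by (intro Max_ge) auto
    then have "g n y \<le> g (N x) y" using that by (intro mono) auto
    also have "\<dots> < e" using NT(3)[of x y] x C(1) that by auto
    finally show ?thesis .
  qed
  then show ?thesis by blast
qed

section \<open>The quaternionic kernel and its four real components\<close>

text \<open>
  The components are indexed by numbers in order to form the family of kernels to be diagonalized.
  All indices above 2 give the last component, so that \<open>quat_comp i\<close> is
  linear for every \<open>i\<close>.
\<close>

definition quat_comp :: "nat \<Rightarrow> quat \<Rightarrow> real"
  where "quat_comp i = (if i = 0 then q0 else if i = 1 then q1 else if i = 2 then q2 else q3)"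

lemma bounded_linear_quat_comp: "bounded_linear (quat_comp i)"
  by (simp add: quat_comp_def bounded_linear_quat_components)

locale quaternionic_kernel = compact_domain D for D :: "'a::euclidean_space set" +
  fixes X :: "'a set" and E :: "'a \<Rightarrow> 'a \<Rightarrow> quat"
  assumes D_subset: "D \<subseteq> X"
    and E_cont: "continuous_on (X \<times> X) (\<lambda>(\<omega>, x). E \<omega> x)"
    and E_sym: "\<And>\<omega> x. \<omega> \<in> X \<Longrightarrow> x \<in> X \<Longrightarrow> E \<omega> x = E x \<omega>"
    and E_total: "\<And>u. u \<in> L2_perp D {\<lambda>\<omega>. E \<omega> x | x. x \<in> X} \<Longrightarrow> AE \<omega> in M. u \<omega> = 0"
    and S_real: "\<And>x y. x \<in> X \<Longrightarrow> y \<in> X \<Longrightarrow> kernel_S D E x y \<in> \<real>"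
    and S_commute: "\<And>x y. x \<in> X \<Longrightarrow> y \<in> X \<Longrightarrow>
      (LINT \<omega>|M. E \<omega> y * qcnj (E \<omega> x)) = (LINT \<omega>|M. qcnj (E \<omega> x) * E \<omega> y)"
    and D_positive: "\<not> negligible D"
    and T_injective: "\<And>f. f \<in> H \<Longrightarrow> (AE x in M. transform D E f x = 0) \<Longrightarrow> (AE \<omega> in M. f \<omega> = 0)"
begin

abbreviation T :: "('a \<Rightarrow> quat) \<Rightarrow> 'a \<Rightarrow> quat" where "T \<equiv> transform D E"
abbreviation S :: "'a \<Rightarrow> 'a \<Rightarrow> quat" where "S \<equiv> kernel_S D E"
abbreviation Es :: "'a \<Rightarrow> 'a \<Rightarrow> quat" where "Es x \<equiv> (\<lambda>\<omega>. E \<omega> x)"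

definition K :: "nat \<Rightarrow> 'a \<Rightarrow> 'a \<Rightarrow> real"
  where "K i w x = quat_comp i (E w x)"

lemma D_in_X: "x \<in> D \<Longrightarrow> x \<in> X"
  using D_subset by auto

lemma E_cont_DX: "continuous_on (D \<times> X) (\<lambda>(w, x). E w x)"
  using D_subset by (intro continuous_on_subset[OF E_cont]) auto

lemma E_cont_DD: "continuous_on (D \<times> D) (\<lambda>(w, x). E w x)"
  using D_subset by (intro continuous_on_subset[OF E_cont]) auto

lemma Es_continuous: "x \<in> X \<Longrightarrow> continuous_on D (Es x)"
  by (rule kernel_section_continuous[OF E_cont_DX])

lemma continuous_H: "continuous_on D f \<Longrightarrow> f \<in> H"
  unfolding L2_eq_sq_int by (rule continuous_sq_int)

lemma Es_H: "x \<in> X \<Longrightarrow> Es x \<in> H"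
  by (intro continuous_H Es_continuous)

lemma T_hp: "T f x = hp f (Es x)"
  by (simp add: transform_def L2_inner_def)

lemma S_hp: "S x y = hp (Es y) (Es x)"
  by (simp add: kernel_S_def L2_inner_def)

lemma sym_kernel_K: "sym_kernel (K i)"
proof (rule kernI)
  show "continuous_on (D \<times> D) (\<lambda>(w, x). K i w x)"
    using bounded_linear.continuous_on[OF bounded_linear_quat_comp[of i] E_cont_DD]
    by (simp add: K_def split_beta')
  show "K i w x = K i x w" if "w \<in> D" "x \<in> D" for w x
    using E_sym[of w x] that D_in_X by (simp add: K_def)
qed

lemma of_real_H: "u \<in> L \<Longrightarrow> (\<lambda>w. of_real (u w)) \<in> H"
  unfolding L2_eq_sq_int sq_int_def by auto

lemma integral_component:
  assumes "integrable M f" "bounded_linear p"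
  shows "p (LINT w|M. f w) = (LINT w|M. p (f w))"
  using integral_bounded_linear[OF assms(2,1)] by simp

text \<open>
  Write \<open>A\<^sub>a\<^sub>b\<close> for the integral of \<open>E\<^sub>a(w, y) E\<^sub>b(w, x)\<close>. The \<open>i\<close>-component of the integral of
  \<open>E(w, y) E(w, x)\<^sup>*\<close> is \<open>(A\<^sub>1\<^sub>0 - A\<^sub>0\<^sub>1) - (A\<^sub>2\<^sub>3 - A\<^sub>3\<^sub>2)\<close>, and that of the product in the other order is
  \<open>(A\<^sub>1\<^sub>0 - A\<^sub>0\<^sub>1) + (A\<^sub>2\<^sub>3 - A\<^sub>3\<^sub>2)\<close>. Both vanish by the reality of \<open>S\<close> and the exchange of the factors,
  so both differences vanish; the \<open>j\<close>- and \<open>k\<close>-components give the remaining pairs.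
\<close>

lemma component_gram_commute:
  assumes x: "x \<in> X" and y: "y \<in> X"
  shows "(LINT w|M. quat_comp i (E w x) * quat_comp j (E w y)) = (LINT w|M. quat_comp j (E w x) * quat_comp i (E w y))"
proof -
  define A where "A p q = (LINT w|M. p (E w y) * q (E w x))" for p q :: "quat \<Rightarrow> real"
  have sec: "(\<lambda>w. p (E w z)) \<in> L" if "bounded_linear p" "z \<in> X" for p :: "quat \<Rightarrow> real" and z
    by (intro continuous_sq_int bounded_linear.continuous_on[OF that(1)] Es_continuous that(2))
  have ints: "integrable M (\<lambda>w. p (E w z) * q (E w z'))"
    if "bounded_linear p" "bounded_linear q" "z \<in> X" "z' \<in> X" for p q :: "quat \<Rightarrow> real" and z z'
    by (intro sq_int_mult_integrable sec that)
  note [simp] = ints bounded_linear_quat_components x y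
  have A': "A p q = (LINT w|M. q (E w x) * p (E w y))" for p q by (simp add: A_def mult.commute)
  have int1: "integrable M (\<lambda>w. E w y * qcnj (E w x))" by (intro hp_integrable Es_H x y)
  have int2: "integrable M (\<lambda>w. qcnj (E w x) * E w y)"
    by (intro sq_int_mult_integrable sq_int_qcnj H_sq_int Es_H x y)
  obtain r where r: "(LINT \<omega>|M. E \<omega> y * qcnj (E \<omega> x)) = of_real r"
    using S_real[OF x y] by (auto simp: kernel_S_def elim: Reals_cases)
  have r': "(LINT \<omega>|M. qcnj (E \<omega> x) * E \<omega> y) = of_real r" using r S_commute[OF x y] by simp
  have 1: "p (LINT \<omega>|M. E \<omega> y * qcnj (E \<omega> x)) = (LINT w|M. p (E w y * qcnj (E w x)))"
    "p (LINT \<omega>|M. qcnj (E \<omega> x) * E \<omega> y) = (LINT w|M. p (qcnj (E w x) * E w y))"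
    if "bounded_linear p" for p :: "quat \<Rightarrow> real"
    by (rule integral_component[OF int1 that], rule integral_component[OF int2 that])
  have "A q1 q0 - A q0 q1 - A q2 q3 + A q3 q2 = 0"
    using 1(1)[OF bounded_linear_quat_components(2)] by (simp add: r A_def)
  moreover have "A q1 q0 - A q0 q1 - A q3 q2 + A q2 q3 = 0"
    using 1(2)[OF bounded_linear_quat_components(2)] by (simp add: r' A')
  moreover have "A q2 q0 - A q0 q2 + A q1 q3 - A q3 q1 = 0"
    using 1(1)[OF bounded_linear_quat_components(3)] by (simp add: r A_def)
  moreover have "A q2 q0 - A q0 q2 - A q1 q3 + A q3 q1 = 0"
    using 1(2)[OF bounded_linear_quat_components(3)] by (simp add: r' A')
  moreover have "A q3 q0 - A q0 q3 - A q1 q2 + A q2 q1 = 0"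
    using 1(1)[OF bounded_linear_quat_components(4)] by (simp add: r A_def)
  moreover have "A q3 q0 - A q0 q3 + A q1 q2 - A q2 q1 = 0"
    using 1(2)[OF bounded_linear_quat_components(4)] by (simp add: r' A')
  ultimately have eqs: "A q1 q0 = A q0 q1" "A q2 q0 = A q0 q2" "A q3 q0 = A q0 q3"
    "A q3 q2 = A q2 q3" "A q3 q1 = A q1 q3" "A q2 q1 = A q1 q2" by linarith+
  have "A (quat_comp j) (quat_comp i) = A (quat_comp i) (quat_comp j)"
    by (auto simp: quat_comp_def eqs)
  then show ?thesis by (simp add: A_def mult.commute)
qed

lemma T_of_real:
  assumes u: "u \<in> L" and x: "x \<in> X"
  shows "T (\<lambda>w. of_real (u w)) x = Quat (kernel_op (K 0) u x) (- kernel_op (K 1) u x) (- kernel_op (K 2) u x) (- kernel_op (K 3) u x)"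
proof -
  have int: "integrable M (\<lambda>w. of_real (u w) * qcnj (E w x))" by (rule hp_integrable[OF of_real_H[OF u] Es_H[OF x]])
  note c = integral_component[OF int bounded_linear_quat_components(1)]
    integral_component[OF int bounded_linear_quat_components(2)]
    integral_component[OF int bounded_linear_quat_components(3)]
    integral_component[OF int bounded_linear_quat_components(4)]
  show ?thesis
    unfolding transform_def quat_eq_iff c by (simp add: kernel_op_def K_def quat_comp_def)
qed

sublocale commuting_kernels D "{0, 1, 2, 3 :: nat}" K
proof
  show "ip (\<lambda>w. K i w x) (\<lambda>w. K j w y) = ip (\<lambda>w. K j w x) (\<lambda>w. K i w y)" if "x \<in> D" "y \<in> D" for i j x y
    unfolding ip_def K_def by (intro component_gram_commute D_in_X that)
  show "AE x in M. u x = 0" if u: "u \<in> L" and 0: "\<And>i. i \<in> {0, 1, 2, 3} \<Longrightarrow> AE x in M. kernel_op (K i) u x = 0" for u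
  proof -
    have "AE x in M. kernel_op (K 0) u x = 0" "AE x in M. kernel_op (K 1) u x = 0"
      "AE x in M. kernel_op (K 2) u x = 0" "AE x in M. kernel_op (K 3) u x = 0" "AE x in M. x \<in> D"
      using 0 by (auto intro: AE_I2)
    then have "AE x in M. T (\<lambda>w. of_real (u w)) x = 0"
      by eventually_elim (simp add: T_of_real[OF u D_in_X] quat_eq_iff)
    from T_injective[OF of_real_H[OF u] this] show ?thesis by simp
  qed
qed (auto simp: sym_kernel_K D_positive)

lemma component_L: "f \<in> H \<Longrightarrow> bounded_linear p \<Longrightarrow> (\<lambda>w. p (f w) :: real) \<in> L"
proof -
  assume f: "f \<in> H" and p: "bounded_linear p"
  from p obtain C where C: "\<And>a. norm (p a) \<le> norm a * C" by (metis bounded_linear.bounded)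
  show "(\<lambda>w. p (f w)) \<in> L"
  proof (rule sq_int_dominated[OF _ H_sq_int[OF f], of _ C])
    have "p \<in> borel_measurable borel"
      by (intro borel_measurable_continuous_onI bounded_linear.continuous_on[OF p] continuous_on_id)
    then show "(\<lambda>w. p (f w)) \<in> borel_measurable M"
      using H_measurable[OF f] by measurable
  qed (use C in \<open>simp add: mult.commute\<close>)
qed

lemma hnorm_components:
  assumes f: "f \<in> H"
  shows "(hnorm f)\<^sup>2 = sqn (\<lambda>w. q0 (f w)) + sqn (\<lambda>w. q1 (f w))
    + sqn (\<lambda>w. q2 (f w)) + sqn (\<lambda>w. q3 (f w))"
  using sq_int_real_integrable[OF component_L[OF f bounded_linear_quat_components(1)]]
    sq_int_real_integrable[OF component_L[OF f bounded_linear_quat_components(2)]]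
    sq_int_real_integrable[OF component_L[OF f bounded_linear_quat_components(3)]]
    sq_int_real_integrable[OF component_L[OF f bounded_linear_quat_components(4)]]
  by (simp add: hnorm_power2 norm_quat_power2 ip_self)

text \<open>
  The components of the Fourier remainder of a quaternionic function are the Fourier remainders of
  its components.
\<close>

lemma real_basis_hilbert_basis:
  fixes F :: "nat \<Rightarrow> 'a \<Rightarrow> real"
  assumes FL: "\<And>n. F n \<in> L" and on: "\<And>m n. ip (F m) (F n) = (if m = n then 1 else 0)"
    and complete: "\<And>u. u \<in> L \<Longrightarrow> (\<lambda>N. sqn (\<lambda>x. u x - (\<Sum>n<N. ip u (F n) * F n x))) \<longlonglongrightarrow> 0"
  shows "hilbert_basis (\<lambda>n w. of_real (F n w))"
proof -
  define Q where "Q = (\<lambda>n w. of_real (F n w) :: quat)"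
  have QH: "Q n \<in> H" for n unfolding Q_def by (rule of_real_H[OF FL])
  have e: "orthonormal Q"
    unfolding orthonormal_def
  proof (intro conjI allI QH)
    fix m n
    have "hp (Q m) (Q n) = (LINT w|M. of_real (F m w * F n w))" by (simp add: L2_inner_def Q_def)
    also have "\<dots> = of_real (ip (F m) (F n))"
      unfolding ip_def by (intro integral_of_real sq_int_mult_integrable FL)
    finally show "hp (Q m) (Q n) = (if m = n then 1 else 0)" by (simp add: on)
  qed
  have "(\<lambda>N. hnorm (remainder Q f N)) \<longlonglongrightarrow> 0" if f: "f \<in> H" for f
  proof -
    have comp: "(\<lambda>w. p (remainder Q f N w)) = (\<lambda>w. p (f w) - (\<Sum>n<N. ip (\<lambda>w. p (f w)) (F n) * F n w))"
      if p: "bounded_linear p" for p :: "quat \<Rightarrow> real" and N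
    proof
      fix w
      have scale: "p (a * of_real r) = p a * r" for a r
        using linear_scale[OF bounded_linear.linear[OF p], of r a] by (simp add: of_real_commute[symmetric] scaleR_conv_of_real mult.commute)
      have "p (hp f (Q n)) = ip (\<lambda>w. p (f w)) (F n)" for n
        unfolding L2_inner_def integral_component[OF hp_integrable[OF f QH] p]
        by (simp add: Q_def ip_def scale)
      then show "p (remainder Q f N w) = p (f w) - (\<Sum>n<N. ip (\<lambda>w. p (f w)) (F n) * F n w)"
        by (simp add: remainder_def linear_diff[OF bounded_linear.linear[OF p]]
            linear_sum[OF bounded_linear.linear[OF p]]) (simp add: Q_def scale)
    qed
    have "(\<lambda>N. (hnorm (remainder Q f N))\<^sup>2) \<longlonglongrightarrow> 0 + 0 + 0 + 0"
      unfolding hnorm_components[OF remainder_H[OF e f]]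
      by (intro tendsto_add; subst (1 2) comp, (rule bounded_linear_quat_components)+,
          rule complete, intro component_L f bounded_linear_quat_components)
    then have "(\<lambda>N. sqrt ((hnorm (remainder Q f N))\<^sup>2)) \<longlonglongrightarrow> sqrt 0"
      by (intro tendsto_real_sqrt) simp
    then show ?thesis by simp
  qed
  with e show ?thesis unfolding hilbert_basis_def Q_def by blast
qed

lemma T_continuous: "f \<in> H \<Longrightarrow> continuous_on X (T f)"
proof -
  assume f: "f \<in> H"
  have "continuous_on (D \<times> X) (\<lambda>(w, x). qcnj (E w x))"
    using continuous_on_qcnj[OF E_cont_DX] by (simp add: split_beta')
  from kernel_op_continuous[OF sq_int_imp_integrable[OF H_sq_int[OF f]] this]
  show ?thesis by (simp add: kernel_op_def[abs_def] transform_def[abs_def])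
qed

lemma T_H: "f \<in> H \<Longrightarrow> T f \<in> H"
  by (rule continuous_H[OF continuous_on_subset[OF T_continuous D_subset]])

lemma S_diagonal_continuous: "continuous_on X (\<lambda>x. S x x)"
proof -
  have "continuous_on (D \<times> X) (\<lambda>(w, x). E w x * qcnj (E w x))"
    using continuous_on_mult[OF E_cont_DX continuous_on_qcnj[OF E_cont_DX]] by (simp add: split_beta')
  from kernel_op_continuous[OF _ this, of "\<lambda>_. 1"]
  show ?thesis by (simp add: kernel_op_def[abs_def] kernel_S_def[abs_def])
qed

lemma T_null_AE:
  assumes "f \<in> H" "\<And>x. x \<in> X \<Longrightarrow> T f x = 0" shows "AE w in M. f w = 0"
  using assms by (intro E_total) (auto simp: L2_perp_def T_hp)

lemma T_diff: "f \<in> H \<Longrightarrow> g \<in> H \<Longrightarrow> x \<in> X \<Longrightarrow> T (\<lambda>w. f w - g w) x = T f x - T g x"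
  by (simp add: T_hp hp_diff Es_H)

lemma T_combination:
  "(\<And>i. i \<in> A \<Longrightarrow> f i \<in> H) \<Longrightarrow> x \<in> X \<Longrightarrow> T (\<lambda>w. \<Sum>i\<in>A. c i * f i w) x = (\<Sum>i\<in>A. c i * T (f i) x)"
  by (simp add: T_hp hp_combination Es_H)

text \<open>
  The null space of \<open>T\<close> consists of the functions that vanish almost everywhere, so its complement
  is the whole space, the projection changes nothing, and \<open>T\<close> is an isometry onto its range.
\<close>

lemma band_inner_eq:
  assumes F: "F \<in> H" "\<And>x. x \<in> X \<Longrightarrow> f x = T F x" and G: "G \<in> H" "\<And>x. x \<in> X \<Longrightarrow> g x = T G x"
  shows "band_inner D X E f g = hp F G"
proof -
  define N where "N = L2_perp D (transform_null D X E)"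
  have N: "N = H"
  proof
    show "N \<subseteq> H" by (auto simp: N_def L2_perp_def)
    have "hp u v = 0" if "u \<in> H" "v \<in> transform_null D X E" for u v
    proof -
      have v: "v \<in> H" "AE w in M. v w = 0" using that(2) T_null_AE[of v] by (auto simp: transform_null_def)
      then have "hp v u = 0" using that(1) by (intro hp_0_left)
      then show ?thesis using hp_commute[OF that(1) v(1)] by simp
    qed
    then show "H \<subseteq> N" by (auto simp: N_def L2_perp_def)
  qed
  have rep: "L2_proj D N (preimage D X E h) \<in> H \<and> (AE w in M. L2_proj D N (preimage D X E h) w = P w)"
    if P: "P \<in> H" "\<And>x. x \<in> X \<Longrightarrow> h x = T P x" for h P
  proof -
    define p where "p = preimage D X E h"
    have "p \<in> H \<and> (\<forall>x\<in>X. h x = T p x)"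
      unfolding p_def preimage_def by (rule someI[of _ P]) (use P in simp)
    then have p: "p \<in> H" "\<And>x. x \<in> X \<Longrightarrow> T p x = h x" by auto
    have "T (\<lambda>w. p w - P w) x = 0" if "x \<in> X" for x
      using T_diff[OF p(1) P(1) that] p(2)[OF that] P(2)[OF that] by simp
    then have 1: "AE w in M. p w - P w = 0" by (intro T_null_AE H_diff p P)
    define u where "u = L2_proj D N p"
    have "u \<in> N \<and> (\<lambda>\<omega>. p \<omega> - u \<omega>) \<in> L2_perp D N"
      unfolding u_def L2_proj_def
    proof (rule someI[of _ p])
      show "p \<in> N \<and> (\<lambda>\<omega>. p \<omega> - p \<omega>) \<in> L2_perp D N"
        using p(1) by (auto simp: N L2_perp_def L2_inner_def L2_eq_sq_int)
    qed
    then have u: "u \<in> H" and "hp (\<lambda>\<omega>. p \<omega> - u \<omega>) (\<lambda>\<omega>. p \<omega> - u \<omega>) = 0"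
      using H_diff[OF p(1)] by (auto simp: N L2_perp_def)
    then have "AE w in M. p w - u w = 0" by (intro hp_self_0_AE H_diff p(1))
    with 1 have "AE w in M. u w = P w" by eventually_elim simp
    with u show ?thesis by (simp add: u_def p_def)
  qed
  have "band_inner D X E f g = hp (L2_proj D N (preimage D X E f)) (L2_proj D N (preimage D X E g))"
    by (simp add: band_inner_def N_def Let_def)
  also have "\<dots> = hp F G"
    using rep[OF F] rep[OF G] F(1) G(1) by (intro hp_cong_AE) auto
  finally show ?thesis .
qed

lemma band_norm_eq:
  assumes "F \<in> H" "\<And>x. x \<in> X \<Longrightarrow> f x = T F x"
  shows "band_norm D X E f = hnorm F"
  unfolding band_norm_def L2_norm_def by (simp only: band_inner_eq[OF assms assms])

lemma bandlimited_H:
  assumes "f \<in> bandlimited D X E" shows "f \<in> H"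
proof -
  obtain F where F: "F \<in> H" "\<And>x. x \<in> X \<Longrightarrow> f x = T F x" using assms by (auto simp: bandlimited_def)
  have "continuous_on D f \<longleftrightarrow> continuous_on D (T F)"
    using F(2) D_in_X by (intro continuous_on_cong) auto
  then show ?thesis by (intro continuous_H) (use continuous_on_subset[OF T_continuous[OF F(1)] D_subset] in simp)
qed

end

section \<open>The prolate spheroidal wave functions\<close>

text \<open>
  A real orthonormal eigenbasis \<open>F\<close> of the transform, with quaternionic eigenvalues multiplying from
  the left.
\<close>

locale prolate_functions = quaternionic_kernel D X E
  for D X :: "'a::euclidean_space set" and E :: "'a \<Rightarrow> 'a \<Rightarrow> quat" +
  fixes F :: "nat \<Rightarrow> 'a \<Rightarrow> real" and lam :: "nat \<Rightarrow> quat"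
  assumes F_L: "\<And>n. F n \<in> L"
    and F_basis: "hilbert_basis (\<lambda>n w. of_real (F n w))"
    and F_eigen: "\<And>n x. x \<in> D \<Longrightarrow> T (\<lambda>w. of_real (F n w)) x = lam n * of_real (F n x)"
    and lam_decreasing: "\<And>n. norm (lam (Suc n)) \<le> norm (lam n)"
    and lam_nonzero: "\<And>n. lam n \<noteq> 0"
    and lam_summable: "summable (\<lambda>n. (norm (lam n))\<^sup>2)"
begin

definition Q :: "nat \<Rightarrow> 'a \<Rightarrow> quat" where "Q n w = of_real (F n w)"
definition \<phi> :: "nat \<Rightarrow> 'a \<Rightarrow> quat" where "\<phi> n = T (Q n)"
definition \<mu> :: "nat \<Rightarrow> real" where "\<mu> n = (norm (lam n))\<^sup>2"

lemma Q_basis: "hilbert_basis Q"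
  using F_basis by (simp add: Q_def[abs_def])

lemmas Q_orthonormal = hilbert_basis_orthonormal[OF Q_basis]
lemmas Q_H = orthonormal_H[OF Q_orthonormal]

lemma hp_Q: "hp (Q m) (Q n) = (if m = n then 1 else 0)"
  using Q_orthonormal by (simp add: orthonormal_def)

lemma phi_on_D: "x \<in> D \<Longrightarrow> \<phi> n x = lam n * Q n x"
  using F_eigen[of x n] by (simp add: \<phi>_def Q_def[abs_def])

lemma phi_hp: "\<phi> n x = hp (Q n) (Es x)"
  by (simp add: \<phi>_def T_hp)

lemma Es_coeff: "x \<in> X \<Longrightarrow> hp (Es x) (Q n) = qcnj (\<phi> n x)"
  unfolding phi_hp by (rule hp_commute[OF Es_H Q_H])

lemma phi_H: "\<phi> n \<in> H"
  unfolding \<phi>_def by (rule T_H[OF Q_H])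

lemma phi_bandlimited: "\<phi> n \<in> bandlimited D X E"
  using Q_H by (auto simp: bandlimited_def \<phi>_def)

lemma phi_continuous: "continuous_on X (\<phi> n)"
  unfolding \<phi>_def by (rule T_continuous[OF Q_H])

lemma band_inner_phi: "band_inner D X E (\<phi> m) (\<phi> n) = (if m = n then 1 else 0)"
  using band_inner_eq[of "Q m" "\<phi> m" "Q n" "\<phi> n"] by (simp add: Q_H \<phi>_def hp_Q)

lemma phi_inj: "inj \<phi>"
proof (rule injI)
  fix m n assume "\<phi> m = \<phi> n"
  then show "m = n" using band_inner_phi[of m n] band_inner_phi[of m m] by (auto split: if_splits)
qed

lemma lam_inverse: "inverse (lam n) * (lam n * a) = a"
  using lam_nonzero[of n] by (simp flip: mult.assoc)

lemma mu_lam: "lam n * qcnj (lam n) = of_real (\<mu> n)"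
  by (simp add: quat_mult_qcnj \<mu>_def)

lemma hp_phi: "f \<in> H \<Longrightarrow> hp f (\<phi> n) = hp f (Q n) * qcnj (lam n)"
proof -
  assume f: "f \<in> H"
  have "hp (\<phi> n) f = hp (\<lambda>w. lam n * Q n w) f" by (intro hp_cong phi_on_D refl)
  also have "\<dots> = lam n * hp (Q n) f" by (rule hp_cmult[OF Q_H f])
  finally show ?thesis using hp_commute[OF f phi_H] hp_commute[OF f Q_H] by simp
qed

lemma hp_phi_phi: "hp (\<phi> m) (\<phi> n) = (if m = n then of_real (\<mu> n) else 0)"
proof -
  have "hp (\<phi> m) (\<phi> n) = hp (\<lambda>w. lam m * Q m w) (\<phi> n)" by (intro hp_cong phi_on_D refl)
  also have "\<dots> = lam m * (hp (Q m) (Q n) * qcnj (lam n))" by (simp add: hp_cmult Q_H phi_H hp_phi)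
  finally show ?thesis by (simp add: hp_Q mu_lam)
qed

lemma small_remainder:
  assumes f: "f \<in> H" and e: "\<epsilon> > 0"
  obtains N where "hnorm (remainder Q f N) < \<epsilon>"
proof -
  have "(\<lambda>N. hnorm (remainder Q f N)) \<longlonglongrightarrow> 0" using Q_basis f by (simp add: hilbert_basis_def)
  from order_tendstoD(2)[OF this e] show ?thesis
    using that by (auto simp: eventually_sequentially)
qed

lemma phi_complete_band: "complete_system (bandlimited D X E) (band_norm D X E) (range \<phi>)"
  unfolding complete_system_def
proof (intro conjI ballI allI impI)
  show "range \<phi> \<subseteq> bandlimited D X E" using phi_bandlimited by auto
  fix f \<epsilon> assume f: "f \<in> bandlimited D X E" and e: "\<epsilon> > (0::real)"
  then obtain G where G: "G \<in> H" "\<And>x. x \<in> X \<Longrightarrow> f x = T G x" by (auto simp: bandlimited_def)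
  obtain N where N: "hnorm (remainder Q G N) < \<epsilon>" by (rule small_remainder[OF G(1) e])
  define g where "g = (\<lambda>x. \<Sum>n<N. hp G (Q n) * \<phi> n x)"
  have "band_norm D X E (\<lambda>x. f x - g x) = hnorm (remainder Q G N)"
  proof (rule band_norm_eq[OF remainder_H[OF Q_orthonormal G(1)]])
    fix x assume x: "x \<in> X"
    show "f x - g x = T (remainder Q G N) x"
      unfolding remainder_def g_def G(2)[OF x]
      by (subst T_diff) (auto simp: G x T_combination Q_H \<phi>_def intro: H_combination Q_H)
  qed
  moreover have "g \<in> left_span (range \<phi>)"
    unfolding g_def by (intro left_span_combination phi_inj) simp
  ultimately show "\<exists>g\<in>left_span (range \<phi>). band_norm D X E (\<lambda>x. f x - g x) < \<epsilon>"
    using N by (intro bexI[of _ g]) simp_all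
qed

lemma phi_complete_L2: "complete_system (L2 D) (L2_norm D) (range \<phi>)"
  unfolding complete_system_def
proof (intro conjI ballI allI impI)
  show "range \<phi> \<subseteq> H" using phi_H by auto
  fix f \<epsilon> assume f: "f \<in> H" and e: "\<epsilon> > (0::real)"
  obtain N where N: "hnorm (remainder Q f N) < \<epsilon>" by (rule small_remainder[OF f e])
  define g where "g = (\<lambda>x. \<Sum>n<N. (hp f (Q n) * inverse (lam n)) * \<phi> n x)"
  have "hnorm (\<lambda>x. f x - g x) = hnorm (remainder Q f N)"
    by (intro hnorm_cong) (simp add: g_def remainder_def phi_on_D mult.assoc lam_inverse)
  moreover have "g \<in> left_span (range \<phi>)"
    unfolding g_def by (intro left_span_combination phi_inj) simp
  ultimately show "\<exists>g\<in>left_span (range \<phi>). hnorm (\<lambda>x. f x - g x) < \<epsilon>"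
    using N by (intro bexI[of _ g]) simp_all
qed

lemma T_phi: "x \<in> X \<Longrightarrow> T (\<phi> n) x = lam n * \<phi> n x"
proof -
  assume x: "x \<in> X"
  have "T (\<phi> n) x = hp (\<lambda>w. lam n * Q n w) (Es x)"
    unfolding T_hp by (intro hp_cong phi_on_D refl)
  then show ?thesis by (simp add: hp_cmult Q_H Es_H x phi_hp)
qed

text \<open>
  The transform multiplies every Fourier coefficient by the eigenvalue from the right. After an
  exchange of integrations this is the eigenvalue equation for \<open>Q\<^sub>n\<close>, because \<open>E\<close> is symmetric and
  the real values of \<open>Q\<^sub>n\<close> commute with everything.
\<close>

lemma T_coeff:
  assumes f: "f \<in> H" shows "hp (T f) (Q n) = hp f (Q n) * lam n"
proof -
  have k: "continuous_on (D \<times> D) (\<lambda>(w, x). qcnj (E w x))"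
    using continuous_on_qcnj[OF E_cont_DD] by (simp add: split_beta')
  have "hp (T f) (Q n) = (LINT x|M. LINT w|M. f w * qcnj (E w x) * Q n x)"
    unfolding L2_inner_def transform_def
  proof (intro Bochner_Integration.integral_cong refl)
    fix x assume "x \<in> space M"
    then have "integrable M (\<lambda>w. f w * qcnj (E w x))" by (intro hp_integrable f Es_H D_in_X) simp
    then show "(LINT w|M. f w * qcnj (E w x)) * qcnj (Q n x) = (LINT w|M. f w * qcnj (E w x) * Q n x)"
      by (simp add: Q_def)
  qed
  also have "\<dots> = (LINT w|M. LINT x|M. f w * qcnj (E w x) * Q n x)"
    by (rule Fubini_continuous_kernel[OF sq_int_imp_integrable[OF H_sq_int[OF f]] sq_int_imp_integrable[OF H_sq_int[OF Q_H]] k])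
  also have "\<dots> = (LINT w|M. (f w * qcnj (Q n w)) * lam n)"
  proof (intro Bochner_Integration.integral_cong refl)
    fix w assume "w \<in> space M"
    then have w: "w \<in> D" by simp
    have "(LINT x|M. f w * qcnj (E w x) * Q n x) = (LINT x|M. f w * (Q n x * qcnj (E x w)))"
    proof (intro Bochner_Integration.integral_cong refl)
      fix x assume "x \<in> space M"
      then have "E w x = E x w" using w by (intro E_sym D_in_X) auto
      then show "f w * qcnj (E w x) * Q n x = f w * (Q n x * qcnj (E x w))"
        by (simp add: Q_def of_real_commute mult.assoc)
    qed
    also have "\<dots> = f w * \<phi> n w"
      using hp_integrable[OF Q_H Es_H[OF D_in_X[OF w]], of n] by (simp add: \<phi>_def transform_def)
    also have "\<dots> = (f w * qcnj (Q n w)) * lam n"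
      unfolding phi_on_D[OF w] by (simp add: Q_def of_real_commute mult.assoc)
    finally show "(LINT x|M. f w * qcnj (E w x) * Q n x) = (f w * qcnj (Q n w)) * lam n" .
  qed
  also have "\<dots> = hp f (Q n) * lam n"
    using hp_integrable[OF f Q_H, of n] by (simp add: L2_inner_def)
  finally show ?thesis .
qed

lemma qcnj_S: "x \<in> X \<Longrightarrow> y \<in> X \<Longrightarrow> qcnj (S x y) = S x y"
  using S_real[of x y] by (auto elim: Reals_cases)

text \<open>
  As \<open>S\<close> is real, \<open>S x y\<close> is the conjugate of the transform of \<open>E(\<cdot>, x)\<close> at \<open>y\<close>. The integral is therefore
  an inner product of \<open>\<phi>\<^sub>n\<close> with a transform, whose Fourier coefficients \<open>T_coeff\<close> gives.
\<close>

lemma integral_phi_S: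
  assumes x: "x \<in> X" shows "(LINT y|M. \<phi> n y * S x y) = of_real (\<mu> n) * \<phi> n x"
proof -
  have "S x y = qcnj (T (Es x) y)" if y: "y \<in> D" for y
  proof -
    have "S x y = qcnj (hp (Es y) (Es x))" using qcnj_S[OF x D_in_X[OF y]] by (simp add: S_hp)
    also have "hp (Es y) (Es x) = qcnj (hp (Es x) (Es y))" by (rule hp_commute[OF Es_H[OF D_in_X[OF y]] Es_H[OF x]])
    finally show ?thesis using qcnj_S[OF x D_in_X[OF y]] by (simp add: T_hp S_hp)
  qed
  then have "(LINT y|M. \<phi> n y * S x y) = hp (\<phi> n) (T (Es x))"
    unfolding L2_inner_def by (intro Bochner_Integration.integral_cong) auto
  also have "\<dots> = qcnj (hp (T (Es x)) (\<phi> n))" by (rule hp_commute[OF phi_H T_H[OF Es_H[OF x]]])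
  also have "hp (T (Es x)) (\<phi> n) = qcnj (\<phi> n x) * (lam n * qcnj (lam n))"
    by (simp add: hp_phi T_H Es_H x T_coeff Es_coeff mult.assoc)
  finally show ?thesis by (simp add: mu_lam)
qed

lemma E_expansion:
  assumes x: "x \<in> X"
  shows "(\<lambda>N. hnorm (\<lambda>\<omega>. E \<omega> x - (\<Sum>n<N. qcnj (\<phi> n x) * inverse (lam n) * \<phi> n \<omega>))) \<longlonglongrightarrow> 0"
proof -
  have "hnorm (\<lambda>\<omega>. E \<omega> x - (\<Sum>n<N. qcnj (\<phi> n x) * inverse (lam n) * \<phi> n \<omega>)) = hnorm (remainder Q (Es x) N)" for N
    by (intro hnorm_cong) (simp add: remainder_def phi_on_D mult.assoc lam_inverse Es_coeff x)
  then show ?thesis using Q_basis Es_H[OF x] by (simp add: hilbert_basis_def)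
qed

lemma S_expansion: "x \<in> X \<Longrightarrow> y \<in> X \<Longrightarrow> (\<lambda>n. qcnj (\<phi> n y) * \<phi> n x) sums S x y"
  using Parseval[OF Q_basis Es_H Es_H, of y x] by (simp add: Es_coeff S_hp)

lemma S_expansion_summable: "x \<in> X \<Longrightarrow> y \<in> X \<Longrightarrow> summable (\<lambda>n. norm (qcnj (\<phi> n y) * \<phi> n x))"
  using hp_summable_norm[OF Q_orthonormal Es_H Es_H, of y x] by (simp add: Es_coeff)

text \<open>
  The error of the \<open>N\<close>-th partial sum at \<open>(x, y)\<close> is the inner product of the Fourier remainders
  of the sections of \<open>E\<close>, whose norms decrease to zero and depend continuously on the point; so
  Dini's theorem makes the convergence uniform on compact sets.
\<close>

lemma S_expansion_uniform:
  assumes X1: "compact X1" "X1 \<subseteq> X" and X2: "compact X2" "X2 \<subseteq> X"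
  shows "uniform_limit (X1 \<times> X2) (\<lambda>N (x, y). \<Sum>n<N. qcnj (\<phi> n y) * \<phi> n x) (\<lambda>(x, y). S x y) sequentially"
  unfolding uniform_limit_sequentially_iff
proof (intro allI impI)
  fix e :: real assume e: "e > 0"
  define \<rho> where "\<rho> N x = (hnorm (remainder Q (Es x) N))\<^sup>2" for N x
  have \<rho>_eq: "\<rho> N x = q0 (S x x) - (\<Sum>n<N. (norm (\<phi> n x))\<^sup>2)" if "x \<in> X" for N x
    using hnorm_remainder[OF Q_orthonormal Es_H[OF that], of N] that
    by (simp add: \<rho>_def Es_coeff S_hp hp_self_hnorm del: of_real_power)
  have sub: "X1 \<union> X2 \<subseteq> X" using X1 X2 by auto
  have "\<exists>N. \<forall>n\<ge>N. \<forall>x\<in>X1 \<union> X2. \<rho> n x < e"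
  proof (rule Dini_decreasing[OF compact_Un[OF X1(1) X2(1)] _ _ _ e])
    show "continuous_on (X1 \<union> X2) (\<rho> n)" for n
    proof -
      have "continuous_on X (\<lambda>x. q0 (S x x) - (\<Sum>k<n. (norm (\<phi> k x))\<^sup>2))"
        by (intro continuous_intros bounded_linear.continuous_on[OF bounded_linear_quat_components(1)]
            S_diagonal_continuous phi_continuous)
      then have "continuous_on X (\<rho> n)" by (subst continuous_on_cong[OF refl \<rho>_eq]) auto
      then show ?thesis using sub by (rule continuous_on_subset)
    qed
    show "\<rho> (Suc n) x \<le> \<rho> n x" if "x \<in> X1 \<union> X2" for n x
      using \<rho>_eq[of x] that sub by auto
    show "(\<lambda>n. \<rho> n x) \<longlonglongrightarrow> 0" if x: "x \<in> X1 \<union> X2" for x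
    proof -
      have "(\<lambda>N. hnorm (remainder Q (Es x) N)) \<longlonglongrightarrow> 0"
        using Q_basis Es_H x sub by (auto simp: hilbert_basis_def)
      from tendsto_power[OF this, of 2] show ?thesis by (simp add: \<rho>_def)
    qed
  qed
  then obtain N where N: "\<And>n x. n \<ge> N \<Longrightarrow> x \<in> X1 \<union> X2 \<Longrightarrow> \<rho> n x < e" by blast
  have "dist (\<Sum>n<m. qcnj (\<phi> n y) * \<phi> n x) (S x y) < e" if m: "m \<ge> N" and xy: "x \<in> X1" "y \<in> X2" for m x y
  proof -
    have X: "x \<in> X" "y \<in> X" using xy X1 X2 by auto
    note r = remainder_H[OF Q_orthonormal Es_H[OF X(1)], of m] remainder_H[OF Q_orthonormal Es_H[OF X(2)], of m]
    have lt: "hnorm (remainder Q (Es x) m) < sqrt e" "hnorm (remainder Q (Es y) m) < sqrt e"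
      using N[OF m, of x] N[OF m, of y] xy by (auto simp: \<rho>_def intro: real_less_rsqrt)
    have "S x y - (\<Sum>n<m. qcnj (\<phi> n y) * \<phi> n x) = hp (remainder Q (Es y) m) (remainder Q (Es x) m)"
      using hp_remainder_remainder[OF Q_orthonormal Es_H[OF X(2)] Es_H[OF X(1)], of m] X
      by (simp add: S_hp Es_coeff)
    then have "dist (\<Sum>n<m. qcnj (\<phi> n y) * \<phi> n x) (S x y) = norm (hp (remainder Q (Es y) m) (remainder Q (Es x) m))"
      by (simp add: dist_commute dist_norm)
    also have "\<dots> \<le> hnorm (remainder Q (Es y) m) * hnorm (remainder Q (Es x) m)"
      by (rule hp_Cauchy_Schwarz[OF r(2,1)])
    also have "\<dots> < sqrt e * sqrt e" using lt e by (intro mult_strict_mono) auto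
    finally show ?thesis using e by simp
  qed
  then show "\<exists>N. \<forall>n\<ge>N. \<forall>z\<in>X1 \<times> X2. dist ((\<lambda>(x, y). \<Sum>n<n. qcnj (\<phi> n y) * \<phi> n x) z) ((\<lambda>(x, y). S x y) z) < e"
    by (intro exI[of _ N]) auto
qed

text \<open>
  If \<open>f\<close> is the transform of \<open>G\<close>, the samples \<open>f (p n)\<close>, \<open>S x (p n)\<close> and \<open>\<phi> m (p n)\<close> are, up to conjugation,
  the Fourier coefficients of \<open>G\<close>, \<open>E(\<cdot>, x)\<close> and \<open>Q\<^sub>m\<close> with respect to the basis of the sections at the
  sampling points; so Parseval's identity for this basis and for \<open>Q\<close> gives all four claims.
\<close>

lemma sampling:
  assumes p: "range p \<subseteq> X" and basis: "L2_orthonormal_basis D (\<lambda>n \<omega>. E \<omega> (p n))"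
  shows "f \<in> bandlimited D X E \<Longrightarrow> x \<in> X \<Longrightarrow> (\<lambda>n. f (p n) * S x (p n)) sums f x"
    and "f \<in> bandlimited D X E \<Longrightarrow> summable (\<lambda>m. f (p m) * qcnj (\<phi> n (p m)))"
    and "f \<in> bandlimited D X E \<Longrightarrow> x \<in> X \<Longrightarrow> (\<lambda>n. (\<Sum>m. f (p m) * qcnj (\<phi> n (p m))) * \<phi> n x) sums f x"
    and "(\<lambda>n. qcnj (\<phi> n (p l)) * \<phi> n (p m)) sums (if m = l then 1 else 0)"
proof -
  have pX: "p n \<in> X" for n using p by auto
  have e: "hilbert_basis (\<lambda>n \<omega>. E \<omega> (p n))" by (rule hilbert_basisI[OF Es_H[OF pX] basis])
  {
    assume f: "f \<in> bandlimited D X E"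
    then obtain G where G: "G \<in> H" "\<And>x. x \<in> X \<Longrightarrow> f x = hp G (Es x)" by (auto simp: bandlimited_def T_hp)
    have sm: "(\<lambda>m. f (p m) * qcnj (\<phi> n (p m))) sums hp G (Q n)" for n
      using Parseval[OF e G(1) Q_H, of n] by (simp add: G(2) pX phi_hp)
    then show "summable (\<lambda>m. f (p m) * qcnj (\<phi> n (p m)))" by (rule sums_summable)
    show "(\<lambda>n. f (p n) * S x (p n)) sums f x" if x: "x \<in> X"
    proof -
      have "(\<lambda>n. hp G (Es (p n)) * qcnj (hp (Es x) (Es (p n)))) sums hp G (Es x)"
        by (rule Parseval[OF e G(1) Es_H[OF x]])
      moreover have "qcnj (hp (Es x) (Es (p n))) = S x (p n)" for n
        using hp_commute[OF Es_H[OF pX] Es_H[OF x], of n] by (simp add: S_hp)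
      ultimately show ?thesis by (simp add: G(2) x pX)
    qed
    show "(\<lambda>n. (\<Sum>m. f (p m) * qcnj (\<phi> n (p m))) * \<phi> n x) sums f x" if x: "x \<in> X"
      using Parseval[OF Q_basis G(1) Es_H[OF x]] sm[THEN sums_unique] by (simp add: G(2) x Es_coeff)
  }
  have "S (p m) (p l) = (if m = l then 1 else 0)"
    using hilbert_basis_orthonormal[OF e] by (auto simp: orthonormal_def S_hp)
  then show "(\<lambda>n. qcnj (\<phi> n (p l)) * \<phi> n (p m)) sums (if m = l then 1 else 0)"
    using S_expansion[OF pX pX, of l m] by simp
qed

lemma trace_integrable: "integrable M (\<lambda>x. S x x)"
  by (intro sq_int_imp_integrable continuous_sq_int continuous_on_subset[OF S_diagonal_continuous D_subset])

text \<open>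
  On the diagonal the terms of the expansion are the nonnegative functions \<open>|\<phi>\<^sub>n(x)|\<^sup>2\<close>, so the partial
  sums are dominated by \<open>S x x\<close> and may be integrated term by term.
\<close>

lemma trace_formula: "(LINT x|M. S x x) = of_real (\<Sum>n. \<mu> n)"
proof -
  have partial: "(\<Sum>n<N. qcnj (\<phi> n x) * \<phi> n x) = of_real (\<Sum>n<N. (norm (\<phi> n x))\<^sup>2)" for N x
    by (simp add: qcnj_mult_self)
  have int: "integrable M (\<lambda>x. qcnj (\<phi> n x) * \<phi> n x)" for n
    by (intro sq_int_mult_integrable sq_int_qcnj H_sq_int phi_H)
  have "(\<lambda>N. LINT x|M. (\<Sum>n<N. qcnj (\<phi> n x) * \<phi> n x)) \<longlonglongrightarrow> (LINT x|M. S x x)"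
  proof (rule integral_dominated_convergence[where w = "\<lambda>x. norm (S x x)"])
    show "(\<lambda>x. S x x) \<in> borel_measurable M" using trace_integrable by auto
    show "(\<lambda>x. \<Sum>n<N. qcnj (\<phi> n x) * \<phi> n x) \<in> borel_measurable M" for N
      using int by (intro borel_measurable_integrable Bochner_Integration.integrable_sum)
    show "integrable M (\<lambda>x. norm (S x x))" using trace_integrable by simp
    show "AE x in M. (\<lambda>N. \<Sum>n<N. qcnj (\<phi> n x) * \<phi> n x) \<longlonglongrightarrow> S x x"
      using S_expansion D_in_X by (intro AE_I2) (auto simp: sums_def)
    show "AE x in M. norm (\<Sum>n<N. qcnj (\<phi> n x) * \<phi> n x) \<le> norm (S x x)" for N
    proof (intro AE_I2)
      fix x assume "x \<in> space M"
      then have x: "x \<in> X" using D_in_X by simp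
      have "(\<Sum>n<N. (norm (\<phi> n x))\<^sup>2) \<le> (hnorm (Es x))\<^sup>2"
        using hp_Bessel[OF Q_orthonormal Es_H[OF x], of N] by (simp add: Es_coeff x)
      moreover have "S x x = of_real ((hnorm (Es x))\<^sup>2)" by (simp only: S_hp hp_self_hnorm)
      ultimately show "norm (\<Sum>n<N. qcnj (\<phi> n x) * \<phi> n x) \<le> norm (S x x)"
        unfolding partial by (simp only: norm_of_real) (simp add: sum_nonneg)
    qed
  qed
  moreover have "(LINT x|M. (\<Sum>n<N. qcnj (\<phi> n x) * \<phi> n x)) = of_real (\<Sum>n<N. \<mu> n)" for N
  proof -
    have "(LINT x|M. qcnj (\<phi> n x) * \<phi> n x) = hp (\<phi> n) (\<phi> n)" for n
      by (simp only: L2_inner_def qcnj_mult_self quat_mult_qcnj)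
    then show ?thesis by (simp add: Bochner_Integration.integral_sum int hp_phi_phi)
  qed
  moreover have "(\<lambda>N. of_real (\<Sum>n<N. \<mu> n) :: quat) \<longlonglongrightarrow> of_real (\<Sum>n. \<mu> n)"
    using lam_summable by (intro tendsto_of_real summable_LIMSEQ) (simp add: \<mu>_def)
  ultimately show ?thesis by (simp add: LIMSEQ_unique)
qed

lemma mu_decreasing: "m \<le> n \<Longrightarrow> \<mu> n \<le> \<mu> m"
  unfolding \<mu>_def
  using lift_Suc_antimono_le[of "\<lambda>n. norm (lam n)", OF lam_decreasing] by (intro power_mono) simp_all

lemma hnorm_bandlimited_le:
  assumes f: "f \<in> bandlimited D X E"
  shows "(hnorm f)\<^sup>2 \<le> \<mu> 0 * (band_norm D X E f)\<^sup>2"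
proof -
  obtain G where G: "G \<in> H" "\<And>x. x \<in> X \<Longrightarrow> f x = T G x" using f by (auto simp: bandlimited_def)
  have "hnorm f = hnorm (T G)" by (intro hnorm_cong G D_in_X)
  moreover have "(hnorm (T G))\<^sup>2 \<le> \<mu> 0 * (hnorm G)\<^sup>2"
  proof (rule sums_le)
    show "(\<lambda>n. (norm (hp (T G) (Q n)))\<^sup>2) sums (hnorm (T G))\<^sup>2"
      by (rule Parseval_norm[OF Q_basis T_H[OF G(1)]])
    show "(\<lambda>n. \<mu> 0 * (norm (hp G (Q n)))\<^sup>2) sums (\<mu> 0 * (hnorm G)\<^sup>2)"
      by (intro sums_mult Parseval_norm[OF Q_basis G(1)])
    show "(norm (hp (T G) (Q n)))\<^sup>2 \<le> \<mu> 0 * (norm (hp G (Q n)))\<^sup>2" for n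
      using mu_decreasing[of 0 n] by (simp add: T_coeff G norm_mult power_mult_distrib mult.commute mult_right_mono flip: \<mu>_def)
  qed
  ultimately show ?thesis by (simp add: band_norm_eq[OF G])
qed

lemma concentration_le:
  assumes f: "f \<in> bandlimited D X E" "band_norm D X E f \<noteq> 0"
  shows "concentration D X E f \<le> \<mu> 0"
  using hnorm_bandlimited_le[OF f(1)] f(2) by (simp add: concentration_def divide_le_eq)

lemma concentration_phi_0: "band_norm D X E (\<phi> 0) = 1" "concentration D X E (\<phi> 0) = \<mu> 0"
proof -
  show b: "band_norm D X E (\<phi> 0) = 1" unfolding band_norm_def band_inner_phi by simp
  have "(hnorm (\<phi> 0))\<^sup>2 = \<mu> 0"
    using hp_phi_phi[of 0 0] unfolding hp_self_hnorm by (simp only: of_real_eq_iff if_True simp_thms)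
  then show "concentration D X E (\<phi> 0) = \<mu> 0" by (simp add: concentration_def b)
qed

end

text \<open>
  The transform conjugates \<open>E\<close>; hence the signs in \<open>lam\<close>. Its squared norm is the eigenvalue of the
  sum of squares by which the eigenfunctions are ordered.
\<close>

lemma (in quaternionic_kernel) prolate_functions_exist:
  obtains F lam where "prolate_functions D X E F lam"
proof -
  obtain F :: "nat \<Rightarrow> 'a \<Rightarrow> real" and t :: "nat \<Rightarrow> nat \<Rightarrow> real" where
    F: "\<And>n. continuous_on D (F n)" "\<And>m n. ip (F m) (F n) = (if m = n then 1 else 0)"
    and eig: "\<And>i n x. i \<in> {0, 1, 2, 3} \<Longrightarrow> x \<in> D \<Longrightarrow> kernel_op (K i) (F n) x = t i n * F n x"
    and dec: "\<And>n. (\<Sum>i\<in>{0, 1, 2, 3}. (t i (Suc n))\<^sup>2) \<le> (\<Sum>i\<in>{0, 1, 2, 3}. (t i n)\<^sup>2)"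
    and pos: "\<And>n. (\<Sum>i\<in>{0, 1, 2, 3}. (t i n)\<^sup>2) > 0"
    and summ: "summable (\<lambda>n. \<Sum>i\<in>{0, 1, 2, 3}. (t i n)\<^sup>2)"
    and complete: "\<And>u. u \<in> L \<Longrightarrow> (\<lambda>N. sqn (\<lambda>x. u x - (\<Sum>n<N. ip u (F n) * F n x))) \<longlonglongrightarrow> 0"
    by (rule simultaneous_diagonalization) blast
  have FL: "F n \<in> L" for n by (rule continuous_sq_int[OF F(1)])
  define lam where "lam n = Quat (t 0 n) (- t 1 n) (- t 2 n) (- t 3 n)" for n
  have norm_lam: "(norm (lam n))\<^sup>2 = (\<Sum>i\<in>{0, 1, 2, 3}. (t i n)\<^sup>2)" for n
    by (simp add: norm_quat_power2 lam_def)
  have "prolate_functions D X E F lam"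
  proof
    show "F n \<in> L" for n by (rule FL)
    show "hilbert_basis (\<lambda>n w. of_real (F n w))" by (rule real_basis_hilbert_basis[OF FL F(2) complete])
    show "T (\<lambda>w. of_real (F n w)) x = lam n * of_real (F n x)" if "x \<in> D" for n x
      using that eig by (simp add: T_of_real[OF FL D_in_X] quat_eq_iff lam_def)
    show "norm (lam (Suc n)) \<le> norm (lam n)" for n
    proof (rule power2_le_imp_le)
      show "(norm (lam (Suc n)))\<^sup>2 \<le> (norm (lam n))\<^sup>2" unfolding norm_lam by (rule dec)
    qed simp
    show "lam n \<noteq> 0" for n
    proof
      assume "lam n = 0"
      then show False using pos[of n] unfolding norm_lam[symmetric] by simp
    qed
    show "summable (\<lambda>n. (norm (lam n))\<^sup>2)" unfolding norm_lam by (rule summ)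
  qed
  then show ?thesis by (rule that)
qed

theorem theorem4p4:
  fixes D X :: "'a::euclidean_space set" and E :: "'a \<Rightarrow> 'a \<Rightarrow> quat"
  assumes "compact D" and "connected D"
    and "open X" and "connected X" and "D \<subseteq> X"
    and E_cont: "continuous_on (X \<times> X) (\<lambda>(\<omega>, x). E \<omega> x)"
    and i: "\<forall>\<omega>\<in>X. \<forall>x\<in>X. E \<omega> x = E x \<omega>"
    and ii: "{\<lambda>\<omega>. E \<omega> x | x. x \<in> X} \<subseteq> L2 D"
      "\<forall>u\<in>L2_perp D {\<lambda>\<omega>. E \<omega> x | x. x \<in> X}. AE \<omega> in lebesgue_on D. u \<omega> = 0"
    and iii: "\<forall>x\<in>X. \<forall>y\<in>X. kernel_S D E x y \<in> \<real>"
    and iv: "\<forall>x\<in>X. \<forall>y\<in>X.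
      (LINT \<omega>|lebesgue_on D. E \<omega> y * qcnj (E \<omega> x)) = (LINT \<omega>|lebesgue_on D. qcnj (E \<omega> x) * E \<omega> y)"
    \<comment> \<open>not in the source, where they are tacit: without either one the conclusion fails\<close>
    and D_nonnull: "\<not> negligible D"
    and restr_inj: "\<forall>F\<in>L2 D. (AE x in lebesgue_on D. transform D E F x = 0) \<longrightarrow>
      (AE \<omega> in lebesgue_on D. F \<omega> = 0)"
  shows "\<exists>(\<phi> :: nat \<Rightarrow> 'a \<Rightarrow> quat) (lam :: nat \<Rightarrow> quat) (\<mu> :: nat \<Rightarrow> real).
    (\<forall>n. norm (lam (Suc n)) \<le> norm (lam n)) \<and>
    (\<forall>n. lam n \<noteq> 0) \<and>
    (\<forall>n. \<mu> n = (norm (lam n))\<^sup>2) \<and>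
    \<comment> \<open>1\<close>
    (\<forall>n. \<phi> n \<in> bandlimited D X E) \<and>
    (\<forall>m n. band_inner D X E (\<phi> m) (\<phi> n) = (if m = n then 1 else 0)) \<and>
    complete_system (bandlimited D X E) (band_norm D X E) (range \<phi>) \<and>
    \<comment> \<open>2\<close>
    (\<forall>n. \<phi> n \<in> L2 D) \<and>
    (\<forall>m n. (LINT \<omega>|lebesgue_on D. \<phi> m \<omega> * qcnj (\<phi> n \<omega>)) = (if m = n then of_real (\<mu> n) else 0)) \<and>
    complete_system (L2 D) (L2_norm D) (range \<phi>) \<and>
    \<comment> \<open>3\<close>
    (\<forall>x\<in>X. \<forall>n. (LINT \<omega>|lebesgue_on D. \<phi> n \<omega> * qcnj (E \<omega> x)) = lam n * \<phi> n x) \<and>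
    (\<forall>x\<in>X. \<forall>n. (LINT y|lebesgue_on D. \<phi> n y * kernel_S D E x y) = of_real (\<mu> n) * \<phi> n x) \<and>
    \<comment> \<open>4\<close>
    (\<forall>n. \<forall>X1. compact X1 \<and> X1 \<subseteq> X \<longrightarrow> uniformly_continuous_on X1 (\<phi> n)) \<and>
    (\<forall>n. continuous_on X (\<phi> n)) \<and>
    \<comment> \<open>5\<close>
    (\<forall>x\<in>X. (\<lambda>N. L2_norm D (\<lambda>\<omega>. E \<omega> x - (\<Sum>n<N. qcnj (\<phi> n x) * inverse (lam n) * \<phi> n \<omega>)))
        \<longlonglongrightarrow> 0) \<and>
    (\<forall>x\<in>X. \<forall>y\<in>X. (\<lambda>n. qcnj (\<phi> n y) * \<phi> n x) sums kernel_S D E x y) \<and>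
    (\<forall>x\<in>X. \<forall>y\<in>X. summable (\<lambda>n. norm (qcnj (\<phi> n y) * \<phi> n x))) \<and>
    (bounded ((\<lambda>(\<omega>, x). E \<omega> x) ` (D \<times> X)) \<longrightarrow>
      (\<forall>X1 X2. compact X1 \<and> X1 \<subseteq> X \<and> compact X2 \<and> X2 \<subseteq> X \<longrightarrow>
        uniform_limit (X1 \<times> X2) (\<lambda>N (x, y). \<Sum>n<N. qcnj (\<phi> n y) * \<phi> n x)
          (\<lambda>(x, y). kernel_S D E x y) sequentially)) \<and>
    \<comment> \<open>6 and the first half of 7\<close>
    (\<forall>p :: nat \<Rightarrow> 'a. range p \<subseteq> X \<and> L2_orthonormal_basis D (\<lambda>n \<omega>. E \<omega> (p n)) \<longrightarrow>
      (\<forall>f\<in>bandlimited D X E. \<forall>x\<in>X.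
        (\<lambda>n. f (p n) * kernel_S D E x (p n)) sums f x \<and>
        (\<forall>n. summable (\<lambda>m. f (p m) * qcnj (\<phi> n (p m)))) \<and>
        (\<lambda>n. (\<Sum>m. f (p m) * qcnj (\<phi> n (p m))) * \<phi> n x) sums f x) \<and>
      (\<forall>l m. (\<lambda>n. qcnj (\<phi> n (p l)) * \<phi> n (p m)) sums (if m = l then 1 else 0))) \<and>
    \<comment> \<open>second half of 7\<close>
    integrable (lebesgue_on D) (\<lambda>x. kernel_S D E x x) \<and>
    summable \<mu> \<and>
    (LINT x|lebesgue_on D. kernel_S D E x x) = of_real (\<Sum>n. \<mu> n) \<and>
    \<comment> \<open>8\<close>
    bandlimited D X E \<subseteq> L2 D \<and>
    bdd_above (concentration D X E ` {f \<in> bandlimited D X E. band_norm D X E f \<noteq> 0}) \<and>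
    Sup (concentration D X E ` {f \<in> bandlimited D X E. band_norm D X E f \<noteq> 0}) = \<mu> 0"
proof -
  interpret quaternionic_kernel D X E
    using assms by unfold_locales auto
  obtain F lam where "prolate_functions D X E F lam" by (rule prolate_functions_exist)
  then interpret prolate_functions D X E F lam .
  show ?thesis
  proof (intro exI[of _ \<phi>] exI[of _ lam] exI[of _ \<mu>] conjI allI ballI impI; (elim conjE)?)
    show "norm (lam (Suc n)) \<le> norm (lam n)" for n by (rule lam_decreasing)
    show "lam n \<noteq> 0" for n by (rule lam_nonzero)
    show "\<mu> n = (norm (lam n))\<^sup>2" for n by (rule \<mu>_def)
    show "\<phi> n \<in> bandlimited D X E" for n by (rule phi_bandlimited)
    show "band_inner D X E (\<phi> m) (\<phi> n) = (if m = n then 1 else 0)" for m n by (rule band_inner_phi)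
    show "complete_system (bandlimited D X E) (band_norm D X E) (range \<phi>)" by (rule phi_complete_band)
    show "\<phi> n \<in> L2 D" for n by (rule phi_H)
    show "(LINT \<omega>|lebesgue_on D. \<phi> m \<omega> * qcnj (\<phi> n \<omega>)) = (if m = n then of_real (\<mu> n) else 0)" for m n
      using hp_phi_phi[of m n] unfolding L2_inner_def .
    show "complete_system (L2 D) (L2_norm D) (range \<phi>)" by (rule phi_complete_L2)
    show "(LINT \<omega>|lebesgue_on D. \<phi> n \<omega> * qcnj (E \<omega> x)) = lam n * \<phi> n x" if "x \<in> X" for x n
      using T_phi[OF that, of n] unfolding transform_def .
    show "(LINT y|lebesgue_on D. \<phi> n y * kernel_S D E x y) = of_real (\<mu> n) * \<phi> n x" if "x \<in> X" for x n
      by (rule integral_phi_S[OF that])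
    show "uniformly_continuous_on X1 (\<phi> n)" if "compact X1" "X1 \<subseteq> X" for n X1
      by (intro compact_uniformly_continuous continuous_on_subset[OF phi_continuous] that)
    show "continuous_on X (\<phi> n)" for n by (rule phi_continuous)
    show "(\<lambda>N. L2_norm D (\<lambda>\<omega>. E \<omega> x - (\<Sum>n<N. qcnj (\<phi> n x) * inverse (lam n) * \<phi> n \<omega>))) \<longlonglongrightarrow> 0"
      if "x \<in> X" for x by (rule E_expansion[OF that])
    show "(\<lambda>n. qcnj (\<phi> n y) * \<phi> n x) sums kernel_S D E x y" if "x \<in> X" "y \<in> X" for x y
      by (rule S_expansion[OF that])
    show "summable (\<lambda>n. norm (qcnj (\<phi> n y) * \<phi> n x))" if "x \<in> X" "y \<in> X" for x y
      by (rule S_expansion_summable[OF that])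
    show "uniform_limit (X1 \<times> X2) (\<lambda>N (x, y). \<Sum>n<N. qcnj (\<phi> n y) * \<phi> n x) (\<lambda>(x, y). kernel_S D E x y) sequentially"
      if "compact X1" "X1 \<subseteq> X" "compact X2" "X2 \<subseteq> X" for X1 X2
      by (rule S_expansion_uniform[OF that])
    fix p :: "nat \<Rightarrow> 'a"
    assume p: "range p \<subseteq> X" "L2_orthonormal_basis D (\<lambda>n \<omega>. E \<omega> (p n))"
    show "(\<lambda>n. f (p n) * kernel_S D E x (p n)) sums f x" if "f \<in> bandlimited D X E" "x \<in> X" for f x
      by (rule sampling(1)[OF p that])
    show "summable (\<lambda>m. f (p m) * qcnj (\<phi> n (p m)))" if "f \<in> bandlimited D X E" for f n
      by (rule sampling(2)[OF p that])
    show "(\<lambda>n. (\<Sum>m. f (p m) * qcnj (\<phi> n (p m))) * \<phi> n x) sums f x" if "f \<in> bandlimited D X E" "x \<in> X" for f x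
      by (rule sampling(3)[OF p that])
    show "(\<lambda>n. qcnj (\<phi> n (p l)) * \<phi> n (p m)) sums (if m = l then 1 else 0)" for l m
      by (rule sampling(4)[OF p])
  next
    show "integrable (lebesgue_on D) (\<lambda>x. kernel_S D E x x)" by (rule trace_integrable)
    show "summable \<mu>" using lam_summable by (simp add: \<mu>_def[abs_def])
    show "(LINT x|lebesgue_on D. kernel_S D E x x) = of_real (\<Sum>n. \<mu> n)" by (rule trace_formula)
    show "bandlimited D X E \<subseteq> L2 D" using bandlimited_H by auto
    show "bdd_above (concentration D X E ` {f \<in> bandlimited D X E. band_norm D X E f \<noteq> 0})"
      using concentration_le by (intro bdd_aboveI2[of _ _ "\<mu> 0"]) auto
    show "Sup (concentration D X E ` {f \<in> bandlimited D X E. band_norm D X E f \<noteq> 0}) = \<mu> 0"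
    proof (rule cSup_eq_maximum)
      show "\<mu> 0 \<in> concentration D X E ` {f \<in> bandlimited D X E. band_norm D X E f \<noteq> 0}"
        using concentration_phi_0 phi_bandlimited by (intro image_eqI[of _ _ "\<phi> 0"]) auto
    qed (use concentration_le in auto)
  qed
qed

end
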